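(* Let $X\subset \mathbb{P}^N$ be a projective variety over $K$ of dimension $n\geq 1$. Let $D_1,\ldots, D_q$ be hypersurfaces in $\mathbb{P}^N$ over $K$ that are in general position with $X$. Let $M$ be a positive integer such that for any subset $I\subset \{1,\ldots, q\}$ of cardinality $|I|=n$, $$\bigcap_{i\in I}D_i\cap X\subset M\operatorname{Supp} \left(\bigcap_{i\in I}D_i\cap X\right),$$ where $D_1,\ldots, D_q$, and $X$ are viewed as closed subschemes of $\mathbb{P}^N$. Let $f:K\to X$ be a nonconstant analytic map whose image is not completely contained in any of the hypersurfaces $D_1,\ldots, D_q$. Then for all $r\geq 1$, $$\sum_{i=1}^q \frac{m_f(r,D_i)}{\deg D_i}\leq \left(n-1+\max_{1\le i\le q} \frac{M}{\deg D_i}\right)T_f(r)+O(1),$$ where the implied constant in $O(1)$ is independent of $r$.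
   Context: $K$ is an algebraically closed field, of arbitrary characteristic, complete with respect to a non-archimedean absolute value $|\cdot|$. An entire function on $K$ is a power series $g(z)=\sum_{i\ge 0} a_iz^i$ with coefficients in $K$ converging on all of $K$; for real $r\geq 0$ put $|g|_r=\sup_i |a_i|r^i$. An analytic map $f:K\to\mathbb{P}^N$ is written $f=(f_0,\ldots,f_N)$ with $f_0,\ldots,f_N$ entire functions without a common zero; a map $f:K\to X$ is an analytic map to $\mathbb{P}^N$ with image in $X$. Put $\|f\|_r=\max\{|f_0|_r,\ldots,|f_N|_r\}$. The characteristic function is $T_f(r)=\log\|f\|_r$, well defined up to an additive constant independently of the representation of $f$. A hypersurface $D\subset\mathbb{P}^N$ of degree $d\geq 1$ is the closed subscheme defined by a homogeneous polynomial $Q\in K[x_0,\ldots,x_N]$ of degree $d$. If $Q\circ f=Q(f_0,\ldots,f_N)\not\equiv 0$, the proximity function is $$m_f(r,D)=\log\frac{\|f\|_r^d}{|Q\circ f|_r},$$ which depends on the choice of $Q$ only up to an additive constant. General position: $D_1,\ldots,D_q$ are in general position with $X$ (where $\dim X=n$) if $\dim\left(\bigcap_{i\in I}D_i\cap X\right)\leq n-|I|$ for every subset $I\subset\{1,\ldots,q\}$ of cardinality $|I|\leq n+1$, where $\dim\emptyset=-1$. Subscheme conventions: for closed subschemes $Y,Z$ of $\mathbb{P}^N$ with ideal sheaves $\mathcal{I}_Y,\mathcal{I}_Z$, write $Y\subset Z$ if $\mathcal{I}_Z\subset\mathcal{I}_Y$; $Y\cap Z$ is the closed subscheme with ideal sheaf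 $\mathcal{I}_Y+\mathcal{I}_Z$; for a positive integer $M$, $MZ$ is the closed subscheme with ideal sheaf $\mathcal{I}_Z^M$; $\operatorname{Supp}Z$ is the closed subscheme with the same underlying set as $Z$ and the reduced induced scheme structure. *)

theory Defs
  imports
    "HOL-Analysis.Analysis"
    "HOL-Library.Poly_Mapping"
    "HOL-Computational_Algebra.Computational_Algebra"
    "HOL-Algebra.Ideal_Product"
begin

section \<open>Non-archimedean absolute values and entire functions\<close>

definition nonarch_absval :: "('k::field \<Rightarrow> real) \<Rightarrow> bool" where
  "nonarch_absval v \<longleftrightarrow>
     (\<forall>x. 0 \<le> v x) \<and> (\<forall>x. v x = 0 \<longleftrightarrow> x = 0) \<and>
     (\<forall>x y. v (x * y) = v x * v y) \<and> (\<forall>x y. v (x + y) \<le> max (v x) (v y))"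

definition complete_absval :: "('k::field \<Rightarrow> real) \<Rightarrow> bool" where
  "complete_absval v \<longleftrightarrow> Metric_space.mcomplete UNIV (\<lambda>x y. v (x - y))"

definition fps_converges_to :: "('k::field \<Rightarrow> real) \<Rightarrow> 'k fps \<Rightarrow> 'k \<Rightarrow> 'k \<Rightarrow> bool" where
  "fps_converges_to v g z l \<longleftrightarrow> (\<lambda>m. v ((\<Sum>i<m. fps_nth g i * z ^ i) - l)) \<longlonglongrightarrow> 0"

definition entire :: "('k::field \<Rightarrow> real) \<Rightarrow> 'k fps \<Rightarrow> bool" where
  "entire v g \<longleftrightarrow> (\<forall>z. \<exists>l. fps_converges_to v g z l)"

definition fps_value :: "('k::field \<Rightarrow> real) \<Rightarrow> 'k fps \<Rightarrow> 'k \<Rightarrow> 'k" where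
  "fps_value v g z = (THE l. fps_converges_to v g z l)"

definition gauss_norm :: "('k::field \<Rightarrow> real) \<Rightarrow> real \<Rightarrow> 'k fps \<Rightarrow> real" where
  "gauss_norm v r g = (SUP i. v (fps_nth g i) * r ^ i)"


section \<open>Polynomials in the homogeneous coordinates\<close>

text \<open>The coordinates of $\mathbb{P}^N$ are indexed by a finite type \<open>'n\<close> with $N + 1$ elements.
  A monomial is an exponent vector, and a polynomial is a finitely supported map from monomials
  to coefficients; \<open>*\<close> on this type is multiplication of polynomials.\<close>

type_synonym ('n, 'k) mpoly = "('n \<Rightarrow>\<^sub>0 nat) \<Rightarrow>\<^sub>0 'k"

definition homogeneous :: "nat \<Rightarrow> ('n::finite, 'k::zero) mpoly \<Rightarrow> bool" where
  "homogeneous d H \<longleftrightarrow> (\<forall>m \<in> Poly_Mapping.keys H. (\<Sum>j\<in>UNIV. Poly_Mapping.lookup m j) = d)"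

text \<open>Substitution of \<open>y\<close> for the variables, with \<open>h\<close> applied to the coefficients.\<close>

definition subst_poly ::
    "('k \<Rightarrow> 'a) \<Rightarrow> ('n \<Rightarrow> 'a) \<Rightarrow> ('n::finite, 'k::zero) mpoly \<Rightarrow> 'a::comm_ring_1" where
  "subst_poly h y H =
     (\<Sum>m\<in>Poly_Mapping.keys H. h (Poly_Mapping.lookup H m) * (\<Prod>j\<in>UNIV. y j ^ Poly_Mapping.lookup m j))"

abbreviation eval_poly :: "('n \<Rightarrow> 'k) \<Rightarrow> ('n::finite, 'k::comm_ring_1) mpoly \<Rightarrow> 'k" where
  "eval_poly \<equiv> subst_poly (\<lambda>c. c)"


section \<open>Projective space with its Zariski topology\<close>

text \<open>A point is the set of all its homogeneous coordinate vectors.  Since the ground field will be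
  algebraically closed, closed subschemes and coherent ideal sheaves are determined on
  $K$-rational points, so only these are used.\<close>

type_synonym ('n, 'k) ppoint = "('n \<Rightarrow> 'k) set"

definition proj_point :: "('n \<Rightarrow> 'k::field) \<Rightarrow> ('n, 'k) ppoint" where
  "proj_point x = {\<lambda>j. c * x j | c. c \<noteq> 0}"

definition proj_space :: "('n, 'k::field) ppoint set" where
  "proj_space = proj_point ` {x. \<exists>j. x j \<noteq> 0}"

definition basic_open :: "('n::finite, 'k::field) mpoly \<Rightarrow> ('n, 'k) ppoint set" where
  "basic_open H = {p \<in> proj_space. \<forall>x\<in>p. eval_poly x H \<noteq> 0}"

definition zariski :: "('n::finite, 'k::field) ppoint topology" where
  "zariski = topology_generated_by {basic_open H | H. \<exists>d. homogeneous d H}"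

definition irreducible_closed :: "('n::finite, 'k::field) ppoint set \<Rightarrow> bool" where
  "irreducible_closed Z \<longleftrightarrow> closedin zariski Z \<and> Z \<noteq> {} \<and>
     (\<forall>A B. closedin zariski A \<longrightarrow> closedin zariski B \<longrightarrow> Z = A \<union> B \<longrightarrow> Z = A \<or> Z = B)"

text \<open>Krull dimension of a closed set: supremum of the lengths of chains of irreducible closed
  subsets.  It is \<open>ereal\<close>-valued so that the supremum is total.\<close>

definition zariski_dim :: "('n::finite, 'k::field) ppoint set \<Rightarrow> ereal" where
  "zariski_dim A = (if A = {} then -1 else
     (SUP m \<in> {m. \<exists>Z. (\<forall>i\<le>m. irreducible_closed (Z i) \<and> Z i \<subseteq> A) \<and> (\<forall>i<m. Z i \<subset> Z (Suc i))}.
        ereal (real m)))"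


section \<open>The structure sheaf\<close>

definition is_quotient_on ::
    "('n::finite, 'k::field) ppoint set \<Rightarrow> (('n, 'k) ppoint \<Rightarrow> 'k) \<Rightarrow>
     ('n, 'k) mpoly \<Rightarrow> ('n, 'k) mpoly \<Rightarrow> bool" where
  "is_quotient_on V s A B \<longleftrightarrow>
     (\<exists>e. homogeneous e A \<and> homogeneous e B) \<and>
     (\<forall>p\<in>V. \<forall>x\<in>p. eval_poly x B \<noteq> 0 \<and> s p = eval_poly x A / eval_poly x B)"

definition regular_functions ::
    "('n::finite, 'k::field) ppoint set \<Rightarrow> (('n, 'k) ppoint \<Rightarrow> 'k) set" where
  "regular_functions U = {s \<in> extensional U.
     \<forall>p\<in>U. \<exists>V A B. openin zariski V \<and> p \<in> V \<and> V \<subseteq> U \<and> is_quotient_on V s A B}"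

definition regular_ring ::
    "('n::finite, 'k::field) ppoint set \<Rightarrow> (('n, 'k) ppoint \<Rightarrow> 'k) ring" where
  "regular_ring U =
     \<lparr> carrier = regular_functions U,
       mult = (\<lambda>s t. \<lambda>p\<in>U. s p * t p), one = (\<lambda>p\<in>U. 1),
       zero = (\<lambda>p\<in>U. 0), add = (\<lambda>s t. \<lambda>p\<in>U. s p + t p) \<rparr>"


section \<open>Closed subschemes\<close>

text \<open>A closed subscheme of projective space is represented by its ideal sheaf, which assigns to
  every open set \<open>U\<close> an ideal of \<open>regular_ring U\<close>.\<close>

type_synonym ('n, 'k) subscheme = "('n, 'k) ppoint set \<Rightarrow> (('n, 'k) ppoint \<Rightarrow> 'k) set"

definition sheafify :: "('n::finite, 'k::field) subscheme \<Rightarrow> ('n, 'k) subscheme" where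
  "sheafify J U = {s \<in> regular_functions U.
     \<forall>p\<in>U. \<exists>V. openin zariski V \<and> p \<in> V \<and> V \<subseteq> U \<and> restrict s V \<in> J V}"

text \<open>The underlying set consists of the points at which the stalk of the ideal sheaf is proper,
  i.e. contained in the maximal ideal of the local ring.\<close>

definition points :: "('n::finite, 'k::field) subscheme \<Rightarrow> ('n, 'k) ppoint set" where
  "points Z = {p \<in> proj_space. \<forall>U. openin zariski U \<longrightarrow> p \<in> U \<longrightarrow> (\<forall>s\<in>Z U. s p = 0)}"

definition reduced_subscheme :: "('n::finite, 'k::field) ppoint set \<Rightarrow> ('n, 'k) subscheme" where
  "reduced_subscheme A U = {s \<in> regular_functions U. \<forall>p\<in>U \<inter> A. s p = 0}"

definition Supp :: "('n::finite, 'k::field) subscheme \<Rightarrow> ('n, 'k) subscheme" where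
  "Supp Z = reduced_subscheme (points Z)"

definition subscheme_le ::
    "('n::finite, 'k::field) subscheme \<Rightarrow> ('n, 'k) subscheme \<Rightarrow> bool" where
  "subscheme_le Y Z \<longleftrightarrow> (\<forall>U. openin zariski U \<longrightarrow> Z U \<subseteq> Y U)"

text \<open>Intersection of a family: the sum of the ideal sheaves, where the sum of a family of ideals
  is the ideal generated by their union.\<close>

definition subscheme_Inter ::
    "('n::finite, 'k::field) subscheme set \<Rightarrow> ('n, 'k) subscheme" where
  "subscheme_Inter F = sheafify (\<lambda>U. Idl\<^bsub>regular_ring U\<^esub> (\<Union>Z\<in>F. Z U))"

primrec ideal_pow :: "('a, 'b) ring_scheme \<Rightarrow> 'a set \<Rightarrow> nat \<Rightarrow> 'a set" where
  "ideal_pow R I 0 = carrier R"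
| "ideal_pow R I (Suc k) = ideal_prod R I (ideal_pow R I k)"

definition subscheme_mult ::
    "nat \<Rightarrow> ('n::finite, 'k::field) subscheme \<Rightarrow> ('n, 'k) subscheme" where
  "subscheme_mult M Z = sheafify (\<lambda>U. ideal_pow (regular_ring U) (Z U) M)"

definition hypersurface :: "('n::finite, 'k::field) mpoly \<Rightarrow> ('n, 'k) subscheme" where
  "hypersurface Q U = {s \<in> regular_functions U.
     \<forall>p\<in>U. \<exists>V A B. openin zariski V \<and> p \<in> V \<and> V \<subseteq> U \<and> is_quotient_on V s (Q * A) B}"

text \<open>For \<open>X\<close> a set of points, \<open>inter_with X Q I\<close> is the intersection of \<open>X\<close>, with its reduced
  structure, and the hypersurfaces \<open>Q i = 0\<close> for \<open>i \<in> I\<close>.\<close>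

definition inter_with ::
    "('n::finite, 'k::field) ppoint set \<Rightarrow> (nat \<Rightarrow> ('n, 'k) mpoly) \<Rightarrow> nat set \<Rightarrow> ('n, 'k) subscheme" where
  "inter_with X Q I =
     subscheme_Inter (insert (reduced_subscheme X) ((\<lambda>i. hypersurface (Q i)) ` I))"

definition general_position ::
    "('n::finite, 'k::field) ppoint set \<Rightarrow> nat \<Rightarrow> (nat \<Rightarrow> ('n, 'k) mpoly) \<Rightarrow> nat \<Rightarrow> bool" where
  "general_position X n Q q \<longleftrightarrow>
     (\<forall>I. I \<subseteq> {1..q} \<longrightarrow> card I \<le> n + 1 \<longrightarrow>
        zariski_dim (points (inter_with X Q I)) \<le> ereal (real n - real (card I)))"


section \<open>Analytic maps and Nevanlinna functions\<close>

definition analytic_rep :: "('k::field \<Rightarrow> real) \<Rightarrow> ('n \<Rightarrow> 'k fps) \<Rightarrow> bool" where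
  "analytic_rep v f \<longleftrightarrow> (\<forall>j. entire v (f j)) \<and> (\<forall>z. \<exists>j. fps_value v (f j) z \<noteq> 0)"

definition analytic_map :: "('k::field \<Rightarrow> real) \<Rightarrow> ('n \<Rightarrow> 'k fps) \<Rightarrow> 'k \<Rightarrow> ('n, 'k) ppoint" where
  "analytic_map v f z = proj_point (\<lambda>j. fps_value v (f j) z)"

definition map_norm :: "('k::field \<Rightarrow> real) \<Rightarrow> ('n::finite \<Rightarrow> 'k fps) \<Rightarrow> real \<Rightarrow> real" where
  "map_norm v f r = (MAX j. gauss_norm v r (f j))"

definition characteristic_fun :: "('k::field \<Rightarrow> real) \<Rightarrow> ('n::finite \<Rightarrow> 'k fps) \<Rightarrow> real \<Rightarrow> real" where
  "characteristic_fun v f r = ln (map_norm v f r)"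

definition proximity_fun ::
    "('k::field \<Rightarrow> real) \<Rightarrow> ('n::finite \<Rightarrow> 'k fps) \<Rightarrow> nat \<Rightarrow> ('n, 'k) mpoly \<Rightarrow> real \<Rightarrow> real" where
  "proximity_fun v f d Q r = ln (map_norm v f r ^ d / gauss_norm v r (subst_poly fps_const f Q))"

end

theory Submission
  imports Defs
begin

text \<open>Write $w_i(r) = |Q_i \circ f|_r / \|f\|_r^{d_i}$, so that $m_f(r, D_i) = - \log w_i(r)$, and $T$ for
  the characteristic function.  Three facts, each uniform in $r \ge 1$, give the inequality.

  (1) Since $Q_i \circ f$ is a nonzero entire function, $|Q_i \circ f|_r$ is bounded below, so
  $m_f(r, D_i) / d_i \le T(r) + O(1)$.

  (2) Among any $n + 1$ of the hypersurfaces, one has bounded proximity.  They have no common point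
  on $X$, so by the Nullstellensatz a power of each variable is on $X$ a combination of the $Q_i$.
  Composing with $f$ and using the ultrametric inequality, one $w_i(r)$ is bounded below
  (\<open>empty_intersection_estimate\<close>).

  (3) Among any $n$ of them, one satisfies $m_f(r, D_i) \le M \, T(r) + O(1)$.  They meet $X$ in finitely
  many points.  For each point choose a linear form through it, and let $F$ be the product of these
  forms.  The inclusion of subschemes says that $F^M$ is locally a combination of the $Q_i$ on $X$,
  and the Nullstellensatz makes this global up to a power of a variable.  As in (2), $\max_i w_i(r)$
  is then at least a constant times $(|F \circ f|_r / \|f\|_r^{\deg F})^M$.  At a given radius, $f$ can be
  close to at most one of the points, because linear forms through two distinct points span all
  linear forms; and the factor of that point is not smaller than a constant times $1 / \|f\|_r$, because
  $f$ is not constant.  So $F$ can be chosen, among finitely many products and depending on $r$, with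
  $|F \circ f|_r / \|f\|_r^{\deg F}$ at least a constant times $1 / \|f\|_r$
  (\<open>zero_dimensional_intersection_estimate\<close>).

  By (2) at most $n$ terms of the sum are unbounded.  If there are $n$ of them, then (3) bounds one by
  $(M / d_i) T$ and (1) bounds the $n - 1$ others by $T$ (\<open>sum_le_of_few_large_terms\<close>).

  The algebraic geometry rests on two results.  The projective Nullstellensatz
  (\<open>projective_Nullstellensatz\<close>) is proved directly: modulo a homogeneous ideal that is
  maximal among those with no zero graded piece in the quotient, any two variables satisfy a
  binary form, hence a linear relation.  The finiteness of a zero-dimensional closed set
  (\<open>zero_dimensional_imp_finite\<close>) follows from the descending chain condition, proved with leading
  monomials and Dickson's lemma.\<close>

section \<open>Polynomials and homogeneity\<close>

abbreviation mdeg :: "('n::finite \<Rightarrow>\<^sub>0 nat) \<Rightarrow> nat" where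
  "mdeg m \<equiv> (\<Sum>j\<in>UNIV. Poly_Mapping.lookup m j)"

definition Var :: "'n \<Rightarrow> ('n, 'k::zero_neq_one) mpoly" where
  "Var k = Poly_Mapping.single (Poly_Mapping.single k 1) 1"

definition Const :: "'k \<Rightarrow> ('n, 'k::zero) mpoly" where
  "Const c = Poly_Mapping.single 0 c"

lemma mpoly_induct [case_names monomial add]:
  fixes H :: "('n::finite, 'k::comm_ring_1) mpoly"
  assumes "\<And>m c. P (Poly_Mapping.single m c)" "\<And>G H. P G \<Longrightarrow> P H \<Longrightarrow> P (G + H)"
  shows "P H"
proof (induction H rule: Poly_Mapping.update_induct)
  case const
  show ?case using assms(1)[of 0 0] by simp
next
  case (update f a b)
  have "Poly_Mapping.update a b f = f + Poly_Mapping.single a b"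
    using update(1) by (intro poly_mapping_eqI)
      (auto simp: lookup_update lookup_add lookup_single when_def in_keys_iff)
  then show ?case using assms update by metis
qed

lemma mdeg_add: "mdeg (m + m') = mdeg m + mdeg m'"
  by (simp add: lookup_add sum.distrib)

lemma homogeneous_0 [simp]: "homogeneous d 0"
  and homogeneous_add: "homogeneous d G \<Longrightarrow> homogeneous d H \<Longrightarrow> homogeneous d (G + H)"
  and homogeneous_uminus: "homogeneous d G' \<Longrightarrow> homogeneous d (- G')"
  and homogeneous_mult: "homogeneous d A \<Longrightarrow> homogeneous e B \<Longrightarrow> homogeneous (d + e) (A * B)"
  and homogeneous_single: "mdeg m = d \<Longrightarrow> homogeneous d (Poly_Mapping.single m c)"
  for G H :: "('n::finite, 'k::comm_monoid_add) mpoly" and G' :: "('n, 'k'::ab_group_add) mpoly"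
    and A B :: "('n, 'l::comm_ring_1) mpoly"
proof -
  show "homogeneous d G \<Longrightarrow> homogeneous d H \<Longrightarrow> homogeneous d (G + H)"
    unfolding homogeneous_def using Poly_Mapping.keys_add[of G H] by blast
  show "homogeneous d A \<Longrightarrow> homogeneous e B \<Longrightarrow> homogeneous (d + e) (A * B)"
    unfolding homogeneous_def using keys_mult[of A B] by (fastforce simp: mdeg_add)
qed (auto simp: homogeneous_def in_keys_iff lookup_single when_def)

lemma homogeneous_diff: "homogeneous d G \<Longrightarrow> homogeneous d H \<Longrightarrow> homogeneous d (G - H)"
  for G H :: "('n::finite, 'k::ab_group_add) mpoly"
  using homogeneous_add[of d G "- H"] homogeneous_uminus[of d H] by simp

lemma homogeneous_sum: "(\<And>i. i \<in> I \<Longrightarrow> homogeneous d (A i)) \<Longrightarrow> homogeneous d (\<Sum>i\<in>I. A i)"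
  for A :: "'i \<Rightarrow> ('n::finite, 'k::comm_ring_1) mpoly"
  by (induction I rule: infinite_finite_induct) (auto intro: homogeneous_add)

lemma homogeneous_Const: "homogeneous 0 (Const c)"
  by (auto simp: Const_def intro: homogeneous_single)

lemma homogeneous_one: "homogeneous 0 (1 :: ('n::finite, 'k::comm_ring_1) mpoly)"
  using homogeneous_Const[of "1::'k"] by (simp add: Const_def)

lemma mdeg_single: "mdeg (Poly_Mapping.single k a) = a"
  by (simp add: lookup_single when_def)

lemma homogeneous_Var: "homogeneous 1 (Var k)"
  by (auto simp: Var_def intro: homogeneous_single simp: mdeg_single)

lemma homogeneous_power: "homogeneous d A \<Longrightarrow> homogeneous (k * d) (A ^ k)"
  for A :: "('n::finite, 'k::comm_ring_1) mpoly"
  by (induction k) (auto intro: homogeneous_one homogeneous_mult)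

lemma homogeneous_Var_power: "homogeneous k (Var j ^ k :: ('n::finite, 'k::comm_ring_1) mpoly)"
  using homogeneous_power[OF homogeneous_Var[of j], of k] by simp

lemma homogeneous_prod:
  fixes A :: "'i \<Rightarrow> ('n::finite, 'k::comm_ring_1) mpoly"
  shows "(\<And>i. i \<in> I \<Longrightarrow> homogeneous (e i) (A i)) \<Longrightarrow> homogeneous (\<Sum>i\<in>I. e i) (\<Prod>i\<in>I. A i)"
  by (induction I rule: infinite_finite_induct) (auto intro: homogeneous_one homogeneous_mult)

lemma homogeneous_Const_mult: "homogeneous d A \<Longrightarrow> homogeneous d (Const c * A)"
  for A :: "('n::finite, 'k::comm_ring_1) mpoly"
  using homogeneous_mult[OF homogeneous_Const, of d A c] by simp

lemma Const_add: "Const (a + b) = Const a + Const (b::'k::comm_ring_1)"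
  by (simp add: Const_def single_add)

lemma Const_mult: "Const (a * b) = Const a * Const (b::'k::comm_ring_1)"
  by (simp add: Const_def mult_single)

lemma Const_uminus: "Const (- a) = - Const (a::'k::comm_ring_1)"
  by (simp add: Const_def single_uminus)

lemma Const_diff: "Const (a - b) = Const a - Const (b::'k::comm_ring_1)"
  by (simp add: Const_def single_diff)

lemma Const_0 [simp]: "Const 0 = 0" and Const_1 [simp]: "Const 1 = 1"
  by (simp_all add: Const_def)

lemma single_eq_Const_mult:
  "Poly_Mapping.single m c = Const c * Poly_Mapping.single m (1::'k::comm_ring_1)"
  by (simp add: Const_def mult_single)

text \<open>Every form is obtained from constants by sums within one degree and multiplication by
  variables, so a property of forms of all degrees need not be checked on monomials.\<close>

lemma homogeneous_induct [consumes 1, case_names zero add Const Var]: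
  fixes H :: "('n::finite, 'k::comm_ring_1) mpoly"
  assumes hom: "homogeneous d H"
    and zero: "\<And>d. P d 0"
    and add: "\<And>d G H. homogeneous d G \<Longrightarrow> homogeneous d H \<Longrightarrow> P d G \<Longrightarrow> P d H \<Longrightarrow> P d (G + H)"
    and Const: "\<And>c. P 0 (Const c)"
    and Var: "\<And>d k H. homogeneous d H \<Longrightarrow> P d H \<Longrightarrow> P (Suc d) (Var k * H)"
  shows "P d H"
proof -
  have mono: "P (mdeg m) (Poly_Mapping.single m c)" for m and c :: 'k
  proof (induction "mdeg m" arbitrary: m)
    case 0
    then have "m = 0" by (intro poly_mapping_eqI) auto
    then show ?case using Const[of c] by (simp add: Const_def)
  next
    case (Suc D)
    then obtain k where k: "Poly_Mapping.lookup m k \<noteq> 0"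
      by (metis nat.distinct(1) sum.neutral)
    define m' where "m' = m - Poly_Mapping.single k 1"
    have m: "m = Poly_Mapping.single k 1 + m'"
      unfolding m'_def using k
      by (intro poly_mapping_eqI) (auto simp: lookup_add lookup_minus lookup_single when_def)
    have D: "mdeg m' = D" using Suc(2) m mdeg_add[of "Poly_Mapping.single k 1" m'] mdeg_single[of k 1]
      by simp
    have "P (Suc D) (Var k * Poly_Mapping.single m' c)"
      using Suc(1)[of m'] D by (intro Var homogeneous_single) auto
    then show ?case using Suc(2) m by (simp add: Var_def mult_single)
  qed
  have "P d (\<Sum>m\<in>S. Poly_Mapping.single m (Poly_Mapping.lookup H m)) \<and>
     homogeneous d (\<Sum>m\<in>S. Poly_Mapping.single m (Poly_Mapping.lookup H m))"
    if "finite S" "S \<subseteq> Poly_Mapping.keys H" for S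
    using that
  proof (induction S)
    case empty
    then show ?case by (simp add: zero)
  next
    case (insert m S)
    then have "mdeg m = d" using hom by (auto simp: homogeneous_def)
    then show ?case using insert mono[of m "Poly_Mapping.lookup H m"]
      by (auto intro!: add homogeneous_add homogeneous_single)
  qed
  moreover have "(\<Sum>m\<in>Poly_Mapping.keys H. Poly_Mapping.single m (Poly_Mapping.lookup H m)) = H"
    by (intro poly_mapping_eqI) (auto simp: lookup_sum lookup_single when_def in_keys_iff sum.delta')
  ultimately show ?thesis by (metis finite_keys order_refl)
qed

lemma finite_monomials: "finite {m :: 'n::finite \<Rightarrow>\<^sub>0 nat. mdeg m = d}"
proof -
  have le: "Poly_Mapping.lookup m j \<le> mdeg m" for m :: "'n \<Rightarrow>\<^sub>0 nat" and j
    by (rule member_le_sum) auto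
  have "Poly_Mapping.lookup ` {m :: 'n \<Rightarrow>\<^sub>0 nat. mdeg m = d} \<subseteq> (UNIV :: 'n set) \<rightarrow>\<^sub>E {..d}"
    using le by auto
  moreover have "finite ((UNIV :: 'n set) \<rightarrow>\<^sub>E {..d})" by (intro finite_PiE) auto
  ultimately have "finite (Poly_Mapping.lookup ` {m :: 'n \<Rightarrow>\<^sub>0 nat. mdeg m = d})"
    by (rule finite_subset)
  then show ?thesis
    by (rule finite_imageD) (simp add: inj_on_def poly_mapping.lookup_inject)
qed

locale coeff_hom =
  fixes h :: "'k::comm_ring_1 \<Rightarrow> 'a::comm_ring_1"
  assumes hom_0: "h 0 = 0" and hom_1: "h 1 = 1"
    and hom_add: "h (a + b) = h a + h b" and hom_mult: "h (a * b) = h a * h b"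
begin

lemma subst_poly_0 [simp]: "subst_poly h y 0 = 0"
  by (simp add: subst_poly_def hom_0)

lemma subst_poly_single:
  "subst_poly h y (Poly_Mapping.single m c) = h c * (\<Prod>j\<in>UNIV. y j ^ Poly_Mapping.lookup m j)"
  by (simp add: subst_poly_def hom_0)

lemma subst_poly_add: "subst_poly h y (G + H) = subst_poly h y G + subst_poly h y H"
  unfolding subst_poly_def by (rule setsum_keys_plus_distrib) (auto simp: hom_0 hom_add distrib_right)

lemma subst_poly_mult: "subst_poly h y (G * H) = subst_poly h y G * subst_poly h y H"
proof (induction G rule: mpoly_induct)
  case (monomial m c)
  show ?case
  proof (induction H rule: mpoly_induct)
    case (monomial m' c')
    show ?case
      by (simp add: mult_single subst_poly_single hom_mult lookup_add power_add prod.distrib mult_ac)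
  qed (simp add: distrib_left subst_poly_add)
qed (simp add: distrib_right subst_poly_add)

lemma subst_poly_1 [simp]: "subst_poly h y 1 = 1"
  using subst_poly_single[of y 0 1] by (simp add: hom_1)

lemma subst_poly_Const [simp]: "subst_poly h y (Const c) = h c"
  by (simp add: Const_def subst_poly_single)

lemma subst_poly_Var [simp]: "subst_poly h y (Var k) = y k"
proof -
  have "(\<Prod>j\<in>UNIV. y j ^ Poly_Mapping.lookup (Poly_Mapping.single k 1) j)
      = (\<Prod>j\<in>UNIV. if j = k then y j else 1)"
    by (intro prod.cong) (auto simp: lookup_single when_def)
  then show ?thesis by (simp add: Var_def subst_poly_single hom_1)
qed

lemma subst_poly_uminus: "subst_poly h y (- G) = - subst_poly h y G"
  by (rule minus_unique[symmetric]) (metis subst_poly_add add.right_inverse subst_poly_0)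

lemma subst_poly_diff: "subst_poly h y (G - H) = subst_poly h y G - subst_poly h y H"
  using subst_poly_add[of y G "- H"] by (simp add: subst_poly_uminus)

lemma subst_poly_power: "subst_poly h y (G ^ k) = subst_poly h y G ^ k"
  by (induction k) (auto simp: subst_poly_mult)

lemma subst_poly_sum: "subst_poly h y (\<Sum>i\<in>I. G i) = (\<Sum>i\<in>I. subst_poly h y (G i))"
  by (induction I rule: infinite_finite_induct) (auto simp: subst_poly_add)

lemma subst_poly_prod: "subst_poly h y (\<Prod>i\<in>I. G i) = (\<Prod>i\<in>I. subst_poly h y (G i))"
  by (induction I rule: infinite_finite_induct) (auto simp: subst_poly_mult)

end

interpretation ev: coeff_hom "\<lambda>c::'k::comm_ring_1. c"
  by unfold_locales auto

interpretation fs: coeff_hom "fps_const :: 'k::field \<Rightarrow> 'k fps"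
  by unfold_locales simp_all

lemma eval_poly_scale:
  assumes "homogeneous d H"
  shows "eval_poly (\<lambda>j. c * x j) H = c ^ d * eval_poly x H"
  using assms
  by (induction rule: homogeneous_induct)
     (auto simp: ev.subst_poly_add ev.subst_poly_mult algebra_simps)

text \<open>Split \<open>A\<close> into its monomials of degree \<open>e - d\<close> and the others.  The others contribute to the
  product only monomials of degree different from \<open>e\<close>, so their contribution is zero.  The disjunct
  \<open>A' = 0\<close> covers \<open>e < d\<close>.\<close>

lemma homogeneous_cofactor:
  fixes Q A :: "('n::finite, 'k::comm_ring_1) mpoly"
  assumes Q: "homogeneous d Q" and QA: "homogeneous e (Q * A)"
  shows "\<exists>A'. Q * A' = Q * A \<and> (A' = 0 \<or> (\<exists>a. a + d = e \<and> homogeneous a A'))"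
proof -
  define part where "part S = (\<Sum>m\<in>S. Poly_Mapping.single m (Poly_Mapping.lookup A m))" for S
  define S where "S = {m \<in> Poly_Mapping.keys A. mdeg m + d = e}"
  define S' where "S' = {m \<in> Poly_Mapping.keys A. mdeg m + d \<noteq> e}"
  have kp: "Poly_Mapping.keys (part T) \<subseteq> T" if "finite T" for T
    unfolding part_def using that
    by (auto simp: in_keys_iff lookup_sum lookup_single when_def sum.delta' split: if_splits)
  have fin: "finite S" "finite S'" by (auto simp: S_def S'_def)
  have "A = part (Poly_Mapping.keys A)"
    unfolding part_def
    by (intro poly_mapping_eqI) (auto simp: lookup_sum lookup_single when_def in_keys_iff sum.delta')
  also have "Poly_Mapping.keys A = S \<union> S'" by (auto simp: S_def S'_def)
  also have "part (S \<union> S') = part S + part S'"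
    unfolding part_def using fin by (intro sum.union_disjoint) (auto simp: S_def S'_def)
  finally have A: "A = part S + part S'" .
  have "homogeneous e (Q * part S)"
    unfolding homogeneous_def
  proof
    fix m assume "m \<in> Poly_Mapping.keys (Q * part S)"
    then obtain a b where "m = a + b" "a \<in> Poly_Mapping.keys Q" "b \<in> S"
      using keys_mult[of Q "part S"] kp[OF fin(1)] by blast
    then show "mdeg m = e" using Q mdeg_add[of a b] by (auto simp: homogeneous_def S_def)
  qed
  then have hom: "homogeneous e (Q * part S')"
    using homogeneous_diff[OF QA, of "Q * part S"] A by (metis add_diff_cancel_left' distrib_left)
  have "Q * part S' = 0"
  proof (rule ccontr)
    assume "Q * part S' \<noteq> 0"
    then obtain m where m: "m \<in> Poly_Mapping.keys (Q * part S')"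
      by (metis keys_eq_empty ex_in_conv)
    then obtain a b where ab: "m = a + b" "a \<in> Poly_Mapping.keys Q" "b \<in> S'"
      using keys_mult[of Q "part S'"] kp[OF fin(2)] by blast
    then show False using m hom Q mdeg_add[of a b] by (auto simp: homogeneous_def S'_def)
  qed
  then have eq: "Q * part S = Q * A" using A by (metis add.right_neutral distrib_left)
  show ?thesis
  proof (cases "part S = 0")
    case True
    then show ?thesis using eq by blast
  next
    case False
    then obtain m where "m \<in> S" using kp[OF fin(1)] by (metis keys_eq_empty subset_empty ex_in_conv)
    then have "d \<le> e" by (auto simp: S_def)
    moreover have "homogeneous (e - d) (part S)"
      using kp[OF fin(1)] by (auto simp: homogeneous_def S_def)
    ultimately show ?thesis using eq by (metis le_add_diff_inverse2)
  qed
qed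

section \<open>The projective Nullstellensatz\<close>

text \<open>A homogeneous ideal, given by its graded pieces.  The degree is recorded in the pair because the
  zero form has every degree.\<close>

definition graded_ideal :: "(nat \<times> ('n::finite, 'k::comm_ring_1) mpoly) set \<Rightarrow> bool" where
  "graded_ideal J \<longleftrightarrow>
     (\<forall>d H. (d, H) \<in> J \<longrightarrow> homogeneous d H) \<and> (\<forall>d. (d, 0) \<in> J) \<and>
     (\<forall>d G H. (d, G) \<in> J \<longrightarrow> (d, H) \<in> J \<longrightarrow> (d, G + H) \<in> J) \<and>
     (\<forall>d e G A. (d, G) \<in> J \<longrightarrow> homogeneous e A \<longrightarrow> (e + d, A * G) \<in> J)"

lemma graded_ideal_homogeneous: "graded_ideal J \<Longrightarrow> (d, H) \<in> J \<Longrightarrow> homogeneous d H"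
  and graded_ideal_zero: "graded_ideal J \<Longrightarrow> (d, 0) \<in> J"
  and graded_ideal_add: "graded_ideal J \<Longrightarrow> (d, G) \<in> J \<Longrightarrow> (d, H) \<in> J \<Longrightarrow> (d, G + H) \<in> J"
  and graded_ideal_mult: "graded_ideal J \<Longrightarrow> (d, G) \<in> J \<Longrightarrow> homogeneous e A \<Longrightarrow> (e + d, A * G) \<in> J"
  unfolding graded_ideal_def by blast+

lemma graded_ideal_Const_mult: "graded_ideal J \<Longrightarrow> (d, G) \<in> J \<Longrightarrow> (d, Const c * G) \<in> J"
  using graded_ideal_mult[of J d G 0 "Const c"] by (simp add: homogeneous_Const)

lemma graded_ideal_sum:
  "graded_ideal J \<Longrightarrow> (\<And>i. i \<in> I \<Longrightarrow> (d, G i) \<in> J) \<Longrightarrow> (d, \<Sum>i\<in>I. G i) \<in> J"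
  by (induction I rule: infinite_finite_induct) (auto intro: graded_ideal_zero graded_ideal_add)

text \<open>A homogeneous ideal contains a full graded piece exactly if it contains a power of the ideal
  generated by the variables; these are the ideals without a zero in projective space.\<close>

definition full_degree :: "(nat \<times> ('n::finite, 'k::comm_ring_1) mpoly) set \<Rightarrow> nat \<Rightarrow> bool" where
  "full_degree J e \<longleftrightarrow> (\<forall>H. homogeneous e H \<longrightarrow> (e, H) \<in> J)"

lemma full_degree_mono:
  fixes J :: "(nat \<times> ('n::finite, 'k::comm_ring_1) mpoly) set"
  assumes J: "graded_ideal J" and e: "full_degree J e" and "e \<le> d"
  shows "full_degree J d"
  unfolding full_degree_def
proof (intro allI impI)
  fix H :: "('n, 'k) mpoly" assume "homogeneous d H"
  then have "e \<le> d \<longrightarrow> (d, H) \<in> J"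
  proof (induction rule: homogeneous_induct)
    case (Const c)
    then show ?case using e homogeneous_Const by (auto simp: full_degree_def)
  next
    case (Var d k H)
    have V: "homogeneous (1 + d) (Var k * H)" using Var homogeneous_mult homogeneous_Var by blast
    show ?case
    proof (cases "e \<le> d")
      case True
      then show ?thesis using graded_ideal_mult[OF J _ homogeneous_Var] Var by fastforce
    next
      case False
      then show ?thesis using V e by (auto simp: full_degree_def le_Suc_eq)
    qed
  qed (auto intro: graded_ideal_zero[OF J] graded_ideal_add[OF J])
  then show "(d, H) \<in> J" using \<open>e \<le> d\<close> by simp
qed

lemma full_degree_monomials:
  fixes J :: "(nat \<times> ('n::finite, 'k::comm_ring_1) mpoly) set"
  assumes J: "graded_ideal J" and m: "\<And>m. mdeg m = e \<Longrightarrow> (e, Poly_Mapping.single m 1) \<in> J"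
  shows "full_degree J e"
  unfolding full_degree_def
proof (intro allI impI)
  fix H :: "('n, 'k) mpoly" assume H: "homogeneous e H"
  have "(e, \<Sum>m\<in>Poly_Mapping.keys H. Poly_Mapping.single m (Poly_Mapping.lookup H m)) \<in> J"
    using H by (intro graded_ideal_sum[OF J], subst single_eq_Const_mult)
      (auto intro!: graded_ideal_Const_mult[OF J] m simp: homogeneous_def)
  moreover have "(\<Sum>m\<in>Poly_Mapping.keys H. Poly_Mapping.single m (Poly_Mapping.lookup H m)) = H"
    by (intro poly_mapping_eqI) (auto simp: lookup_sum lookup_single when_def in_keys_iff sum.delta')
  ultimately show "(e, H) \<in> J" by simp
qed

text \<open>The ideal generated by \<open>J\<close> and the form \<open>h\<close> of degree \<open>d\<close>; in degrees below \<open>d\<close> the cofactor \<open>A\<close>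
  has to be zero.\<close>

definition ideal_plus ::
    "(nat \<times> ('n::finite, 'k::comm_ring_1) mpoly) set \<Rightarrow> nat \<Rightarrow> ('n, 'k) mpoly \<Rightarrow>
     (nat \<times> ('n, 'k) mpoly) set" where
  "ideal_plus J d h =
     {(k, G + A * h) | k G A. (k, G) \<in> J \<and> (A = 0 \<or> (\<exists>a. a + d = k \<and> homogeneous a A))}"

lemma ideal_plusI:
  "(k, G) \<in> J \<Longrightarrow> A = 0 \<or> (\<exists>a. a + d = k \<and> homogeneous a A) \<Longrightarrow> (k, G + A * h) \<in> ideal_plus J d h"
  by (auto simp: ideal_plus_def)

lemma ideal_plusE:
  assumes "(k, P) \<in> ideal_plus J d h"
  obtains G A where "P = G + A * h" "(k, G) \<in> J" "A = 0 \<or> (\<exists>a. a + d = k \<and> homogeneous a A)"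
  using assms by (auto simp: ideal_plus_def)

lemma graded_ideal_plus:
  fixes J :: "(nat \<times> ('n::finite, 'k::comm_ring_1) mpoly) set"
  assumes J: "graded_ideal J" and h: "homogeneous d h"
  shows "graded_ideal (ideal_plus J d h)"
  unfolding graded_ideal_def
proof (intro conjI allI impI)
  fix k P assume "(k, P) \<in> ideal_plus J d h"
  then obtain G A where P': "P = G + A * h" "(k, G) \<in> J" "A = 0 \<or> (\<exists>a. a + d = k \<and> homogeneous a A)"
    by (rule ideal_plusE)
  then show "homogeneous k P"
    using graded_ideal_homogeneous[OF J P'(2)] h by (auto intro: homogeneous_add homogeneous_mult)
next
  fix k show "(k, 0) \<in> ideal_plus J d h"
    using ideal_plusI[OF graded_ideal_zero[OF J], of 0 d k h] by simp
next
  fix k P R assume P: "(k, P) \<in> ideal_plus J d h" and R: "(k, R) \<in> ideal_plus J d h"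
  obtain G A where P': "P = G + A * h" "(k, G) \<in> J" "A = 0 \<or> (\<exists>a. a + d = k \<and> homogeneous a A)"
    using P by (rule ideal_plusE)
  obtain G' A' where R': "R = G' + A' * h" "(k, G') \<in> J" "A' = 0 \<or> (\<exists>a. a + d = k \<and> homogeneous a A')"
    using R by (rule ideal_plusE)
  have "A + A' = 0 \<or> (\<exists>a. a + d = k \<and> homogeneous a (A + A'))"
    using P'(3) R'(3) by (auto intro: homogeneous_add)
  then have "(k, (G + G') + (A + A') * h) \<in> ideal_plus J d h"
    by (intro ideal_plusI graded_ideal_add[OF J] P' R')
  then show "(k, P + R) \<in> ideal_plus J d h" by (simp add: P'(1) R'(1) algebra_simps)
next
  fix k e P and B :: "('n, 'k) mpoly" assume P: "(k, P) \<in> ideal_plus J d h" and B: "homogeneous e B"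
  obtain G A where P': "P = G + A * h" "(k, G) \<in> J" "A = 0 \<or> (\<exists>a. a + d = k \<and> homogeneous a A)"
    using P by (rule ideal_plusE)
  have "B * A = 0 \<or> (\<exists>a. a + d = e + k \<and> homogeneous a (B * A))"
    using P'(3) B by (metis add.assoc homogeneous_mult mult_zero_right)
  then have "(e + k, B * G + (B * A) * h) \<in> ideal_plus J d h"
    by (intro ideal_plusI graded_ideal_mult[OF J] P' B)
  then show "(e + k, B * P) \<in> ideal_plus J d h" by (simp add: P'(1) algebra_simps)
qed

lemma ideal_plus_superset: "J \<subseteq> ideal_plus J d h"
  using ideal_plusI[where A = 0 and J = J and d = d and h = h] by force

lemma ideal_plus_generator: "graded_ideal J \<Longrightarrow> (d, h) \<in> ideal_plus J d h"
  using ideal_plusI[OF graded_ideal_zero, of J 1 d d h] homogeneous_one by auto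

definition colon_ideal ::
    "(nat \<times> ('n::finite, 'k::comm_ring_1) mpoly) set \<Rightarrow> nat \<Rightarrow> ('n, 'k) mpoly \<Rightarrow>
     (nat \<times> ('n, 'k) mpoly) set" where
  "colon_ideal J d h = {(k, G). homogeneous k G \<and> (k + d, G * h) \<in> J}"

lemma graded_ideal_colon: "graded_ideal J \<Longrightarrow> graded_ideal (colon_ideal J d h)"
  unfolding graded_ideal_def colon_ideal_def
  by (auto simp: distrib_right mult.assoc add.assoc intro: homogeneous_add homogeneous_mult)

text \<open>Among homogeneous ideals without a full graded piece, a maximal one turns out to be the ideal of
  a single point.\<close>

locale maximal_graded_ideal =
  fixes J :: "(nat \<times> ('n::finite, 'k::alg_closed_field) mpoly) set"
  assumes ideal: "graded_ideal J" and not_full: "\<not> full_degree J e"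
    and maximal: "graded_ideal J' \<Longrightarrow> J \<subset> J' \<Longrightarrow> \<exists>e. full_degree J' e"

text \<open>Zorn's lemma applies because a graded piece is spanned by finitely many monomials: if the union
  of a chain contains them all, then so does a member of the chain.\<close>

lemma maximal_graded_ideal_exists:
  fixes I :: "(nat \<times> ('n::finite, 'k::alg_closed_field) mpoly) set"
  assumes I: "graded_ideal I" and "\<And>e. \<not> full_degree I e"
  shows "\<exists>J. I \<subseteq> J \<and> maximal_graded_ideal J"
proof -
  define \<A> where "\<A> = {J. graded_ideal J \<and> I \<subseteq> J \<and> (\<forall>e. \<not> full_degree J e)}"
  have "\<exists>M\<in>\<A>. \<forall>X\<in>\<A>. M \<subseteq> X \<longrightarrow> X = M"
  proof (rule subset_Zorn_nonempty)
    show "\<A> \<noteq> {}" using assms by (auto simp: \<A>_def)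
  next
    fix \<C> assume C: "\<C> \<noteq> {}" "subset.chain \<A> \<C>"
    then have sub: "\<C> \<subseteq> \<A>" and chain: "\<And>x y. x \<in> \<C> \<Longrightarrow> y \<in> \<C> \<Longrightarrow> x \<subseteq> y \<or> y \<subseteq> x"
      by (auto simp: subset_chain_def)
    have gi: "\<And>J. J \<in> \<C> \<Longrightarrow> graded_ideal J" using sub by (auto simp: \<A>_def)
    have U: "graded_ideal (\<Union>\<C>)"
      unfolding graded_ideal_def
    proof (intro conjI allI impI)
      fix d G H assume "(d, G) \<in> \<Union>\<C>" "(d, H) \<in> \<Union>\<C>"
      then obtain J where "J \<in> \<C>" "(d, G) \<in> J" "(d, H) \<in> J" using chain by blast
      then show "(d, G + H) \<in> \<Union>\<C>" using graded_ideal_add[OF gi] by blast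
    next
      fix d e G and A :: "('n, 'k) mpoly" assume "(d, G) \<in> \<Union>\<C>" "homogeneous e A"
      then show "(e + d, A * G) \<in> \<Union>\<C>" using graded_ideal_mult[OF gi] by blast
    qed (use C(1) gi in \<open>auto intro: graded_ideal_homogeneous graded_ideal_zero\<close>)
    have "\<not> full_degree (\<Union>\<C>) e" for e
    proof
      assume full: "full_degree (\<Union>\<C>) e"
      define S where "S = (\<lambda>m. (e, Poly_Mapping.single m (1::'k))) ` {m :: 'n \<Rightarrow>\<^sub>0 nat. mdeg m = e}"
      have "finite S" "S \<subseteq> \<Union>\<C>"
        using full finite_monomials by (auto simp: S_def full_degree_def homogeneous_single)
      then obtain J where J: "J \<in> \<C>" "S \<subseteq> J"
        using finite_subset_Union_chain[OF _ _ C] by metis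
      then have "full_degree J e"
        by (intro full_degree_monomials gi) (auto simp: S_def)
      then show False using J sub by (auto simp: \<A>_def)
    qed
    moreover have "I \<subseteq> \<Union>\<C>" using C(1) sub by (auto simp: \<A>_def)
    ultimately show "\<Union>\<C> \<in> \<A>" using U by (auto simp: \<A>_def)
  qed
  then obtain M where M: "M \<in> \<A>" "\<And>X. X \<in> \<A> \<Longrightarrow> M \<subseteq> X \<Longrightarrow> X = M" by blast
  then have "maximal_graded_ideal M"
    by unfold_locales (auto simp: \<A>_def)
  then show ?thesis using M(1) by (auto simp: \<A>_def)
qed

text \<open>Gaussian elimination: a vector \<open>k0\<close> with nonzero entry at \<open>b\<close> clears this entry in the others.\<close>

lemma linear_dependence:
  fixes w :: "'i \<Rightarrow> 'b \<Rightarrow> 'k::field"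
  assumes "finite B" "finite K" "card B < card K"
  shows "\<exists>a. (\<exists>k\<in>K. a k \<noteq> 0) \<and> (\<forall>b\<in>B. (\<Sum>k\<in>K. a k * w k b) = 0)"
  using assms
proof (induction B arbitrary: K w)
  case empty
  then have "K \<noteq> {}" by auto
  then have "\<exists>k\<in>K. (1 :: 'k) \<noteq> 0" using one_neq_zero by blast
  then have "(\<exists>k\<in>K. (1 :: 'k) \<noteq> 0) \<and> (\<forall>b\<in>{}. (\<Sum>k\<in>K. 1 * w k b) = 0)" by blast
  then show ?case by (rule exI[where x = "\<lambda>_. 1"])
next
  case (insert b B)
  show ?case
  proof (cases "\<forall>k\<in>K. w k b = 0")
    case True
    moreover obtain a where "\<exists>k\<in>K. a k \<noteq> 0" "\<forall>c\<in>B. (\<Sum>k\<in>K. a k * w k c) = 0"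
      using insert.IH[of K w] insert.prems insert.hyps by auto
    ultimately show ?thesis by (intro exI[of _ a]) simp
  next
    case False
    then obtain k0 where k0: "k0 \<in> K" "w k0 b \<noteq> 0" by blast
    define K' where "K' = K - {k0}"
    define w' where "w' k c = w k c - w k b / w k0 b * w k0 c" for k c
    have fin: "finite K'" and "card B < card K'" using insert k0 by (auto simp: K'_def)
    then obtain a where a: "\<exists>k\<in>K'. a k \<noteq> 0" "\<And>c. c \<in> B \<Longrightarrow> (\<Sum>k\<in>K'. a k * w' k c) = 0"
      using insert.IH[of K' w'] by blast
    define a' where "a' k = (if k = k0 then - (\<Sum>k\<in>K'. a k * w k b) / w k0 b else a k)" for k
    have "(\<Sum>k\<in>K. a' k * w k c) = (\<Sum>k\<in>K'. a k * w' k c)" for c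
    proof -
      have "(\<Sum>k\<in>K. a' k * w k c) = a' k0 * w k0 c + (\<Sum>k\<in>K'. a' k * w k c)"
        unfolding K'_def using insert.prems k0 by (simp add: sum.remove)
      also have "(\<Sum>k\<in>K'. a' k * w k c) = (\<Sum>k\<in>K'. a k * w k c)"
        by (intro sum.cong) (auto simp: a'_def K'_def)
      also have "a' k0 * w k0 c = - (\<Sum>k\<in>K'. a k * (w k b / w k0 b * w k0 c))"
        by (simp add: a'_def sum_distrib_right sum_divide_distrib mult.assoc)
      finally show ?thesis by (simp add: w'_def right_diff_distrib sum_subtractf)
    qed
    moreover have "w' k b = 0" for k using k0 by (simp add: w'_def)
    ultimately have "\<forall>c\<in>insert b B. (\<Sum>k\<in>K. a' k * w k c) = 0" using a(2) by auto
    moreover have "\<exists>k\<in>K. a' k \<noteq> 0" using a(1) by (auto simp: a'_def K'_def)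
    ultimately show ?thesis by blast
  qed
qed

lemma lookup_Const_mult: "Poly_Mapping.lookup (Const c * H) m = c * Poly_Mapping.lookup H m"
  for H :: "('n, 'k::comm_ring_1) mpoly"
  unfolding Const_def mult_map_scale_conv_mult[symmetric] by (simp add: Poly_Mapping.map.rep_eq when_def)

text \<open>The homogenization, of degree \<open>D\<close>, of a univariate polynomial in the two variables \<open>i\<close> and \<open>j\<close>.\<close>

definition binary_form :: "'n \<Rightarrow> 'n \<Rightarrow> nat \<Rightarrow> 'k poly \<Rightarrow> ('n, 'k::field) mpoly" where
  "binary_form i j D p = (\<Sum>k\<le>D. Const (coeff p k) * Var i ^ k * Var j ^ (D - k))"

lemma homogeneous_binary_form: "homogeneous D (binary_form i j D p)"
  unfolding binary_form_def
proof (intro homogeneous_sum)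
  fix k assume "k \<in> {..D}"
  then show "homogeneous D (Const (coeff p k) * Var i ^ k * Var j ^ (D - k))"
    using homogeneous_mult[OF homogeneous_Const_mult[OF homogeneous_Var_power[of k i]]
        homogeneous_Var_power[of "D - k" j]] by simp
qed

lemma binary_form_root:
  fixes q :: "'k::field poly"
  assumes "degree q \<le> D"
  shows "binary_form i j (Suc D) ([:- c, 1:] * q) = (Var i - Const c * Var j) * binary_form i j D q"
proof -
  have diff: "binary_form i j (Suc D) (p - p') = binary_form i j (Suc D) p - binary_form i j (Suc D) p'"
    for p p' :: "'k poly"
    unfolding binary_form_def sum_subtractf[symmetric]
    by (intro sum.cong) (auto simp: Const_diff algebra_simps)
  have 1: "binary_form i j (Suc D) (pCons 0 q) = Var i * binary_form i j D q"
    unfolding binary_form_def sum.atMost_Suc_shift by (simp add: sum_distrib_left mult_ac)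
  have "coeff q (Suc D) = 0" using assms by (intro coeff_eq_0) auto
  then have 2: "binary_form i j (Suc D) (smult c q) = Const c * Var j * binary_form i j D q"
    unfolding binary_form_def
    by (simp add: sum_distrib_left mult_ac Const_mult Suc_diff_le)
  have "[:- c, 1:] * q = pCons 0 q - smult c q" by simp
  then show ?thesis by (simp only: diff 1 2 left_diff_distrib)
qed

context maximal_graded_ideal
begin

lemmas add = graded_ideal_add[OF ideal] and mult = graded_ideal_mult[OF ideal]
  and zero = graded_ideal_zero[OF ideal] and scale = graded_ideal_Const_mult[OF ideal]

text \<open>If neither factor is in \<open>J\<close>, then \<open>J\<close> with either factor adjoined contains a full graded piece.
  The ideal quotient of \<open>J\<close> by \<open>h\<close> contains \<open>J\<close> and \<open>h'\<close>, hence a full graded piece; multiplying it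
  into \<open>J\<close> with \<open>h\<close> adjoined yields a full graded piece in \<open>J\<close> itself.\<close>

lemma prime:
  assumes h: "homogeneous d h" "homogeneous d' h'" and hh': "(d + d', h * h') \<in> J"
  shows "(d, h) \<in> J \<or> (d', h') \<in> J"
proof (rule ccontr)
  assume "\<not> ?thesis"
  then have "J \<subset> ideal_plus J d h" "J \<subset> ideal_plus J d' h'"
    using ideal_plus_superset ideal_plus_generator[OF ideal] by blast+
  then obtain e e' where e: "full_degree (ideal_plus J d h) e" and e': "full_degree (ideal_plus J d' h') e'"
    using maximal graded_ideal_plus ideal h by meson
  have "ideal_plus J d' h' \<subseteq> colon_ideal J d h"
  proof (clarify elim!: ideal_plusE)
    fix k G and A :: "('n, 'k) mpoly" assume G: "(k, G) \<in> J" and A: "A = 0 \<or> (\<exists>a. a + d' = k \<and> homogeneous a A)"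
    have "(k + d, G * h) \<in> J" using mult[OF G h(1)] by (simp add: mult.commute add.commute)
    moreover have "(k + d, A * h' * h) \<in> J"
    proof (cases "A = 0")
      case True
      then show ?thesis by (simp add: zero)
    next
      case False
      then obtain a where a: "a + d' = k" "homogeneous a A" using A by blast
      then show ?thesis using mult[OF hh' a(2)] a(1)[symmetric] by (simp add: mult_ac add_ac)
    qed
    moreover have "homogeneous k (G + A * h')"
      using graded_ideal_homogeneous[OF ideal G] A h by (auto intro: homogeneous_add homogeneous_mult)
    ultimately show "(k, G + A * h') \<in> colon_ideal J d h"
      using add by (auto simp: colon_ideal_def distrib_right)
  qed
  then have "full_degree (colon_ideal J d h) e'" using e' by (auto simp: full_degree_def)
  then have C: "full_degree (colon_ideal J d h) (e + e')"
    using full_degree_mono graded_ideal_colon[OF ideal] by (metis le_add2)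
  have P: "full_degree (ideal_plus J d h) (e + e' + d)"
    using full_degree_mono[OF graded_ideal_plus[OF ideal h(1)] e] by (metis le_add1 add.assoc)
  have "full_degree J (e + e' + d)"
    unfolding full_degree_def
  proof (intro allI impI)
    fix H :: "('n, 'k) mpoly" assume "homogeneous (e + e' + d) H"
    then have "(e + e' + d, H) \<in> ideal_plus J d h" using P by (auto simp: full_degree_def)
    then obtain G A where GA: "H = G + A * h" "(e + e' + d, G) \<in> J"
      "A = 0 \<or> (\<exists>a. a + d = e + e' + d \<and> homogeneous a A)" by (rule ideal_plusE)
    have "(e + e' + d, A * h) \<in> J"
      using GA(3) C zero by (auto simp: full_degree_def colon_ideal_def)
    then show "(e + e' + d, H) \<in> J" using GA add by auto
  qed
  then show False using not_full by blast
qed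

lemma one_notin: "(0, 1) \<notin> J"
proof
  assume "(0, 1) \<in> J"
  then have "full_degree J 0" using mult[of 0 1 0] by (auto simp: full_degree_def)
  then show False using not_full by blast
qed

lemma Var_power_notin:
  fixes j :: 'n
  shows "(1, Var j) \<notin> J \<Longrightarrow> (k, Var j ^ k) \<notin> J"
proof (induction k)
  case (Suc k)
  then show ?case using prime[OF homogeneous_Var[of j] homogeneous_Var_power[of k j]] by auto
qed (simp add: one_notin)

lemma ex_Var_notin: "\<exists>j. (1, Var j) \<notin> J"
proof (rule ccontr)
  assume *: "\<not> ?thesis"
  have "full_degree J 1"
    unfolding full_degree_def
  proof (intro allI impI)
    fix H :: "('n, 'k) mpoly" assume "homogeneous 1 H"
    moreover have "d = 1 \<longrightarrow> (d, H) \<in> J" if "homogeneous d H" for d and H :: "('n, 'k) mpoly"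
      using that
    proof (induction rule: homogeneous_induct)
      case (Var d k H)
      then show ?case using * mult[of 1 "Var k" d H] by (auto simp: mult.commute)
    qed (auto intro: zero add)
    ultimately show "(1, H) \<in> J" by blast
  qed
  then show False using not_full by blast
qed

text \<open>Over an algebraically closed field a binary form is a product of linear forms, and the ideal is
  prime.\<close>

lemma Var_proportional_if_binary_form:
  assumes j: "(1, Var j) \<notin> J" and "p \<noteq> 0" "degree p \<le> D" "(D, binary_form i j D p) \<in> J"
  shows "\<exists>c. (1, Var i - Const c * Var j) \<in> J"
  using assms(2-4)
proof (induction D arbitrary: p)
  have deg0: False if p: "p \<noteq> 0" "degree p = 0" "(D, binary_form i j D p) \<in> J" for D p
  proof -
    obtain u where u: "p = [:u:]" "u \<noteq> 0" using p(1,2) by (metis degree_eq_zeroE pCons_0_0)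
    have "binary_form i j D p = Const u * Var j ^ D"
      unfolding binary_form_def u(1) sum.atMost_shift by (simp add: lessThan_Suc_atMost)
    then have "(D, Const (inverse u) * (Const u * Var j ^ D)) \<in> J" using p(3) scale by auto
    then have "(D, Var j ^ D) \<in> J"
      using u(2) by (simp add: mult.assoc[symmetric] Const_mult[symmetric])
    then show False using Var_power_notin[OF j] by blast
  qed
  {
    case 0
    then show ?case using deg0 by blast
  next
    case (Suc D)
    then have "degree p > 0" using deg0 by blast
    then obtain c where "poly p c = 0" using alg_closed_imp_poly_has_root by blast
    then obtain q where q: "p = [:- c, 1:] * q" by (metis dvdE poly_eq_0_iff_dvd)
    then have "q \<noteq> 0" "degree q \<le> D" using Suc.prems by (auto simp: degree_mult_eq simp del: mult_pCons_left)
    then have "(1 + D, (Var i - Const c * Var j) * binary_form i j D q) \<in> J"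
      using Suc.prems(3) unfolding q by (simp add: binary_form_root del: mult_pCons_left)
    then consider "(1, Var i - Const c * Var j) \<in> J" | "(D, binary_form i j D q) \<in> J"
      using prime[OF homogeneous_diff[OF homogeneous_Var homogeneous_Const_mult[OF homogeneous_Var]]
          homogeneous_binary_form] by blast
    then show ?case using Suc.IH \<open>q \<noteq> 0\<close> \<open>degree q \<le> D\<close> by cases auto
  }
qed

text \<open>Modulo \<open>J\<close>, each form of degree \<open>e\<close> is divisible by \<open>Var j\<close>, so that
  \<open>Var i ^ k * Var j ^ e\<close> is congruent to a multiple \<open>Var j ^ k * W k\<close> with \<open>W k\<close> of the fixed degree \<open>e\<close>.
  More of the \<open>W k\<close> than there are monomials of degree \<open>e\<close> are linearly dependent, and a dependency
  is a binary form in \<open>J\<close>.\<close>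

lemma Var_proportional:
  assumes j: "(1, Var j) \<notin> J"
  shows "\<exists>c. (1, Var i - Const c * Var j) \<in> J"
proof -
  have "J \<subset> ideal_plus J 1 (Var j)"
    using ideal_plus_superset ideal_plus_generator[OF ideal] j by blast
  then obtain e where e: "full_degree (ideal_plus J 1 (Var j)) e"
    using maximal graded_ideal_plus ideal homogeneous_Var by meson
  have "\<exists>W. homogeneous e W \<and> (k + e, Var i ^ k * Var j ^ e - Var j ^ k * W) \<in> J" for k
  proof (induction k)
    case 0
    then show ?case by (intro exI[of _ "Var j ^ e"]) (auto intro: homogeneous_Var_power zero)
  next
    case (Suc k)
    then obtain W where W: "homogeneous e W" "(k + e, Var i ^ k * Var j ^ e - Var j ^ k * W) \<in> J"
      by blast
    then have "(e, W) \<in> ideal_plus J 1 (Var j)" using e by (auto simp: full_degree_def)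
    then obtain G A where GA: "W = G + A * Var j" "(e, G) \<in> J" "A = 0 \<or> (\<exists>a. a + 1 = e \<and> homogeneous a A)"
      by (rule ideal_plusE)
    have hom: "homogeneous e (Var i * A)"
      using GA(3) homogeneous_mult[OF homogeneous_Var[of i], of _ A] by auto
    have "(1 + (k + e), Var i * (Var i ^ k * Var j ^ e - Var j ^ k * W)) \<in> J"
      by (intro mult W homogeneous_Var)
    moreover have "((1 + k) + e, (Var i * Var j ^ k) * G) \<in> J"
      by (intro mult GA homogeneous_mult homogeneous_Var homogeneous_Var_power)
    ultimately have "(Suc k + e, Var i * (Var i ^ k * Var j ^ e - Var j ^ k * W) + (Var i * Var j ^ k) * G) \<in> J"
      using add by simp
    also have "Var i * (Var i ^ k * Var j ^ e - Var j ^ k * W) + (Var i * Var j ^ k) * G =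
        Var i ^ Suc k * Var j ^ e - Var j ^ Suc k * (Var i * A)"
      by (simp add: GA(1) algebra_simps)
    finally show ?case using hom by blast
  qed
  then obtain W where W: "\<And>k. homogeneous e (W k)"
    "\<And>k. (k + e, Var i ^ k * Var j ^ e - Var j ^ k * W k) \<in> J" by metis
  \<comment> \<open>The \<open>D + 1\<close> forms \<open>W 0, \<dots>, W D\<close> live in a space of dimension \<open>D\<close>.\<close>
  define B where "B = {m :: 'n \<Rightarrow>\<^sub>0 nat. mdeg m = e}"
  define D where "D = card B"
  have "finite B" "card B < card {..D}" using finite_monomials by (auto simp: B_def D_def)
  then obtain a where a: "\<exists>k\<in>{..D}. a k \<noteq> 0"
    "\<And>m. m \<in> B \<Longrightarrow> (\<Sum>k\<le>D. a k * Poly_Mapping.lookup (W k) m) = 0"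
    using linear_dependence[of B "{..D}" "\<lambda>k. Poly_Mapping.lookup (W k)"] by auto
  have "Poly_Mapping.lookup (\<Sum>k\<le>D. Const (a k) * W k) m = 0" for m
  proof (cases "m \<in> B")
    case True
    then show ?thesis using a(2) by (simp add: lookup_sum lookup_Const_mult)
  next
    case False
    then have "Poly_Mapping.lookup (W k) m = 0" for k
      using W(1)[of k] by (auto simp: homogeneous_def B_def in_keys_iff)
    then show ?thesis by (simp add: lookup_sum lookup_Const_mult)
  qed
  then have dep: "(\<Sum>k\<le>D. Const (a k) * W k) = 0" by (intro poly_mapping_eqI) simp
  define p where "p = (\<Sum>k\<le>D. monom (a k) k)"
  have coeff_p: "coeff p k = (if k \<le> D then a k else 0)" for k
    by (auto simp: p_def coeff_sum)
  have "p \<noteq> 0" using a(1) coeff_p by (metis atMost_iff coeff_0)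
  moreover have "degree p \<le> D" by (rule degree_le) (simp add: coeff_p)
  moreover have "(D, binary_form i j D p) \<in> J"
  proof -
    have "(D + e, \<Sum>k\<le>D. Const (a k) * (Var j ^ (D - k) * (Var i ^ k * Var j ^ e - Var j ^ k * W k))) \<in> J"
    proof (intro graded_ideal_sum[OF ideal] scale)
      fix k assume "k \<in> {..D}"
      then show "(D + e, Var j ^ (D - k) * (Var i ^ k * Var j ^ e - Var j ^ k * W k)) \<in> J"
        using mult[OF W(2)[of k] homogeneous_Var_power[of "D - k" j]] by simp
    qed
    also have "(\<Sum>k\<le>D. Const (a k) * (Var j ^ (D - k) * (Var i ^ k * Var j ^ e - Var j ^ k * W k)))
      = (\<Sum>k\<le>D. Const (a k) * Var i ^ k * Var j ^ (D - k) * Var j ^ e - Var j ^ D * (Const (a k) * W k))"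
    proof (intro sum.cong refl)
      fix k assume "k \<in> {..D}"
      then have "Var j ^ (D - k) * Var j ^ k = (Var j ^ D :: ('n, 'k) mpoly)"
        by (simp flip: power_add)
      moreover have *: "Const (a k) * (Var j ^ (D - k) * (Var i ^ k * Var j ^ e - Var j ^ k * W k)) =
          Const (a k) * Var i ^ k * Var j ^ (D - k) * Var j ^ e
            - (Var j ^ (D - k) * Var j ^ k) * (Const (a k) * W k)"
        by (simp only: right_diff_distrib mult_ac)
      ultimately show "Const (a k) * (Var j ^ (D - k) * (Var i ^ k * Var j ^ e - Var j ^ k * W k)) =
          Const (a k) * Var i ^ k * Var j ^ (D - k) * Var j ^ e - Var j ^ D * (Const (a k) * W k)"
        by simp
    qed
    also have "\<dots> = binary_form i j D p * Var j ^ e"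
      unfolding sum_subtractf sum_distrib_left[symmetric] sum_distrib_right[symmetric] dep
      by (simp add: binary_form_def coeff_p)
    finally show ?thesis
      using prime[OF homogeneous_binary_form homogeneous_Var_power] Var_power_notin[OF j] by blast
  qed
  ultimately show ?thesis using Var_proportional_if_binary_form[OF j] by blast
qed

text \<open>Modulo \<open>J\<close> all variables are multiples \<open>x i\<close> of a single one, so each form \<open>H\<close> is congruent to
  \<open>eval_poly x H\<close> times a power of that variable, and no such power lies in \<open>J\<close>.\<close>

lemma common_zero: "\<exists>x. (\<exists>j. x j \<noteq> 0) \<and> (\<forall>d H. (d, H) \<in> J \<longrightarrow> eval_poly x H = 0)"
proof -
  obtain j where j: "(1, Var j) \<notin> J" using ex_Var_notin by blast
  obtain x where x: "\<And>i. (1, Var i - Const (x i) * Var j) \<in> J"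
    using Var_proportional[OF j] by metis
  have "x j \<noteq> 0" using x[of j] j by auto
  moreover have "(d, H - Const (eval_poly x H) * Var j ^ d) \<in> J" if "homogeneous d H" for d H
    using that
  proof (induction rule: homogeneous_induct)
    case (add d G H)
    have "(d, (G - Const (eval_poly x G) * Var j ^ d) + (H - Const (eval_poly x H) * Var j ^ d)) \<in> J"
      using add maximal_graded_ideal.add[OF maximal_graded_ideal_axioms] by blast
    then show ?case by (simp add: ev.subst_poly_add Const_add algebra_simps)
  next
    case (Var d k H)
    have "(1 + d, Var k * (H - Const (eval_poly x H) * Var j ^ d)) \<in> J"
      using Var by (intro mult homogeneous_Var)
    moreover have "(d + 1, Var j ^ d * (Var k - Const (x k) * Var j)) \<in> J"
      by (intro mult x homogeneous_Var_power)
    ultimately have "(Suc d, Var k * (H - Const (eval_poly x H) * Var j ^ d) +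
        Const (eval_poly x H) * (Var j ^ d * (Var k - Const (x k) * Var j))) \<in> J"
      using add scale by simp
    then show ?case by (simp add: ev.subst_poly_mult Const_mult algebra_simps)
  qed (auto simp: zero)
  moreover have "eval_poly x H = 0" if "(d, H) \<in> J" for d H
  proof (rule ccontr)
    assume ne: "eval_poly x H \<noteq> 0"
    have "(d, H - Const (eval_poly x H) * Var j ^ d) \<in> J"
      using calculation(2) graded_ideal_homogeneous[OF ideal that] by blast
    then have "(d, Const (- inverse (eval_poly x H)) * ((H - Const (eval_poly x H) * Var j ^ d) + Const (-1) * H)) \<in> J"
      using add scale that by blast
    also have "(H - Const (eval_poly x H) * Var j ^ d) + Const (-1) * H = Const (- eval_poly x H) * Var j ^ d"
      by (simp add: Const_uminus)
    also have "Const (- inverse (eval_poly x H)) * \<dots> = Var j ^ d"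
      using ne by (simp flip: mult.assoc Const_mult)
    finally show False using Var_power_notin[OF j] by blast
  qed
  ultimately show ?thesis by blast
qed

end

text \<open>Enlarge the ideal to a maximal one without a full graded piece; that one has a zero.\<close>

theorem projective_Nullstellensatz:
  fixes I :: "(nat \<times> ('n::finite, 'k::alg_closed_field) mpoly) set"
  assumes "graded_ideal I"
    and "\<And>x. \<exists>j. x j \<noteq> 0 \<Longrightarrow> \<exists>d H. (d, H) \<in> I \<and> eval_poly x H \<noteq> 0"
  shows "\<exists>e. full_degree I e"
proof (rule ccontr)
  assume "\<not> ?thesis"
  then obtain J where J: "I \<subseteq> J" "maximal_graded_ideal J"
    using maximal_graded_ideal_exists assms(1) by blast
  then show False using maximal_graded_ideal.common_zero[OF J(2)] assms(2) by blast
qed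

section \<open>Zariski-closed sets\<close>

lemma proj_point_in_space: "x j \<noteq> 0 \<Longrightarrow> proj_point x \<in> proj_space"
  by (auto simp: proj_space_def)

lemma self_in_proj_point: "x \<in> proj_point x"
  unfolding proj_point_def using one_neq_zero by force

lemma proj_point_scale:
  assumes "c \<noteq> 0"
  shows "proj_point (\<lambda>j. c * x j) = proj_point x"
proof -
  have "\<exists>b'. (\<lambda>j. b * x j) = (\<lambda>j. b' * (c * x j)) \<and> b' \<noteq> 0" if "b \<noteq> 0" for b
    using assms that by (intro exI[of _ "b / c"]) auto
  moreover have "\<exists>b'. (\<lambda>j. b * (c * x j)) = (\<lambda>j. b' * x j) \<and> b' \<noteq> 0" if "b \<noteq> 0" for b
    using assms that by (intro exI[of _ "b * c"]) (auto simp: mult.assoc)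
  ultimately show ?thesis unfolding proj_point_def by auto
qed

lemma proj_point_eq:
  assumes "p \<in> proj_space" "x \<in> p"
  shows "p = proj_point x"
proof -
  obtain y where y: "p = proj_point y" using assms(1) by (auto simp: proj_space_def)
  then obtain c where "x = (\<lambda>j. c * y j)" "c \<noteq> 0" using assms(2) by (auto simp: proj_point_def)
  then show ?thesis using y proj_point_scale by metis
qed

lemma proj_space_nonempty: "p \<in> proj_space \<Longrightarrow> \<exists>x. x \<in> p"
  using self_in_proj_point by (auto simp: proj_space_def)

lemma proj_space_nonzero: "p \<in> proj_space \<Longrightarrow> x \<in> p \<Longrightarrow> \<exists>j. x j \<noteq> 0"
  by (auto simp: proj_space_def proj_point_def)

lemma proj_space_multiple: "p \<in> proj_space \<Longrightarrow> x \<in> p \<Longrightarrow> y \<in> p \<Longrightarrow> \<exists>c. c \<noteq> 0 \<and> y = (\<lambda>j. c * x j)"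
  using proj_point_eq[of p x] by (auto simp: proj_point_def)

lemma homogeneous_eval_zero_iff:
  assumes "homogeneous d H" "p \<in> proj_space" "x \<in> p" "y \<in> p"
  shows "eval_poly x H = 0 \<longleftrightarrow> eval_poly y H = 0"
proof -
  obtain c where "c \<noteq> 0" "y = (\<lambda>j. c * x j)" using proj_space_multiple[OF assms(2-4)] by blast
  then show ?thesis using eval_poly_scale[OF assms(1), of c x] by simp
qed

lemma in_basic_open_iff:
  assumes "homogeneous d H" "p \<in> proj_space" "x \<in> p"
  shows "p \<in> basic_open H \<longleftrightarrow> eval_poly x H \<noteq> 0"
  using homogeneous_eval_zero_iff[OF assms] assms(2,3) unfolding basic_open_def by blast

lemma basic_open_subset: "basic_open H \<subseteq> proj_space"
  by (auto simp: basic_open_def)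

lemma basic_open_mult: "basic_open (G * H) = basic_open G \<inter> basic_open H"
  by (auto simp: basic_open_def ev.subst_poly_mult)

lemma basic_open_one: "basic_open 1 = proj_space"
  by (auto simp: basic_open_def)

lemma openin_basic_open: "homogeneous d H \<Longrightarrow> openin zariski (basic_open H)"
  unfolding zariski_def by (rule topology_generated_by_Basis) blast

lemma topspace_zariski: "topspace (zariski :: ('n::finite, 'k::field) ppoint topology) = proj_space"
proof
  show "topspace (zariski :: ('n, 'k) ppoint topology) \<subseteq> proj_space"
    using basic_open_subset by (force simp: zariski_def)
  show "proj_space \<subseteq> topspace (zariski :: ('n, 'k) ppoint topology)"
    using openin_subset[OF openin_basic_open[OF homogeneous_one]] basic_open_one by blast
qed

lemma openin_zariski_subset: "openin zariski U \<Longrightarrow> U \<subseteq> proj_space"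
  using openin_subset topspace_zariski by blast

lemma closedin_zariski_subset: "closedin zariski A \<Longrightarrow> A \<subseteq> proj_space"
  using closedin_subset topspace_zariski by blast

text \<open>The basic open sets form a base, because they are closed under finite intersections.\<close>

lemma zariski_neighbourhood:
  fixes U :: "('n::finite, 'k::field) ppoint set"
  assumes "openin zariski U" "p \<in> U"
  shows "\<exists>d G. homogeneous d G \<and> p \<in> basic_open G \<and> basic_open G \<subseteq> U"
proof -
  have "generate_topology_on {basic_open H |H :: ('n, 'k) mpoly. \<exists>d. homogeneous d H} U"
    using assms(1) by (simp add: zariski_def openin_topology_generated_by_iff)
  then show ?thesis using assms(2)
  proof (induction arbitrary: p)
    case (Int a b)
    obtain d G where "homogeneous d G" "p \<in> basic_open G" "basic_open G \<subseteq> a"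
      using Int.IH(1) Int.prems by (metis IntE)
    moreover obtain e H where "homogeneous e H" "p \<in> basic_open H" "basic_open H \<subseteq> b"
      using Int.IH(2) Int.prems by (metis IntE)
    ultimately show ?case
      by (intro exI[of _ "d + e"] exI[of _ "G * H"]) (auto simp: basic_open_mult homogeneous_mult)
  next
    case (UN K)
    then obtain k where k: "k \<in> K" "p \<in> k" by blast
    then obtain d G where "homogeneous d G" "p \<in> basic_open G" "basic_open G \<subseteq> k" using UN.IH by metis
    then show ?case using k(1) by (metis Union_upper order_trans)
  next
    case (Basis s)
    then show ?case by blast
  qed simp
qed

lemma closedin_zariski_separate:
  assumes "closedin zariski A" "p \<in> proj_space" "p \<notin> A"
  shows "\<exists>d H. homogeneous d H \<and> p \<in> basic_open H \<and> (\<forall>q\<in>A. \<forall>x\<in>q. eval_poly x H = 0)"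
proof -
  have "openin zariski (proj_space - A)" using assms(1) topspace_zariski by (metis closedin_def)
  then obtain d H where H: "homogeneous d H" "p \<in> basic_open H" "basic_open H \<subseteq> proj_space - A"
    using zariski_neighbourhood assms by (metis DiffI)
  moreover have "eval_poly x H = 0" if "q \<in> A" "x \<in> q" for q x
    using in_basic_open_iff[OF H(1) _ that(2)] that H(3) closedin_zariski_subset[OF assms(1)] by blast
  ultimately show ?thesis by blast
qed

lemma closedin_zero_set:
  assumes "homogeneous d H"
  shows "closedin zariski {p \<in> proj_space. \<forall>x\<in>p. eval_poly x H = 0}"
proof -
  have "proj_space - {p \<in> proj_space. \<forall>x\<in>p. eval_poly x H = 0} = basic_open H"
    using homogeneous_eval_zero_iff[OF assms] proj_space_nonempty unfolding basic_open_def by blast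
  then show ?thesis using openin_basic_open[OF assms] by (auto simp: closedin_def topspace_zariski)
qed

text \<open>The linear forms vanishing at the point with coordinates \<open>x\<close>: the two-by-two minors of the
  matrix with rows \<open>x\<close> and the variables.\<close>

definition minor :: "('n \<Rightarrow> 'k::comm_ring_1) \<Rightarrow> 'n \<times> 'n \<Rightarrow> ('n::finite, 'k) mpoly" where
  "minor x ij = Const (x (fst ij)) * Var (snd ij) - Const (x (snd ij)) * Var (fst ij)"

lemma homogeneous_minor: "homogeneous 1 (minor x ij)"
  unfolding minor_def by (intro homogeneous_diff homogeneous_Const_mult homogeneous_Var)

lemma eval_minor: "eval_poly y (minor x (i, j)) = x i * y j - x j * y i"
  by (simp add: minor_def ev.subst_poly_diff ev.subst_poly_mult)

lemma minors_zero_imp_proportional: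
  fixes x y :: "'n \<Rightarrow> 'k::field"
  assumes "\<And>i j. x i * y j = x j * y i" "x k \<noteq> 0" "\<exists>j. y j \<noteq> 0"
  shows "proj_point y = proj_point x"
proof -
  define c where "c = y k / x k"
  have y: "y = (\<lambda>j. c * x j)" using assms(1)[of k] assms(2) by (auto simp: c_def field_simps)
  then have "c \<noteq> 0" using assms(3) by auto
  then show ?thesis using proj_point_scale y by metis
qed

lemma eval_minor_zero:
  assumes "p \<in> proj_space" "x \<in> p" "y \<in> p"
  shows "eval_poly y (minor x ij) = 0"
  using proj_space_multiple[OF assms] by (cases ij) (auto simp: eval_minor)

lemma closedin_zariski_point:
  assumes "p \<in> proj_space"
  shows "closedin zariski {p}"
proof -
  obtain x k where x: "x \<in> p" "x k \<noteq> 0" using assms proj_space_nonempty proj_space_nonzero by blast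
  have "{p} = (\<Inter>ij. {q \<in> proj_space. \<forall>y\<in>q. eval_poly y (minor x ij) = 0})"
  proof (intro equalityI subsetI)
    fix q assume "q \<in> {p}"
    then show "q \<in> (\<Inter>ij. {q \<in> proj_space. \<forall>y\<in>q. eval_poly y (minor x ij) = 0})"
      using eval_minor_zero[OF assms x(1)] assms by blast
  next
    fix q assume q: "q \<in> (\<Inter>ij. {q \<in> proj_space. \<forall>y\<in>q. eval_poly y (minor x ij) = 0})"
    then obtain y where y: "q \<in> proj_space" "y \<in> q" using proj_space_nonempty by blast
    then have "eval_poly y (minor x (i, j)) = 0" for i j using q by blast
    then have "x i * y j = x j * y i" for i j using eval_minor[of y x i j] by simp
    then have "proj_point y = proj_point x"
      using minors_zero_imp_proportional[of x y] x(2) proj_space_nonzero[OF y] by blast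
    then show "q \<in> {p}" using proj_point_eq y x(1) assms by blast
  qed
  moreover have "closedin zariski (\<Inter>ij. {q \<in> proj_space. \<forall>y\<in>q. eval_poly y (minor x ij) = 0})"
    by (intro closedin_INT closedin_zero_set[OF homogeneous_minor]) simp
  ultimately show ?thesis by (simp only:)
qed

lemma irreducible_closed_point: "p \<in> proj_space \<Longrightarrow> irreducible_closed {p}"
  using closedin_zariski_point unfolding irreducible_closed_def
  by (metis Un_upper1 Un_upper2 insert_not_empty subset_singletonD sup_bot_left)

subsection \<open>The descending chain condition\<close>

text \<open>Choose indices whose value is minimal among all later values.\<close>

lemma nat_increasing_subsequence:
  fixes s :: "nat \<Rightarrow> nat"
  shows "\<exists>r. strict_mono r \<and> incseq (\<lambda>k. s (r k))"
proof -
  define P where "P x \<longleftrightarrow> (\<forall>j\<ge>x. s x \<le> s j)" for x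
  have least: "\<exists>y\<ge>x. P y" for x
  proof -
    obtain y where "y \<ge> x" "\<And>j. j \<ge> x \<Longrightarrow> s y \<le> s j"
      using ex_has_least_nat[of "\<lambda>y. y \<ge> x" x s] by auto
    then show ?thesis by (intro exI[of _ y]) (auto simp: P_def)
  qed
  have "\<exists>r. \<forall>n. P (r n) \<and> r n < r (Suc n)"
  proof (rule dependent_nat_choice)
    show "\<exists>x. P x" using least by blast
    show "\<exists>y. P y \<and> x < y" for x using least[of "Suc x"] by (auto simp: Suc_le_eq)
  qed
  then obtain r where r: "\<And>n. P (r n)" "\<And>n. r n < r (Suc n)" by blast
  then show ?thesis
    by (intro exI[of _ r] conjI incseq_SucI) (auto simp: strict_mono_Suc_iff P_def less_imp_le)
qed

text \<open>Dickson's lemma: pass, for one coordinate after the other, to a subsequence along which that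
  coordinate increases.\<close>

lemma dickson:
  fixes f :: "nat \<Rightarrow> 'n::finite \<Rightarrow> nat"
  shows "\<exists>i j. i < j \<and> (\<forall>l. f i l \<le> f j l)"
proof -
  have "\<exists>r. strict_mono r \<and> (\<forall>l\<in>S. incseq (\<lambda>k. f (r k) l))" if "finite S" for S :: "'n set"
    using that
  proof (induction S)
    case empty
    show ?case by (auto intro: exI[of _ id] simp: strict_mono_def)
  next
    case (insert l S)
    then obtain r where r: "strict_mono r" "\<And>l. l \<in> S \<Longrightarrow> incseq (\<lambda>k. f (r k) l)" by blast
    obtain r' where r': "strict_mono r'" "incseq (\<lambda>k. f (r (r' k)) l)"
      using nat_increasing_subsequence[of "\<lambda>k. f (r k) l"] by blast
    have "incseq (\<lambda>k. f (r (r' k)) l')" if "l' \<in> S" for l'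
      using r(2)[OF that] r'(1) by (auto simp: incseq_def strict_mono_less_eq)
    then show ?case using r r' strict_mono_o[OF r(1) r'(1)] by (intro exI[of _ "r \<circ> r'"]) (auto simp: o_def)
  qed
  then obtain r where "strict_mono r" "\<And>l. incseq (\<lambda>k. f (r k) l)" by (metis finite UNIV_I)
  then show ?thesis
    by (intro exI[of _ "r 0"] exI[of _ "r 1"]) (auto simp: strict_mono_def incseq_def)
qed

text \<open>A monomial order without ordering the variables: assign distinct primes to the variables
  and compare monomials by the products of prime powers.\<close>

lemma monomial_order_exists:
  "\<exists>\<phi> :: ('n::finite \<Rightarrow>\<^sub>0 nat) \<Rightarrow> nat. inj \<phi> \<and> (\<forall>m m'. \<phi> (m + m') = \<phi> m * \<phi> m')"
proof -
  obtain g :: "'n \<Rightarrow> nat" where g: "inj g"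
    using finite_imp_inj_to_nat_seg[of "UNIV :: 'n set"] by auto
  obtain r :: "nat \<Rightarrow> nat" where r: "strict_mono r" "\<And>n. prime (r n)"
    using infinite_enumerate[OF primes_infinite] by auto
  define \<pi> where "\<pi> = r \<circ> g"
  have inj: "inj \<pi>" using g r(1) by (auto simp: \<pi>_def intro: inj_compose strict_mono_imp_inj_on)
  have prime: "prime (\<pi> j)" for j using r(2) by (simp add: \<pi>_def)
  define \<phi> where "\<phi> m = (\<Prod>j\<in>UNIV. \<pi> j ^ Poly_Mapping.lookup m j)" for m
  have "multiplicity (\<pi> j) (\<phi> m) = Poly_Mapping.lookup m j" for m j
  proof -
    have "\<phi> m = (\<Prod>p\<in>range \<pi>. p ^ Poly_Mapping.lookup m (inv_into UNIV \<pi> p))"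
      by (simp add: \<phi>_def prod.reindex[OF inj] inj inv_f_f)
    then show ?thesis
      using multiplicity_prod_prime_powers[of "range \<pi>" "\<pi> j" "\<lambda>p. Poly_Mapping.lookup m (inv_into UNIV \<pi> p)"]
        prime inj by (auto simp: inv_f_f)
  qed
  then have "inj \<phi>" by (intro injI poly_mapping_eqI) metis
  moreover have "\<phi> (m + m') = \<phi> m * \<phi> m'" for m m'
    by (simp add: \<phi>_def lookup_add power_add prod.distrib)
  ultimately show ?thesis by blast
qed

lemma lookup_monomial_mult:
  fixes H :: "('n::finite, 'k::comm_ring_1) mpoly"
  shows "Poly_Mapping.lookup (Poly_Mapping.single d c * H) (d + m) = c * Poly_Mapping.lookup H m"
  by (induction H rule: mpoly_induct)
     (auto simp: mult_single lookup_single when_def lookup_add distrib_left)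

definition vanishing :: "('n::finite, 'k::field) ppoint set \<Rightarrow> ('n, 'k) mpoly set" where
  "vanishing A = {H. \<forall>p\<in>A. \<forall>x\<in>p. eval_poly x H = 0}"

lemma vanishing_diff: "G \<in> vanishing A \<Longrightarrow> H \<in> vanishing A \<Longrightarrow> G - H \<in> vanishing A"
  and vanishing_mult: "H \<in> vanishing A \<Longrightarrow> G * H \<in> vanishing A"
  and vanishing_mono: "A \<subseteq> B \<Longrightarrow> vanishing B \<subseteq> vanishing A"
  by (auto simp: vanishing_def ev.subst_poly_diff ev.subst_poly_mult)

text \<open>Hilbert's basis theorem, in the guise of the descending chain condition.  In each step of the
  chain pick, among the polynomials that vanish on the smaller set only, one with least leading
  monomial.  By Dickson's lemma the leading monomial \<open>m i\<close> divides a later \<open>m j\<close>, and cancelling it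
  produces a smaller choice at step \<open>j\<close>.\<close>

lemma zariski_noetherian:
  fixes A :: "nat \<Rightarrow> ('n::finite, 'k::field) ppoint set"
  assumes closed: "\<And>k. closedin zariski (A k)" and dec: "\<And>k. A (Suc k) \<subset> A k"
  shows False
proof -
  obtain \<phi> :: "('n \<Rightarrow>\<^sub>0 nat) \<Rightarrow> nat" where \<phi>: "inj \<phi>" "\<And>m m'. \<phi> (m + m') = \<phi> m * \<phi> m'"
    using monomial_order_exists by blast
  define L where "L H = Max (\<phi> ` Poly_Mapping.keys H)" for H :: "('n, 'k) mpoly"
  have mono: "A j \<subseteq> A i" if "i \<le> j" for i j
  proof (rule lift_Suc_antimono_le[of A, OF _ that])
    show "A (Suc k) \<subseteq> A k" for k using dec[of k] by (rule psubset_imp_subset)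
  qed
  have "\<exists>H. H \<in> vanishing (A (Suc k)) - vanishing (A k)" for k
  proof -
    obtain p where p: "p \<in> A k" "p \<notin> A (Suc k)" using dec[of k] by blast
    then have "p \<in> proj_space" using closedin_zariski_subset[OF closed[of k]] by blast
    then obtain d H where H: "homogeneous d H" "p \<in> basic_open H"
      "\<forall>q\<in>A (Suc k). \<forall>x\<in>q. eval_poly x H = 0"
      using closedin_zariski_separate[OF closed[of "Suc k"]] p by blast
    obtain x where "x \<in> p" using proj_space_nonempty[OF \<open>p \<in> proj_space\<close>] by blast
    then show ?thesis using H p(1) unfolding vanishing_def basic_open_def by blast
  qed
  then have ex: "\<exists>H. H \<in> vanishing (A (Suc k)) - vanishing (A k)" for k .
  have "\<exists>H. H \<in> vanishing (A (Suc k)) - vanishing (A k) \<and>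
      (\<forall>G. G \<in> vanishing (A (Suc k)) - vanishing (A k) \<longrightarrow> L H \<le> L G)" for k
  proof -
    obtain H0 where "H0 \<in> vanishing (A (Suc k)) - vanishing (A k)" using ex by blast
    then show ?thesis by (rule ex_has_least_nat)
  qed
  then obtain H where H: "\<And>k. H k \<in> vanishing (A (Suc k)) - vanishing (A k)"
    and least: "\<And>k G. G \<in> vanishing (A (Suc k)) - vanishing (A k) \<Longrightarrow> L (H k) \<le> L G" by metis
  have nz: "P \<noteq> 0" if "P \<in> vanishing (A (Suc k)) - vanishing (A k)" for P k
    using that by (auto simp: vanishing_def)
  have L: "\<phi> m \<le> L P" if "m \<in> Poly_Mapping.keys P" for m P using that by (simp add: L_def)
  have L_in: "L P \<in> \<phi> ` Poly_Mapping.keys P" if "P \<noteq> 0" for P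
    unfolding L_def using that by (intro Max_in) auto
  have "\<exists>m. m \<in> Poly_Mapping.keys (H k) \<and> \<phi> m = L (H k)" for k
    using L_in[OF nz[OF H[of k]]] by force
  then obtain m where m: "\<And>k. m k \<in> Poly_Mapping.keys (H k)" "\<And>k. \<phi> (m k) = L (H k)" by metis
  obtain i j where ij: "i < j" "\<And>l. Poly_Mapping.lookup (m i) l \<le> Poly_Mapping.lookup (m j) l"
    using dickson[of "\<lambda>k. Poly_Mapping.lookup (m k)"] by blast
  define \<delta> where "\<delta> = m j - m i"
  have mj: "m j = \<delta> + m i"
    using ij(2) by (intro poly_mapping_eqI) (simp add: \<delta>_def lookup_add lookup_minus)
  define S where "S = Poly_Mapping.single \<delta> (Poly_Mapping.lookup (H j) (m j) / Poly_Mapping.lookup (H i) (m i))"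
  define G where "G = H j - S * H i"
  have Hi: "H i \<in> vanishing (A (Suc j))" "H i \<in> vanishing (A j)"
    using H[of i] vanishing_mono[OF mono] ij(1) by (meson DiffD1 Suc_leI le_SucI subsetD)+
  have G: "G \<in> vanishing (A (Suc j)) - vanishing (A j)"
  proof
    show "G \<in> vanishing (A (Suc j))" using Hi H[of j] by (auto simp: G_def intro!: vanishing_diff vanishing_mult)
    show "G \<notin> vanishing (A j)"
    proof
      assume "G \<in> vanishing (A j)"
      then have "G - (- S) * H i \<in> vanishing (A j)" using Hi vanishing_diff vanishing_mult by blast
      then show False using H[of j] by (simp add: G_def)
    qed
  qed
  have "Poly_Mapping.lookup (H i) (m i) \<noteq> 0" using m(1)[of i] by (simp add: in_keys_iff)
  then have "Poly_Mapping.lookup G (m j) = 0"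
    unfolding G_def S_def lookup_minus by (simp add: mj lookup_monomial_mult)
  then have "m j \<notin> Poly_Mapping.keys G" by (simp add: in_keys_iff)
  moreover have "\<phi> k \<le> \<phi> (m j)" if k: "k \<in> Poly_Mapping.keys G" for k
  proof -
    have "k \<in> Poly_Mapping.keys (H j) \<or> k \<in> Poly_Mapping.keys (S * H i)"
      using k by (auto simp: G_def in_keys_iff lookup_minus)
    then show ?thesis
    proof
      assume "k \<in> Poly_Mapping.keys (H j)"
      then show ?thesis using L m(2) by metis
    next
      assume "k \<in> Poly_Mapping.keys (S * H i)"
      then obtain a b where ab: "k = a + b" "a \<in> Poly_Mapping.keys S" "b \<in> Poly_Mapping.keys (H i)"
        using keys_mult[of S "H i"] by blast
      then have "a = \<delta>" by (auto simp: S_def split: if_splits)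
      moreover have "\<phi> b \<le> \<phi> (m i)" using L[OF ab(3)] m(2) by simp
      ultimately show ?thesis using ab(1) mj by (simp add: \<phi>(2))
    qed
  qed
  moreover obtain k where "k \<in> Poly_Mapping.keys G" "\<phi> k = L G" using L_in[OF nz[OF G]] by force
  ultimately have "L G \<le> \<phi> (m j)" "L G \<noteq> \<phi> (m j)" using \<phi>(1) by (metis, metis injD)
  then show False using least[OF G] m(2)[of j] by simp
qed

text \<open>Noetherian induction: a closed set that is not irreducible is a union of two smaller ones.\<close>

lemma closed_finite_union_of_irreducibles:
  fixes A :: "('n::finite, 'k::field) ppoint set"
  assumes "closedin zariski A"
  shows "\<exists>F. finite F \<and> (\<forall>Z\<in>F. irreducible_closed Z) \<and> A = \<Union>F"
proof -
  define R where "R = {(B, A :: ('n, 'k) ppoint set). closedin zariski A \<and> closedin zariski B \<and> B \<subset> A}"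
  have "wf R"
    unfolding wf_iff_no_infinite_down_chain
  proof
    assume "\<exists>f. \<forall>i. (f (Suc i), f i) \<in> R"
    then obtain f where "\<And>i. (f (Suc i), f i) \<in> R" by blast
    then show False by (intro zariski_noetherian[of f]) (auto simp: R_def)
  qed
  then show ?thesis using assms
  proof (induction A rule: wf_induct_rule)
    case (less A)
    show ?case
    proof (cases "A = {} \<or> irreducible_closed A")
      case True
      then show ?thesis
      proof
        assume "A = {}"
        then show ?thesis by (intro exI[of _ "{}"]) auto
      next
        assume "irreducible_closed A"
        then show ?thesis by (intro exI[of _ "{A}"]) auto
      qed
    next
      case False
      then obtain B C where BC: "closedin zariski B" "closedin zariski C" "A = B \<union> C" "A \<noteq> B" "A \<noteq> C"
        using less.prems by (auto simp: irreducible_closed_def)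
      then have "(B, A) \<in> R" "(C, A) \<in> R" using less.prems by (auto simp: R_def)
      then obtain F F' where "finite F" "\<forall>Z\<in>F. irreducible_closed Z" "B = \<Union>F"
        "finite F'" "\<forall>Z\<in>F'. irreducible_closed Z" "C = \<Union>F'"
        using less.IH BC by meson
      then show ?thesis using BC(3) by (intro exI[of _ "F \<union> F'"]) auto
    qed
  qed
qed

lemma zariski_dim_ge:
  assumes "A \<noteq> {}" "\<And>i. i \<le> m \<Longrightarrow> irreducible_closed (Z i) \<and> Z i \<subseteq> A" "\<And>i. i < m \<Longrightarrow> Z i \<subset> Z (Suc i)"
  shows "zariski_dim A \<ge> ereal (real m)"
proof -
  have "m \<in> {m. \<exists>Z. (\<forall>i\<le>m. irreducible_closed (Z i) \<and> Z i \<subseteq> A) \<and> (\<forall>i<m. Z i \<subset> Z (Suc i))}"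
    using assms(2,3) by blast
  then show ?thesis using assms(1) unfolding zariski_dim_def by (simp only: if_False) (rule SUP_upper)
qed

lemma zariski_dim_negative_imp_empty:
  assumes "A \<subseteq> proj_space" "zariski_dim A < 0"
  shows "A = {}"
proof (rule ccontr)
  assume "A \<noteq> {}"
  then obtain p where "p \<in> A" by blast
  then have "zariski_dim A \<ge> ereal (real 0)"
    using assms(1) irreducible_closed_point by (intro zariski_dim_ge[where Z = "\<lambda>_. {p}"]) auto
  then show False using assms(2) by (simp add: zero_ereal_def)
qed

text \<open>An irreducible component with more than one point would give, with one of its points, a chain of
  length \<open>1\<close>.\<close>

lemma zero_dimensional_imp_finite:
  assumes A: "closedin zariski A" and dim: "zariski_dim A \<le> 0"
  shows "finite A"
proof -
  obtain F where F: "finite F" "\<forall>Z\<in>F. irreducible_closed Z" "A = \<Union>F"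
    using closed_finite_union_of_irreducibles[OF A] by blast
  have "finite Z" if Z: "Z \<in> F" for Z
  proof -
    obtain p where p: "p \<in> Z" using F(2) Z unfolding irreducible_closed_def by blast
    have "Z = {p}"
    proof (rule ccontr)
      assume "Z \<noteq> {p}"
      then have "{p} \<subset> Z" using p by blast
      moreover have "p \<in> proj_space" using p Z F(3) closedin_zariski_subset[OF A] by blast
      ultimately have "zariski_dim A \<ge> ereal (real 1)"
        using F(2,3) Z p irreducible_closed_point
        by (intro zariski_dim_ge[where Z = "\<lambda>i. if i = 0 then {p} else Z"]) auto
      then have "ereal 1 \<le> 0" using dim order_trans by fastforce
      then show False by (simp add: zero_ereal_def)
    qed
    then show ?thesis by simp
  qed
  then show ?thesis using F by blast
qed

section \<open>Sections of the ideal sheaves\<close>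

lemma is_quotient_on_subset: "is_quotient_on V s A B \<Longrightarrow> V' \<subseteq> V \<Longrightarrow> is_quotient_on V' s A B"
  by (auto simp: is_quotient_on_def)

lemma is_quotient_on_cong:
  "is_quotient_on V s A B \<Longrightarrow> (\<And>p. p \<in> V \<Longrightarrow> t p = s p) \<Longrightarrow> is_quotient_on V t A B"
  by (auto simp: is_quotient_on_def)

lemma is_quotient_on_const: "is_quotient_on V (\<lambda>_. c) (Const c) 1"
  unfolding is_quotient_on_def using homogeneous_Const homogeneous_one by auto

lemma is_quotient_on_add:
  assumes "is_quotient_on V s A B" "is_quotient_on V t C D"
  shows "is_quotient_on V (\<lambda>p. s p + t p) (A * D + C * B) (B * D)"
proof -
  obtain e e' where e: "homogeneous e A" "homogeneous e B" "homogeneous e' C" "homogeneous e' D"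
    using assms by (auto simp: is_quotient_on_def)
  have "homogeneous (e + e') (A * D + C * B)" "homogeneous (e + e') (B * D)"
    using e homogeneous_mult[of e A e' D] homogeneous_mult[of e' C e B] homogeneous_mult[of e B e' D]
    by (auto simp: add.commute intro: homogeneous_add)
  then show ?thesis
    using assms by (auto simp: is_quotient_on_def ev.subst_poly_add ev.subst_poly_mult add_frac_eq)
qed

lemma is_quotient_on_mult:
  assumes "is_quotient_on V s A B" "is_quotient_on V t C D"
  shows "is_quotient_on V (\<lambda>p. s p * t p) (A * C) (B * D)"
proof -
  obtain e e' where "homogeneous e A" "homogeneous e B" "homogeneous e' C" "homogeneous e' D"
    using assms by (auto simp: is_quotient_on_def)
  then have "homogeneous (e + e') (A * C)" "homogeneous (e + e') (B * D)"
    by (auto intro: homogeneous_mult)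
  then show ?thesis using assms by (auto simp: is_quotient_on_def ev.subst_poly_mult)
qed

lemma regular_functionsD:
  assumes "s \<in> regular_functions U" "p \<in> U"
  obtains V A B where "openin zariski V" "p \<in> V" "V \<subseteq> U" "is_quotient_on V s A B"
  using assms unfolding regular_functions_def by blast

lemma regular_const: "openin zariski U \<Longrightarrow> (\<lambda>p\<in>U. c) \<in> regular_functions U"
proof -
  assume U: "openin zariski U"
  have "is_quotient_on U (\<lambda>p\<in>U. c) (Const c) 1"
    by (rule is_quotient_on_cong[OF is_quotient_on_const]) simp
  then show ?thesis using U unfolding regular_functions_def by blast
qed

lemma regular_binop:
  assumes s: "s \<in> regular_functions U" and t: "t \<in> regular_functions U"
    and op: "\<And>V A B C D. is_quotient_on V s A B \<Longrightarrow> is_quotient_on V t C D \<Longrightarrow>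
      \<exists>E F. is_quotient_on V (\<lambda>p. f (s p) (t p)) E F"
  shows "(\<lambda>p\<in>U. f (s p) (t p)) \<in> regular_functions U"
  unfolding regular_functions_def
proof (intro CollectI conjI ballI)
  fix p assume "p \<in> U"
  obtain V A B where V: "openin zariski V" "p \<in> V" "V \<subseteq> U" "is_quotient_on V s A B"
    using regular_functionsD[OF s \<open>p \<in> U\<close>] .
  obtain V' C D where V': "openin zariski V'" "p \<in> V'" "V' \<subseteq> U" "is_quotient_on V' t C D"
    using regular_functionsD[OF t \<open>p \<in> U\<close>] .
  obtain E F where "is_quotient_on (V \<inter> V') (\<lambda>p. f (s p) (t p)) E F"
    using op[of "V \<inter> V'"] is_quotient_on_subset[OF V(4)] is_quotient_on_subset[OF V'(4)]
    by (meson Int_lower1 Int_lower2)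
  then have "is_quotient_on (V \<inter> V') (\<lambda>p\<in>U. f (s p) (t p)) E F"
    by (rule is_quotient_on_cong) (use V(3) in auto)
  then show "\<exists>V A B. openin zariski V \<and> p \<in> V \<and> V \<subseteq> U \<and> is_quotient_on V (\<lambda>p\<in>U. f (s p) (t p)) A B"
    using V V' by (intro exI[of _ "V \<inter> V'"]) auto
qed simp

lemma regular_add:
  "s \<in> regular_functions U \<Longrightarrow> t \<in> regular_functions U \<Longrightarrow> (\<lambda>p\<in>U. s p + t p) \<in> regular_functions U"
  by (rule regular_binop[where f = "(+)"]) (blast intro: is_quotient_on_add)+

lemma regular_mult:
  "s \<in> regular_functions U \<Longrightarrow> t \<in> regular_functions U \<Longrightarrow> (\<lambda>p\<in>U. s p * t p) \<in> regular_functions U"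
  by (rule regular_binop[where f = "(*)"]) (blast intro: is_quotient_on_mult)+

lemma regular_extensional: "s \<in> regular_functions U \<Longrightarrow> s \<in> extensional U"
  by (simp add: regular_functions_def)

lemma regular_uminus:
  assumes "openin zariski U" "s \<in> regular_functions U"
  shows "(\<lambda>p\<in>U. - s p) \<in> regular_functions U"
proof -
  have "(\<lambda>p\<in>U. (\<lambda>p\<in>U. -1) p * s p) \<in> regular_functions U"
    using regular_mult[OF regular_const[OF assms(1)] assms(2)] .
  moreover have "(\<lambda>p\<in>U. (\<lambda>p\<in>U. -1) p * s p) = (\<lambda>p\<in>U. - s p)" by (rule restrict_ext) simp
  ultimately show ?thesis by simp
qed

lemma regular_ring_cring:
  fixes U :: "('n::finite, 'k::field) ppoint set"
  assumes "openin zariski U"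
  shows "cring (regular_ring U)"
proof (rule cringI)
  show "abelian_group (regular_ring U)"
  proof (rule abelian_groupI)
    fix s assume s: "s \<in> carrier (regular_ring U)"
    show "\<exists>t\<in>carrier (regular_ring U). t \<oplus>\<^bsub>regular_ring U\<^esub> s = \<zero>\<^bsub>regular_ring U\<^esub>"
      using s regular_uminus[OF assms]
      by (intro bexI[of _ "\<lambda>p\<in>U. - s p"]) (auto simp: regular_ring_def cong: restrict_cong)
    show "\<zero>\<^bsub>regular_ring U\<^esub> \<oplus>\<^bsub>regular_ring U\<^esub> s = s"
      using s regular_extensional by (auto simp: regular_ring_def intro!: extensionalityI[where A = U])
  qed (auto simp: regular_ring_def regular_add regular_const[OF assms] add_ac cong: restrict_cong)
  show "comm_monoid (regular_ring U)"
  proof (rule comm_monoidI)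
    fix s assume s: "s \<in> carrier (regular_ring U)"
    show "\<one>\<^bsub>regular_ring U\<^esub> \<otimes>\<^bsub>regular_ring U\<^esub> s = s"
      using s regular_extensional by (auto simp: regular_ring_def intro!: extensionalityI[where A = U])
  qed (auto simp: regular_ring_def regular_mult regular_const[OF assms] mult_ac cong: restrict_cong)
qed (auto simp: regular_ring_def distrib_right cong: restrict_cong)

text \<open>Coefficients that make all the products \<open>Q i * A i\<close> homogeneous of degree \<open>D\<close>; the zero
  polynomial is the only choice where \<open>D < d i\<close>.\<close>

definition cofactors ::
    "nat set \<Rightarrow> (nat \<Rightarrow> nat) \<Rightarrow> nat \<Rightarrow> (nat \<Rightarrow> ('n::finite, 'k::comm_ring_1) mpoly) \<Rightarrow> bool" where
  "cofactors I d D A \<longleftrightarrow> (\<forall>i\<in>I. A i = 0 \<or> (\<exists>a. a + d i = D \<and> homogeneous a (A i)))"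

lemma cofactors_zero: "cofactors I d D (\<lambda>_. 0)"
  by (simp add: cofactors_def)

lemma cofactors_add:
  assumes "cofactors I d D A" "cofactors I d D B"
  shows "cofactors I d D (\<lambda>i. A i + B i)"
  unfolding cofactors_def
proof
  fix i assume "i \<in> I"
  then show "A i + B i = 0 \<or> (\<exists>a. a + d i = D \<and> homogeneous a (A i + B i))"
    using assms by (fastforce simp: cofactors_def intro: homogeneous_add)
qed

lemma cofactors_mult:
  assumes "cofactors I d D A" "homogeneous e G"
  shows "cofactors I d (e + D) (\<lambda>i. G * A i)"
  unfolding cofactors_def
proof
  fix i assume "i \<in> I"
  then show "G * A i = 0 \<or> (\<exists>a. a + d i = e + D \<and> homogeneous a (G * A i))"
    using assms by (metis add.assoc cofactors_def homogeneous_mult mult_zero_right)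
qed

lemma cofactors_single:
  assumes "a + d i = D" "homogeneous a G"
  shows "cofactors I d D (\<lambda>j. if j = i then G else 0)"
  using assms by (auto simp: cofactors_def)

text \<open>On the cone over \<open>X\<close>, the form \<open>P\<close> of degree \<open>D\<close> lies in the ideal of the \<open>Q i\<close>.  The local
  variant asks for this only after multiplication by a form that does not vanish at \<open>p\<close>, which is
  what sections of a sheaf can express.\<close>

abbreviation combination ::
    "('n::finite, 'k::field) ppoint set \<Rightarrow> (nat \<Rightarrow> ('n, 'k) mpoly) \<Rightarrow> (nat \<Rightarrow> nat) \<Rightarrow> nat set \<Rightarrow>
     nat \<Rightarrow> ('n, 'k) mpoly \<Rightarrow> bool" where
  "combination X Q d I D P \<equiv> \<exists>A. cofactors I d D A \<and>
     (\<forall>q\<in>X. \<forall>x\<in>q. eval_poly x P = (\<Sum>i\<in>I. eval_poly x (Q i * A i)))"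

abbreviation locally_combination ::
    "('n::finite, 'k::field) ppoint set \<Rightarrow> (nat \<Rightarrow> ('n, 'k) mpoly) \<Rightarrow> (nat \<Rightarrow> nat) \<Rightarrow> nat set \<Rightarrow>
     ('n, 'k) ppoint \<Rightarrow> nat \<Rightarrow> ('n, 'k) mpoly \<Rightarrow> bool" where
  "locally_combination X Q d I p k P \<equiv> \<exists>D H A. homogeneous D H \<and> p \<in> basic_open H \<and>
     cofactors I d (D + k) A \<and>
     (\<forall>q\<in>X. \<forall>x\<in>q. eval_poly x (H * P) = (\<Sum>i\<in>I. eval_poly x (Q i * A i)))"

text \<open>Sections over \<open>V\<close> that, after multiplication by a form that does not vanish at \<open>p\<close>, agree on
  \<open>X\<close> with a combination of the \<open>Q i\<close>.  They form an ideal which contains the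
  generators of the ideal sheaf of \<open>X \<inter> \<Inter>i\<in>I. D i\<close>.\<close>

definition combinations_at ::
    "('n::finite, 'k::field) ppoint set \<Rightarrow> (nat \<Rightarrow> ('n, 'k) mpoly) \<Rightarrow> (nat \<Rightarrow> nat) \<Rightarrow> nat set \<Rightarrow>
     ('n, 'k) ppoint set \<Rightarrow> ('n, 'k) ppoint \<Rightarrow> (('n, 'k) ppoint \<Rightarrow> 'k) set" where
  "combinations_at X Q d I V p = {t \<in> regular_functions V. \<exists>D H A. homogeneous D H \<and> p \<in> basic_open H \<and>
     cofactors I d D A \<and>
     (\<forall>q\<in>X \<inter> V \<inter> basic_open H. \<forall>x\<in>q. eval_poly x H * t q = (\<Sum>i\<in>I. eval_poly x (Q i) * eval_poly x (A i)))}"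

lemma combinations_atI:
  assumes "t \<in> regular_functions V" "homogeneous D H" "p \<in> basic_open H" "cofactors I d D A"
    and "\<And>q x. q \<in> X \<Longrightarrow> q \<in> V \<Longrightarrow> q \<in> basic_open H \<Longrightarrow> x \<in> q \<Longrightarrow>
      eval_poly x H * t q = (\<Sum>i\<in>I. eval_poly x (Q i) * eval_poly x (A i))"
  shows "t \<in> combinations_at X Q d I V p"
  using assms unfolding combinations_at_def by blast

lemma combinations_atE:
  assumes "t \<in> combinations_at X Q d I V p"
  obtains D H A where "t \<in> regular_functions V" "homogeneous D H" "p \<in> basic_open H" "cofactors I d D A"
    and "\<And>q x. q \<in> X \<Longrightarrow> q \<in> V \<Longrightarrow> q \<in> basic_open H \<Longrightarrow> x \<in> q \<Longrightarrow>
      eval_poly x H * t q = (\<Sum>i\<in>I. eval_poly x (Q i) * eval_poly x (A i))"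
  using assms unfolding combinations_at_def by blast

lemma combinations_at_add:
  assumes "s \<in> combinations_at X Q d I V p" "t \<in> combinations_at X Q d I V p"
  shows "(\<lambda>q\<in>V. s q + t q) \<in> combinations_at X Q d I V p"
proof -
  obtain D H A where 1: "s \<in> regular_functions V" "homogeneous D H" "p \<in> basic_open H" "cofactors I d D A"
    and s: "\<And>q x. q \<in> X \<Longrightarrow> q \<in> V \<Longrightarrow> q \<in> basic_open H \<Longrightarrow> x \<in> q \<Longrightarrow>
      eval_poly x H * s q = (\<Sum>i\<in>I. eval_poly x (Q i) * eval_poly x (A i))"
    using assms(1) by (rule combinations_atE) blast
  obtain E G B where 2: "t \<in> regular_functions V" "homogeneous E G" "p \<in> basic_open G" "cofactors I d E B"
    and t: "\<And>q x. q \<in> X \<Longrightarrow> q \<in> V \<Longrightarrow> q \<in> basic_open G \<Longrightarrow> x \<in> q \<Longrightarrow>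
      eval_poly x G * t q = (\<Sum>i\<in>I. eval_poly x (Q i) * eval_poly x (B i))"
    using assms(2) by (rule combinations_atE) blast
  show ?thesis
  proof (rule combinations_atI)
    show "(\<lambda>q\<in>V. s q + t q) \<in> regular_functions V" using 1(1) 2(1) by (rule regular_add)
    show "homogeneous (D + E) (H * G)" using 1(2) 2(2) by (rule homogeneous_mult)
    show "p \<in> basic_open (H * G)" using 1(3) 2(3) by (simp add: basic_open_mult)
    show "cofactors I d (D + E) (\<lambda>i. G * A i + H * B i)"
      using cofactors_mult[OF 1(4) 2(2)] cofactors_mult[OF 2(4) 1(2)]
      by (intro cofactors_add) (simp_all add: add.commute)
    fix q x assume q: "q \<in> X" "q \<in> V" "q \<in> basic_open (H * G)" "x \<in> q"
    then have "q \<in> basic_open H" "q \<in> basic_open G" by (simp_all add: basic_open_mult)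
    then have "eval_poly x (H * G) * (s q + t q) =
        eval_poly x G * (\<Sum>i\<in>I. eval_poly x (Q i) * eval_poly x (A i)) +
        eval_poly x H * (\<Sum>i\<in>I. eval_poly x (Q i) * eval_poly x (B i))"
      using s[OF q(1,2) _ q(4), symmetric] t[OF q(1,2) _ q(4), symmetric]
      by (simp add: ev.subst_poly_mult algebra_simps)
    then show "eval_poly x (H * G) * (\<lambda>q\<in>V. s q + t q) q =
        (\<Sum>i\<in>I. eval_poly x (Q i) * eval_poly x (G * A i + H * B i))"
      using q(2) by (simp add: ev.subst_poly_mult ev.subst_poly_add sum_distrib_left sum.distrib[symmetric]
          distrib_left mult_ac)
  qed
qed

text \<open>Near \<open>p\<close> the function \<open>u\<close> is a quotient \<open>C / B\<close>; the denominator \<open>B\<close> and a form \<open>G\<close> cutting out the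
  neighbourhood are absorbed into the multiplier.\<close>

lemma combinations_at_mult:
  assumes t: "t \<in> combinations_at X Q d I V p" and u: "u \<in> regular_functions V" and p: "p \<in> V"
  shows "(\<lambda>q\<in>V. u q * t q) \<in> combinations_at X Q d I V p"
proof -
  obtain D H A where 1: "t \<in> regular_functions V" "homogeneous D H" "p \<in> basic_open H" "cofactors I d D A"
    and s: "\<And>q x. q \<in> X \<Longrightarrow> q \<in> V \<Longrightarrow> q \<in> basic_open H \<Longrightarrow> x \<in> q \<Longrightarrow>
      eval_poly x H * t q = (\<Sum>i\<in>I. eval_poly x (Q i) * eval_poly x (A i))"
    using t by (rule combinations_atE) blast
  obtain W B C where W: "openin zariski W" "p \<in> W" "W \<subseteq> V" and quot: "is_quotient_on W u C B"
    using regular_functionsD[OF u p] .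
  obtain e where e: "homogeneous e C" "homogeneous e B" using quot by (auto simp: is_quotient_on_def)
  obtain g G where G: "homogeneous g G" "p \<in> basic_open G" "basic_open G \<subseteq> W"
    using zariski_neighbourhood[OF W(1,2)] by blast
  have pB: "p \<in> basic_open B"
    using quot W(2) G(2) basic_open_subset by (auto simp: is_quotient_on_def basic_open_def)
  show ?thesis
  proof (rule combinations_atI)
    show "(\<lambda>q\<in>V. u q * t q) \<in> regular_functions V" using u 1(1) by (rule regular_mult)
    show "homogeneous ((e + g) + D) ((B * G) * H)" by (intro homogeneous_mult e G 1)
    show "p \<in> basic_open ((B * G) * H)" using 1(3) G(2) pB by (simp add: basic_open_mult)
    show "cofactors I d ((e + g) + D) (\<lambda>i. (C * G) * A i)"
      by (intro cofactors_mult 1 homogeneous_mult e G)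
    fix q x assume q: "q \<in> X" "q \<in> V" "q \<in> basic_open ((B * G) * H)" "x \<in> q"
    then have "q \<in> basic_open H" "q \<in> W" using G(3) by (auto simp: basic_open_mult)
    then have bu: "eval_poly x B * u q = eval_poly x C"
      using quot q(4) by (auto simp: is_quotient_on_def)
    have h: "eval_poly x H * t q = (\<Sum>i\<in>I. eval_poly x (Q i) * eval_poly x (A i))"
      using s q(1,2,4) \<open>q \<in> basic_open H\<close> by blast
    have "eval_poly x ((B * G) * H) * (u q * t q) =
        (eval_poly x B * u q) * eval_poly x G * (eval_poly x H * t q)"
      by (simp add: ev.subst_poly_mult mult_ac)
    also have "\<dots> = eval_poly x C * eval_poly x G * (\<Sum>i\<in>I. eval_poly x (Q i) * eval_poly x (A i))"
      by (simp only: bu h)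
    also have "\<dots> = (\<Sum>i\<in>I. eval_poly x (Q i) * eval_poly x ((C * G) * A i))"
      by (simp add: ev.subst_poly_mult sum_distrib_left mult_ac)
    finally show "eval_poly x ((B * G) * H) * (\<lambda>q\<in>V. u q * t q) q =
        (\<Sum>i\<in>I. eval_poly x (Q i) * eval_poly x ((C * G) * A i))"
      using q(2) by simp
  qed
qed

lemma combinations_at_ideal:
  assumes V: "openin zariski V" and p: "p \<in> V"
  shows "ideal (combinations_at X Q d I V p) (regular_ring V)"
proof -
  interpret cring "regular_ring V" by (rule regular_ring_cring[OF V])
  let ?W = "combinations_at X Q d I V p"
  have sub: "?W \<subseteq> regular_functions V" by (auto simp: combinations_at_def)
  have pP: "p \<in> proj_space" using openin_zariski_subset[OF V] p by blast
  have zero: "(\<lambda>q\<in>V. 0) \<in> ?W"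
    by (rule combinations_atI[OF regular_const[OF V] homogeneous_one _ cofactors_zero])
       (auto simp: basic_open_one pP)
  have minus: "\<ominus>\<^bsub>regular_ring V\<^esub> s = (\<lambda>q\<in>V. (\<lambda>q\<in>V. -1) q * s q)" if "s \<in> regular_functions V" for s
  proof (rule minus_equality)
    show "(\<lambda>q\<in>V. (\<lambda>q\<in>V. -1) q * s q) \<oplus>\<^bsub>regular_ring V\<^esub> s = \<zero>\<^bsub>regular_ring V\<^esub>"
      by (auto simp: regular_ring_def cong: restrict_cong)
  qed (use that regular_mult[OF regular_const[OF V] that] in \<open>auto simp: regular_ring_def\<close>)
  show ?thesis
  proof (rule idealI)
    show "subgroup ?W (add_monoid (regular_ring V))"
    proof (rule add.subgroupI)
      fix s assume "s \<in> ?W"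
      then have "(\<lambda>q\<in>V. (\<lambda>q\<in>V. -1) q * s q) \<in> ?W"
        using combinations_at_mult[OF _ regular_const[OF V] p] by blast
      then show "\<ominus>\<^bsub>regular_ring V\<^esub> s \<in> ?W" using minus \<open>s \<in> ?W\<close> sub by auto
    qed (use zero sub combinations_at_add in \<open>auto simp: regular_ring_def\<close>)
  next
    fix s u assume su: "s \<in> ?W" "u \<in> carrier (regular_ring V)"
    then have u: "u \<in> carrier (regular_ring V)" "s \<in> carrier (regular_ring V)"
      "u \<in> regular_functions V" using sub by (auto simp: regular_ring_def)
    have "(\<lambda>q\<in>V. u q * s q) \<in> ?W" using su(1) u(3) p by (rule combinations_at_mult)
    then show "u \<otimes>\<^bsub>regular_ring V\<^esub> s \<in> ?W" by (simp add: regular_ring_def)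
    then show "s \<otimes>\<^bsub>regular_ring V\<^esub> u \<in> ?W" using m_comm u by simp
  qed (rule ring_axioms)
qed

lemma reduced_subscheme_subset_combinations:
  assumes V: "openin zariski V" and p: "p \<in> V" and t: "t \<in> reduced_subscheme X V"
  shows "t \<in> combinations_at X Q d I V p"
proof (rule combinations_atI[OF _ homogeneous_one _ cofactors_zero])
  show "p \<in> basic_open 1" using openin_zariski_subset[OF V] p by (auto simp: basic_open_one)
qed (use t in \<open>auto simp: reduced_subscheme_def\<close>)

lemma hypersurface_subset_combinations:
  assumes p: "p \<in> V" and t: "t \<in> hypersurface (Q i) V"
    and I: "finite I" "i \<in> I" and Q: "homogeneous (d i) (Q i)"
  shows "t \<in> combinations_at X Q d I V p"
proof -
  obtain W A B where W: "openin zariski W" "p \<in> W" "W \<subseteq> V" and quot: "is_quotient_on W t (Q i * A) B"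
    using t p unfolding hypersurface_def by blast
  obtain e where e: "homogeneous e (Q i * A)" "homogeneous e B" using quot by (auto simp: is_quotient_on_def)
  obtain A' where A': "Q i * A' = Q i * A" "A' = 0 \<or> (\<exists>a. a + d i = e \<and> homogeneous a A')"
    using homogeneous_cofactor[OF Q e(1)] by blast
  obtain g G where G: "homogeneous g G" "p \<in> basic_open G" "basic_open G \<subseteq> W"
    using zariski_neighbourhood[OF W(1,2)] by blast
  have pB: "p \<in> basic_open B"
    using quot W(2) G(2) basic_open_subset by (auto simp: is_quotient_on_def basic_open_def)
  have "cofactors I d e (\<lambda>j. if j = i then A' else 0)" using A'(2) by (auto simp: cofactors_def)
  then have cof: "cofactors I d (g + e) (\<lambda>j. G * (if j = i then A' else 0))"
    using G(1) by (rule cofactors_mult)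
  show ?thesis
  proof (rule combinations_atI[OF _ _ _ cof])
    show "t \<in> regular_functions V" using t by (simp add: hypersurface_def)
    show "homogeneous (g + e) (G * B)" using G(1) e(2) by (rule homogeneous_mult)
    show "p \<in> basic_open (G * B)" using G(2) pB by (simp add: basic_open_mult)
    fix q x assume q: "q \<in> X" "q \<in> V" "q \<in> basic_open (G * B)" "x \<in> q"
    then have "q \<in> W" using G(3) by (auto simp: basic_open_mult)
    then have "eval_poly x B * t q = eval_poly x (Q i * A')"
      using quot q(4) A'(1) by (auto simp: is_quotient_on_def)
    then have "eval_poly x (G * B) * t q = eval_poly x G * (eval_poly x (Q i) * eval_poly x A')"
      by (simp add: ev.subst_poly_mult mult.assoc)
    also have "\<dots> = (\<Sum>j\<in>I. if j = i then eval_poly x (Q i) * eval_poly x (G * A') else 0)"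
      using I by (simp add: ev.subst_poly_mult mult_ac)
    also have "\<dots> = (\<Sum>j\<in>I. eval_poly x (Q j) * eval_poly x (G * (if j = i then A' else 0)))"
      by (intro sum.cong) auto
    finally show "eval_poly x (G * B) * t q =
        (\<Sum>j\<in>I. eval_poly x (Q j) * eval_poly x (G * (if j = i then A' else 0)))" .
  qed
qed

text \<open>The ideal of \<open>combinations_at\<close> contains the generators, hence the ideal that they generate.\<close>

lemma inter_with_local:
  assumes U: "p \<in> U" and s: "s \<in> inter_with X Q I U"
    and I: "finite I" and Q: "\<And>i. i \<in> I \<Longrightarrow> homogeneous (d i) (Q i)"
  shows "\<exists>V. openin zariski V \<and> p \<in> V \<and> V \<subseteq> U \<and> restrict s V \<in> combinations_at X Q d I V p"
proof -
  define F where "F = insert (reduced_subscheme X) ((\<lambda>i. hypersurface (Q i)) ` I)"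
  obtain V where V: "openin zariski V" "p \<in> V" "V \<subseteq> U"
    and r: "restrict s V \<in> Idl\<^bsub>regular_ring V\<^esub> (\<Union>Z\<in>F. Z V)"
    using s U unfolding inter_with_def subscheme_Inter_def sheafify_def F_def by blast
  have "(\<Union>Z\<in>F. Z V) \<subseteq> combinations_at X Q d I V p"
  proof (intro UN_least subsetI)
    fix Z t assume "Z \<in> F" and t: "t \<in> Z V"
    then consider "Z = reduced_subscheme X" | i where "i \<in> I" "Z = hypersurface (Q i)"
      unfolding F_def by blast
    then show "t \<in> combinations_at X Q d I V p"
    proof cases
      case 1
      then show ?thesis using reduced_subscheme_subset_combinations[OF V(1,2)] t by blast
    next
      case 2
      then show ?thesis using hypersurface_subset_combinations[of p V t Q i I d X] V(2) t I Q by blast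
    qed
  qed
  then have "Idl\<^bsub>regular_ring V\<^esub> (\<Union>Z\<in>F. Z V) \<subseteq> combinations_at X Q d I V p"
    unfolding genideal_def by (intro Inter_lower CollectI conjI combinations_at_ideal V)
  then show ?thesis using V r by blast
qed

text \<open>The two instances show that the intersection has no points outside \<open>X\<close> or off a hypersurface:
  around such a point one of the ideals contains the constant \<open>1\<close>.\<close>

lemma one_in_inter_with:
  assumes H: "homogeneous e H"
    and Z: "Z \<in> insert (reduced_subscheme X) ((\<lambda>i. hypersurface (Q i)) ` I)"
    and one: "(\<lambda>q\<in>basic_open H. 1) \<in> Z (basic_open H)"
  shows "(\<lambda>q\<in>basic_open H. 1) \<in> inter_with X Q I (basic_open H)"
proof -
  let ?U = "basic_open H"
  have U: "openin zariski ?U" using H by (rule openin_basic_open)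
  have "restrict (\<lambda>q\<in>?U. 1) ?U \<in> Idl\<^bsub>regular_ring ?U\<^esub>
      (\<Union>Z\<in>insert (reduced_subscheme X) ((\<lambda>i. hypersurface (Q i)) ` I). Z ?U)"
    using one Z unfolding genideal_def by auto
  then show ?thesis
    using U regular_const[OF U, of 1] unfolding inter_with_def subscheme_Inter_def sheafify_def by blast
qed

lemma points_inter_with:
  assumes X: "closedin zariski X" and I: "finite I"
    and Q: "\<And>i. i \<in> I \<Longrightarrow> homogeneous (d i) (Q i)"
  shows "points (inter_with X Q I) = {p \<in> X. \<forall>i\<in>I. \<forall>x\<in>p. eval_poly x (Q i) = 0}"
proof (intro equalityI subsetI)
  fix p assume p: "p \<in> points (inter_with X Q I)"
  then have pP: "p \<in> proj_space" by (simp add: points_def)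
  have no_one: "p \<notin> basic_open H"
    if "homogeneous e H" "Z \<in> insert (reduced_subscheme X) ((\<lambda>i. hypersurface (Q i)) ` I)"
      "(\<lambda>q\<in>basic_open H. 1) \<in> Z (basic_open H)" for e H Z
  proof
    assume "p \<in> basic_open H"
    then have "(\<lambda>q\<in>basic_open H. 1 :: 'b) p = 0"
      using p one_in_inter_with[OF that] openin_basic_open[OF that(1)] unfolding points_def by blast
    then show False using \<open>p \<in> basic_open H\<close> by simp
  qed
  have "p \<in> X"
  proof (rule ccontr)
    assume "p \<notin> X"
    then obtain e H where H: "homogeneous e H" "p \<in> basic_open H" "\<forall>q\<in>X. \<forall>x\<in>q. eval_poly x H = 0"
      using closedin_zariski_separate[OF X pP] by blast
    have "basic_open H \<inter> X = {}"
      using H(3) proj_space_nonempty unfolding basic_open_def by blast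
    then have "(\<lambda>q\<in>basic_open H. 1) \<in> reduced_subscheme X (basic_open H)"
      using regular_const[OF openin_basic_open[OF H(1)]] by (simp add: reduced_subscheme_def)
    then show False using no_one[OF H(1)] H(2) by blast
  qed
  moreover have "eval_poly x (Q i) = 0" if "i \<in> I" "x \<in> p" for i x
  proof (rule ccontr)
    assume "eval_poly x (Q i) \<noteq> 0"
    then have pQ: "p \<in> basic_open (Q i)" using in_basic_open_iff[OF Q pP] that by blast
    have U: "openin zariski (basic_open (Q i))" using openin_basic_open[OF Q] that by blast
    have "is_quotient_on (basic_open (Q i)) (\<lambda>q\<in>basic_open (Q i). 1) (Q i * 1) (Q i)"
      unfolding is_quotient_on_def using Q[OF that(1)] by (auto simp: basic_open_def)
    then have "(\<lambda>q\<in>basic_open (Q i). 1) \<in> hypersurface (Q i) (basic_open (Q i))"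
      using regular_const[OF U, of 1] U unfolding hypersurface_def by blast
    then show False using no_one[OF Q] that(1) pQ by blast
  qed
  ultimately show "p \<in> {p \<in> X. \<forall>i\<in>I. \<forall>x\<in>p. eval_poly x (Q i) = 0}" by blast
next
  fix p assume "p \<in> {p \<in> X. \<forall>i\<in>I. \<forall>x\<in>p. eval_poly x (Q i) = 0}"
  then have pX: "p \<in> X" and pQ: "\<And>i x. i \<in> I \<Longrightarrow> x \<in> p \<Longrightarrow> eval_poly x (Q i) = 0" by blast+
  have pP: "p \<in> proj_space" using pX closedin_zariski_subset[OF X] by blast
  obtain x where x: "x \<in> p" using proj_space_nonempty[OF pP] by blast
  have "s p = 0" if U: "openin zariski U" "p \<in> U" and s: "s \<in> inter_with X Q I U" for U s
  proof -
    obtain V where V: "p \<in> V" "restrict s V \<in> combinations_at X Q d I V p"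
      using inter_with_local[OF U(2) s I Q] by blast
    obtain D H A where H: "p \<in> basic_open H" and
      *: "\<And>q x. q \<in> X \<Longrightarrow> q \<in> V \<Longrightarrow> q \<in> basic_open H \<Longrightarrow> x \<in> q \<Longrightarrow>
        eval_poly x H * restrict s V q = (\<Sum>i\<in>I. eval_poly x (Q i) * eval_poly x (A i))"
      using V(2) by (rule combinations_atE) blast
    have "eval_poly x H * s p = 0" using *[OF pX V(1) H x] V(1) pQ[OF _ x] by simp
    then show ?thesis using H x by (auto simp: basic_open_def)
  qed
  then show "p \<in> points (inter_with X Q I)" using pP by (auto simp: points_def)
qed

lemma closedin_points_inter_with:
  assumes X: "closedin zariski X" and I: "finite I"
    and Q: "\<And>i. i \<in> I \<Longrightarrow> homogeneous (d i) (Q i)"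
  shows "closedin zariski (points (inter_with X Q I))"
proof -
  have "points (inter_with X Q I) = \<Inter>(insert X ((\<lambda>i. {p \<in> proj_space. \<forall>x\<in>p. eval_poly x (Q i) = 0}) ` I))"
    using points_inter_with[of X I d Q, OF X I] Q closedin_zariski_subset[OF X] by auto
  also have "closedin zariski \<dots>"
    by (rule closedin_Inter) (use X closedin_zero_set[OF Q] in auto)
  finally show ?thesis .
qed

lemma zero_in_points_hypersurface:
  assumes "p \<in> proj_space" "\<And>x. x \<in> p \<Longrightarrow> eval_poly x Q = 0"
  shows "p \<in> points (hypersurface Q)"
proof -
  obtain x where x: "x \<in> p" using proj_space_nonempty[OF assms(1)] by blast
  have "s p = 0" if U: "p \<in> U" and s: "s \<in> hypersurface Q U" for U s
  proof -
    have "\<exists>V A B. openin zariski V \<and> p \<in> V \<and> V \<subseteq> U \<and> is_quotient_on V s (Q * A) B"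
      using s U unfolding hypersurface_def by simp
    then obtain V A B where "p \<in> V" "is_quotient_on V s (Q * A) B" by blast
    then show ?thesis using x assms(2)[OF x] by (auto simp: is_quotient_on_def ev.subst_poly_mult)
  qed
  then show ?thesis using assms(1) by (auto simp: points_def)
qed

text \<open>The choice of homogeneous coordinates does not matter as soon as both forms have the same
  degree.\<close>

definition form_quotient :: "('n::finite, 'k::field) mpoly \<Rightarrow> ('n, 'k) mpoly \<Rightarrow> ('n, 'k) ppoint \<Rightarrow> 'k" where
  "form_quotient A B = (\<lambda>p\<in>basic_open B. eval_poly (SOME x. x \<in> p) A / eval_poly (SOME x. x \<in> p) B)"

lemma form_quotient_eq:
  assumes "homogeneous e A" "homogeneous e B" "p \<in> basic_open B" "x \<in> p"
  shows "form_quotient A B p = eval_poly x A / eval_poly x B"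
proof -
  define y where "y = (SOME x. x \<in> p)"
  have "y \<in> p" unfolding y_def using assms(4) by (auto simp: some_in_eq)
  moreover have "p \<in> proj_space" using assms(3) basic_open_subset by blast
  ultimately obtain c where "c \<noteq> 0" "y = (\<lambda>j. c * x j)" using proj_space_multiple assms(4) by blast
  then show ?thesis
    using assms(3) eval_poly_scale[OF assms(1), of c x] eval_poly_scale[OF assms(2), of c x]
    by (simp add: form_quotient_def y_def[symmetric])
qed

lemma form_quotient_regular:
  assumes "homogeneous e A" "homogeneous e B"
  shows "form_quotient A B \<in> regular_functions (basic_open B)"
proof -
  have "is_quotient_on (basic_open B) (form_quotient A B) A B"
    unfolding is_quotient_on_def using form_quotient_eq[OF assms] assms by (auto simp: basic_open_def)
  then show ?thesis
    using openin_basic_open[OF assms(2)] unfolding regular_functions_def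
    by (auto simp: form_quotient_def)
qed

lemma power_in_ideal_pow:
  assumes U: "openin zariski U" and s: "s \<in> regular_functions U" "s \<in> J"
  shows "(\<lambda>p\<in>U. s p ^ M) \<in> ideal_pow (regular_ring U) J M \<and> (\<lambda>p\<in>U. s p ^ M) \<in> regular_functions U"
proof (induction M)
  case 0
  then show ?case using regular_const[OF U, of 1] by (simp add: regular_ring_def del: restrict_apply)
next
  case (Suc M)
  have eq: "(\<lambda>p\<in>U. s p * (\<lambda>p\<in>U. s p ^ M) p) = (\<lambda>p\<in>U. s p ^ Suc M)" by (rule restrict_ext) simp
  have "s \<otimes>\<^bsub>regular_ring U\<^esub> (\<lambda>p\<in>U. s p ^ M) \<in> ideal_pow (regular_ring U) J (Suc M)"
    unfolding ideal_pow.simps using s(2) conjunct1[OF Suc] by (rule ideal_prod.prod)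
  moreover have "s \<otimes>\<^bsub>regular_ring U\<^esub> (\<lambda>p\<in>U. s p ^ M) = (\<lambda>p\<in>U. s p ^ Suc M)"
    unfolding regular_ring_def by (simp only: monoid.simps eq)
  ultimately show ?case using regular_mult[OF s(1) conjunct2[OF Suc]] eq by (simp only:)
qed

text \<open>The inclusion of subschemes, read off at a point.  Dividing \<open>F\<close> by a power of a variable that is
  nonzero at \<open>p\<close> gives a section of the ideal of the support; its \<open>M\<close>-th power lies in the ideal of
  the intersection, and clearing the denominators gives the representation near \<open>p\<close>.  It is made
  valid on all of \<open>X\<close> by multiplying with forms that vanish outside the neighbourhood.\<close>

lemma power_locally_combination:
  assumes X: "closedin zariski X" and I: "finite I"
    and Q: "\<And>i. i \<in> I \<Longrightarrow> homogeneous (d i) (Q i)"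
    and le: "subscheme_le (inter_with X Q I) (subscheme_mult M (Supp (inter_with X Q I)))"
    and F: "homogeneous k F" "\<And>q x. q \<in> points (inter_with X Q I) \<Longrightarrow> x \<in> q \<Longrightarrow> eval_poly x F = 0"
    and p: "p \<in> proj_space"
  shows "locally_combination X Q d I p (M * k) (F ^ M)"
proof -
  obtain y j where y: "y \<in> p" "y j \<noteq> 0" using p proj_space_nonempty proj_space_nonzero by blast
  define B where "B = (Var j ^ k :: ('a, 'b) mpoly)"
  have B: "homogeneous k B" unfolding B_def by (rule homogeneous_Var_power)
  define U where "U = basic_open B"
  have U: "openin zariski U" unfolding U_def using B by (rule openin_basic_open)
  have pU: "p \<in> U"
    unfolding U_def using in_basic_open_iff[OF B p y(1)] y(2) by (simp add: B_def ev.subst_poly_power)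
  define s where "s = form_quotient F B"
  have sreg: "s \<in> regular_functions U" unfolding s_def U_def using F(1) B by (rule form_quotient_regular)
  have "s q = 0" if q: "q \<in> U \<inter> points (inter_with X Q I)" for q
  proof -
    obtain x where "x \<in> q" using q proj_space_nonempty openin_zariski_subset[OF U] by blast
    then show ?thesis using form_quotient_eq[OF F(1) B, of q x] F(2)[of q x] q by (simp add: s_def U_def)
  qed
  then have "s \<in> Supp (inter_with X Q I) U" using sreg by (simp add: Supp_def reduced_subscheme_def)
  then have "(\<lambda>q\<in>U. s q ^ M) \<in> subscheme_mult M (Supp (inter_with X Q I)) U"
    using power_in_ideal_pow[OF U sreg, of "Supp (inter_with X Q I) U" M] U
    unfolding subscheme_mult_def sheafify_def by (auto intro!: exI[of _ U] simp del: restrict_apply)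
  then have sM: "(\<lambda>q\<in>U. s q ^ M) \<in> inter_with X Q I U" using le U unfolding subscheme_le_def by blast
  obtain V where V: "openin zariski V" "p \<in> V" "V \<subseteq> U"
    "restrict (\<lambda>q\<in>U. s q ^ M) V \<in> combinations_at X Q d I V p"
    using inter_with_local[OF pU sM I Q] by blast
  obtain D H A where H: "homogeneous D H" "p \<in> basic_open H" "cofactors I d D A"
    and comb: "\<And>q x. q \<in> X \<Longrightarrow> q \<in> V \<Longrightarrow> q \<in> basic_open H \<Longrightarrow> x \<in> q \<Longrightarrow>
      eval_poly x H * restrict (\<lambda>q\<in>U. s q ^ M) V q = (\<Sum>i\<in>I. eval_poly x (Q i) * eval_poly x (A i))"
    using V(4) by (rule combinations_atE) blast
  obtain g G where G: "homogeneous g G" "p \<in> basic_open G" "basic_open G \<subseteq> V"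
    using zariski_neighbourhood[OF V(1,2)] by blast
  define S where "S = H * G * B ^ M"
  have "cofactors I d ((D + g + M * k) + D) (\<lambda>i. S * A i)"
    unfolding S_def by (intro cofactors_mult H homogeneous_mult G homogeneous_power B)
  then have cof: "cofactors I d ((D + g + D) + M * k) (\<lambda>i. S * A i)" by (simp add: add_ac)
  have "eval_poly x ((H * G * H) * F ^ M) = (\<Sum>i\<in>I. eval_poly x (Q i * (S * A i)))" if q: "q \<in> X" "x \<in> q" for q x
  proof (cases "q \<in> basic_open H \<and> q \<in> basic_open G")
    case True
    then have qV: "q \<in> V" "q \<in> U" using G(3) V(3) by blast+
    have "eval_poly x B \<noteq> 0" using qV(2) q(2) by (auto simp: U_def basic_open_def)
    moreover have "s q = eval_poly x F / eval_poly x B"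
      unfolding s_def using form_quotient_eq[OF F(1) B] qV(2) q(2) by (simp add: U_def)
    ultimately have F_eq: "eval_poly x F ^ M = s q ^ M * eval_poly x B ^ M" by (simp add: power_divide)
    have "eval_poly x H * s q ^ M = (\<Sum>i\<in>I. eval_poly x (Q i) * eval_poly x (A i))"
      using comb[OF q(1) qV(1) _ q(2)] True qV by simp
    then have "eval_poly x ((H * G * H) * F ^ M) =
        eval_poly x S * (\<Sum>i\<in>I. eval_poly x (Q i) * eval_poly x (A i))"
      by (simp add: ev.subst_poly_mult ev.subst_poly_power S_def F_eq mult_ac)
    then show ?thesis by (simp add: ev.subst_poly_mult sum_distrib_left mult_ac)
  next
    case False
    have "q \<in> proj_space" using q(1) closedin_zariski_subset[OF X] by blast
    then have "eval_poly x H = 0 \<or> eval_poly x G = 0"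
      using False in_basic_open_iff[OF H(1) _ q(2)] in_basic_open_iff[OF G(1) _ q(2)] by blast
    then have "eval_poly x S = 0" "eval_poly x ((H * G * H) * F ^ M) = 0"
      by (auto simp: S_def ev.subst_poly_mult)
    moreover have "eval_poly x (Q i * (S * A i)) = eval_poly x (Q i) * (eval_poly x S * eval_poly x (A i))" for i
      by (simp add: ev.subst_poly_mult)
    ultimately show ?thesis by simp
  qed
  moreover have "homogeneous (D + g + D) (H * G * H)" by (intro homogeneous_mult H G)
  moreover have "p \<in> basic_open (H * G * H)" using H(2) G(2) by (simp add: basic_open_mult)
  ultimately show ?thesis using cof by blast
qed

text \<open>The forms \<open>H\<close> for which \<open>H * P\<close> is a combination are a homogeneous ideal.  The local
  representations say that it has no zero, so it contains a power of each variable.\<close>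

lemma combination_local_to_global:
  fixes X :: "('n::finite, 'k::alg_closed_field) ppoint set"
  assumes local: "\<And>p. p \<in> proj_space \<Longrightarrow> locally_combination X Q d I p k P"
  shows "\<exists>e. \<forall>j. combination X Q d I (e + k) (Var j ^ e * P)"
proof -
  define S where "S = {(D, H). homogeneous D H \<and> combination X Q d I (D + k) (H * P)}"
  have SI: "(D, H) \<in> S" if "homogeneous D H" "cofactors I d (D + k) A"
    "\<And>q x. q \<in> X \<Longrightarrow> x \<in> q \<Longrightarrow> eval_poly x (H * P) = (\<Sum>i\<in>I. eval_poly x (Q i * A i))" for D H A
    using that unfolding S_def by blast
  have SD: "homogeneous D H \<and> combination X Q d I (D + k) (H * P)" if "(D, H) \<in> S" for D H
    using that by (simp add: S_def)
  have "graded_ideal S"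
    unfolding graded_ideal_def
  proof (intro conjI allI impI)
    fix D H assume "(D, H) \<in> S" then show "homogeneous D H" by (simp add: S_def)
  next
    fix D show "(D, 0) \<in> S" by (rule SI[OF _ cofactors_zero]) auto
  next
    fix D G H assume "(D, G) \<in> S" "(D, H) \<in> S"
    obtain A where A: "homogeneous D G" "cofactors I d (D + k) A"
      "\<forall>q\<in>X. \<forall>x\<in>q. eval_poly x (G * P) = (\<Sum>i\<in>I. eval_poly x (Q i * A i))"
      using SD[OF \<open>(D, G) \<in> S\<close>] by blast
    obtain B where B: "homogeneous D H" "cofactors I d (D + k) B"
      "\<forall>q\<in>X. \<forall>x\<in>q. eval_poly x (H * P) = (\<Sum>i\<in>I. eval_poly x (Q i * B i))"
      using SD[OF \<open>(D, H) \<in> S\<close>] by blast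
    show "(D, G + H) \<in> S"
    proof (rule SI[OF homogeneous_add[OF A(1) B(1)] cofactors_add[OF A(2) B(2)]])
      fix q x assume "q \<in> X" "x \<in> q"
      then show "eval_poly x ((G + H) * P) = (\<Sum>i\<in>I. eval_poly x (Q i * (A i + B i)))"
        using A(3) B(3) by (simp add: distrib_left distrib_right ev.subst_poly_add sum.distrib)
    qed
  next
    fix D e H and G :: "('n, 'k) mpoly" assume "(D, H) \<in> S" and G: "homogeneous e G"
    obtain A where *: "homogeneous D H" "cofactors I d (D + k) A"
      "\<forall>q\<in>X. \<forall>x\<in>q. eval_poly x (H * P) = (\<Sum>i\<in>I. eval_poly x (Q i * A i))"
      using SD[OF \<open>(D, H) \<in> S\<close>] by blast
    have cof: "cofactors I d (e + D + k) (\<lambda>i. G * A i)" using cofactors_mult[OF *(2) G] by (simp add: add_ac)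
    show "(e + D, G * H) \<in> S"
    proof (rule SI[OF homogeneous_mult[OF G *(1)] cof])
      fix q x assume "q \<in> X" "x \<in> q"
      then have "eval_poly x (G * (H * P)) = eval_poly x G * (\<Sum>i\<in>I. eval_poly x (Q i * A i))"
        using *(3) by (simp add: ev.subst_poly_mult[of x G])
      then show "eval_poly x (G * H * P) = (\<Sum>i\<in>I. eval_poly x (Q i * (G * A i)))"
        by (simp add: ev.subst_poly_mult sum_distrib_left mult_ac)
    qed
  qed
  moreover have "\<exists>D H. (D, H) \<in> S \<and> eval_poly x H \<noteq> 0" if x: "\<exists>j. x j \<noteq> 0" for x
  proof -
    have "proj_point x \<in> proj_space" using x by (auto intro: proj_point_in_space)
    from local[OF this] show ?thesis
    proof (elim exE conjE)
      fix D H A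
      assume *: "homogeneous D H" "proj_point x \<in> basic_open H" "cofactors I d (D + k) A"
        "\<forall>q\<in>X. \<forall>x\<in>q. eval_poly x (H * P) = (\<Sum>i\<in>I. eval_poly x (Q i * A i))"
      have "eval_poly x H \<noteq> 0"
        using *(2) self_in_proj_point[of x] by (simp add: basic_open_def)
      moreover have "(D, H) \<in> S" using SI[OF *(1,3)] *(4) by simp
      ultimately show ?thesis by (intro exI[of _ D] exI[of _ H] conjI)
    qed
  qed
  ultimately obtain e where e: "full_degree S e" using projective_Nullstellensatz by blast
  have "combination X Q d I (e + k) (Var j ^ e * P)" for j
  proof -
    have "(e, Var j ^ e) \<in> S" using e homogeneous_Var_power unfolding full_degree_def by blast
    then show ?thesis by (rule SD[THEN conjunct2])
  qed
  then show ?thesis by blast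
qed

text \<open>At a point of \<open>X\<close> take for \<open>H\<close> one of the \<open>Q i\<close>; outside \<open>X\<close>, take a form that vanishes on \<open>X\<close>.\<close>

lemma empty_intersection_locally_combination:
  fixes X :: "('n::finite, 'k::field) ppoint set"
  assumes X: "closedin zariski X" and I: "finite I"
    and Q: "\<And>i. i \<in> I \<Longrightarrow> homogeneous (d i) (Q i)"
    and empty: "points (inter_with X Q I) = {}" and p: "p \<in> proj_space"
  shows "locally_combination X Q d I p 0 1"
proof (cases "p \<in> X")
  case True
  then obtain i x where i: "i \<in> I" "x \<in> p" "eval_poly x (Q i) \<noteq> 0"
    using empty points_inter_with[of X I d Q, OF X I] Q by blast
  define A where "A j = (if j = i then 1 else 0 :: ('n, 'k) mpoly)" for j
  have "p \<in> basic_open (Q i)" using in_basic_open_iff[OF Q p] i by blast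
  moreover have "cofactors I d (d i + 0) A"
    using cofactors_single[of 0 d i "d i" 1 I] homogeneous_one by (simp add: A_def[abs_def])
  moreover have "eval_poly x (Q i * 1) = (\<Sum>j\<in>I. eval_poly x (Q j * A j))" for x
  proof -
    have "(\<Sum>j\<in>I. eval_poly x (Q j * A j)) = (\<Sum>j\<in>I. if j = i then eval_poly x (Q i) else 0)"
      by (intro sum.cong) (auto simp: A_def)
    then show ?thesis using I i(1) by simp
  qed
  ultimately show ?thesis using Q[OF i(1)] by blast
next
  case False
  then obtain D H where H: "homogeneous D H" "p \<in> basic_open H" "\<forall>q\<in>X. \<forall>x\<in>q. eval_poly x H = 0"
    using closedin_zariski_separate[OF X p] by blast
  then show ?thesis by (intro exI[of _ D] exI[of _ H] exI[of _ "\<lambda>_. 0"]) (auto simp: cofactors_zero)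
qed

section \<open>Gauss norms\<close>

locale nonarch =
  fixes v :: "'k::field \<Rightarrow> real"
  assumes absval: "nonarch_absval v"
begin

lemma v_nonneg [simp]: "0 \<le> v x"
  and v_eq_0 [simp]: "v x = 0 \<longleftrightarrow> x = 0"
  and v_mult: "v (x * y) = v x * v y"
  and v_add_le: "v (x + y) \<le> max (v x) (v y)"
  using absval by (auto simp: nonarch_absval_def)

lemma v_0 [simp]: "v 0 = 0" by simp

lemma v_pos: "x \<noteq> 0 \<Longrightarrow> 0 < v x"
  using v_nonneg[of x] v_eq_0[of x] by linarith

lemma v_1 [simp]: "v 1 = 1"
  using v_mult[of 1 1] v_eq_0[of 1] by simp

lemma v_power: "v (x ^ k) = v x ^ k"
  by (induction k) (auto simp: v_mult)

lemma v_uminus [simp]: "v (- x) = v x"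
proof -
  have "v (-1) * v (-1) = 1" using v_mult[of "-1" "-1"] by simp
  then have "v (-1) = 1" using v_nonneg[of "-1"] by (metis abs_of_nonneg abs_square_eq_1 power2_eq_square)
  then show ?thesis using v_mult[of "-1" x] by simp
qed

lemma v_diff_le: "v (x - y) \<le> max (v x) (v y)"
  using v_add_le[of x "- y"] by simp

lemma v_add_eq:
  assumes "v y < v x"
  shows "v (x + y) = v x"
  using assms v_add_le[of x y] v_diff_le[of "x + y" y] by (simp add: max_def split: if_splits)

lemma v_sum_le:
  assumes "0 \<le> B" "\<And>i. i \<in> S \<Longrightarrow> v (a i) \<le> B"
  shows "v (\<Sum>i\<in>S. a i) \<le> B"
  using assms(2)
proof (induction S rule: infinite_finite_induct)
  case (insert i S)
  then have "max (v (a i)) (v (\<Sum>i\<in>S. a i)) \<le> B" by simp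
  then show ?case using insert.hyps v_add_le[of "a i" "\<Sum>i\<in>S. a i"] by (simp del: max.bounded_iff)
qed (use assms(1) in auto)

lemma v_sum_less:
  assumes "0 < B" "\<And>i. i \<in> S \<Longrightarrow> v (a i) < B"
  shows "v (\<Sum>i\<in>S. a i) < B"
  using assms(2)
proof (induction S rule: infinite_finite_induct)
  case (insert i S)
  then have "max (v (a i)) (v (\<Sum>i\<in>S. a i)) < B" by simp
  then show ?case using insert.hyps v_add_le[of "a i" "\<Sum>i\<in>S. a i"] by (simp del: max_less_iff_conj)
qed (use assms(1) in auto)

text \<open>The terms of the series tend to zero at radius \<open>r\<close>, where \<open>r\<close> is any real number and not only an
  absolute value of an element of the field.\<close>

definition decays :: "real \<Rightarrow> 'k fps \<Rightarrow> bool" where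
  "decays r g \<longleftrightarrow> (\<forall>e>0. \<exists>N. \<forall>i\<ge>N. v (fps_nth g i) * r ^ i < e)"

lemma decaysD: "decays r g \<Longrightarrow> e > 0 \<Longrightarrow> \<exists>N. \<forall>i\<ge>N. v (fps_nth g i) * r ^ i < e"
  by (simp add: decays_def)

lemma decays_bounded:
  assumes "decays r g"
  shows "\<exists>B>0. \<forall>i. v (fps_nth g i) * r ^ i \<le> B"
proof -
  obtain N where N: "\<And>i. i \<ge> N \<Longrightarrow> v (fps_nth g i) * r ^ i < 1" using decaysD[OF assms, of 1] by auto
  define B where "B = Max (insert 1 ((\<lambda>i. v (fps_nth g i) * r ^ i) ` {..<N}))"
  have "v (fps_nth g i) * r ^ i \<le> B" for i
  proof (cases "i < N")
    case True
    then show ?thesis unfolding B_def by (intro Max_ge) auto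
  next
    case False
    then have "v (fps_nth g i) * r ^ i \<le> 1" using N[of i] by simp
    also have "1 \<le> B" unfolding B_def by (intro Max_ge) auto
    finally show ?thesis .
  qed
  moreover have "1 \<le> B" unfolding B_def by (intro Max_ge) auto
  ultimately show ?thesis by (intro exI[of _ B]) auto
qed

lemma gauss_norm_ge:
  assumes "decays r g"
  shows "v (fps_nth g i) * r ^ i \<le> gauss_norm v r g"
  unfolding gauss_norm_def using decays_bounded[OF assms]
  by (intro cSUP_upper) (auto simp: bdd_above_def)

lemma gauss_norm_le: "(\<And>i. v (fps_nth g i) * r ^ i \<le> B) \<Longrightarrow> gauss_norm v r g \<le> B"
  unfolding gauss_norm_def by (intro cSUP_least) auto

lemma gauss_norm_nonneg: "decays r g \<Longrightarrow> 0 \<le> gauss_norm v r g"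
  using gauss_norm_ge[of r g 0] order_trans[OF v_nonneg] by fastforce

lemma gauss_norm_zero [simp]: "gauss_norm v r 0 = 0"
  unfolding gauss_norm_def by simp

lemma gauss_norm_pos:
  assumes "decays r g" "g \<noteq> 0" "r > 0"
  shows "0 < gauss_norm v r g"
proof -
  obtain i where "fps_nth g i \<noteq> 0" using assms(2) by (auto simp: fps_eq_iff)
  then have "0 < v (fps_nth g i) * r ^ i" using assms(3) v_pos by simp
  then show ?thesis using gauss_norm_ge[OF assms(1), of i] by linarith
qed

lemma gauss_norm_attained:
  assumes "decays r g" "g \<noteq> 0" "r > 0"
  shows "\<exists>i. v (fps_nth g i) * r ^ i = gauss_norm v r g \<and>
    (\<forall>j<i. v (fps_nth g j) * r ^ j < gauss_norm v r g)"
proof -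
  let ?G = "gauss_norm v r g" and ?t = "\<lambda>i. v (fps_nth g i) * r ^ i"
  have pos: "0 < ?G" using assms by (rule gauss_norm_pos)
  have "\<exists>i. ?t i = ?G"
  proof (rule ccontr)
    assume "\<nexists>i. ?t i = ?G"
    then have less: "?t i < ?G" for i using gauss_norm_ge[OF assms(1), of i] by (metis less_le)
    obtain N where N: "\<And>i. i \<ge> N \<Longrightarrow> ?t i < ?G / 2" using decaysD[OF assms(1), of "?G / 2"] pos by auto
    define B where "B = Max (insert (?G / 2) (?t ` {..<N}))"
    have "?t i \<le> B" for i
    proof (cases "i < N")
      case True
      then show ?thesis unfolding B_def by (intro Max_ge) auto
    next
      case False
      then have "?t i \<le> ?G / 2" using N[of i] by simp
      also have "?G / 2 \<le> B" unfolding B_def by (intro Max_ge) auto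
      finally show ?thesis .
    qed
    then have "?G \<le> B" by (rule gauss_norm_le)
    moreover have "B < ?G" unfolding B_def using less pos by (subst Max_less_iff) auto
    ultimately show False by simp
  qed
  then obtain i where i: "?t i = ?G" "\<And>j. j < i \<Longrightarrow> ?t j \<noteq> ?G"
    using exists_least_iff[of "\<lambda>i. ?t i = ?G"] by auto
  then show ?thesis using gauss_norm_ge[OF assms(1)] by (metis less_le)
qed

lemma gauss_norm_const [simp]: "gauss_norm v r (fps_const c) = v c"
proof (rule antisym)
  show "gauss_norm v r (fps_const c) \<le> v c" by (rule gauss_norm_le) simp
  have "v c = v (fps_nth (fps_const c) 0) * r ^ 0" by simp
  also have "\<dots> \<le> gauss_norm v r (fps_const c)"
    unfolding gauss_norm_def by (rule cSUP_upper) (auto intro!: bdd_aboveI2[where M = "v c"])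
  finally show "v c \<le> gauss_norm v r (fps_const c)" .
qed

lemma decays_const: "decays r (fps_const c)"
  unfolding decays_def by (intro allI impI exI[of _ 1]) auto

lemma decays_add:
  assumes "r \<ge> 0" "decays r g" "decays r h"
  shows "decays r (g + h)"
  unfolding decays_def
proof (intro allI impI)
  fix e :: real assume "e > 0"
  obtain N N' where N: "\<And>i. i \<ge> N \<Longrightarrow> v (fps_nth g i) * r ^ i < e" "\<And>i. i \<ge> N' \<Longrightarrow> v (fps_nth h i) * r ^ i < e"
    using decaysD[OF assms(2) \<open>e > 0\<close>] decaysD[OF assms(3) \<open>e > 0\<close>] by auto
  have "v (fps_nth (g + h) i) * r ^ i < e" if "i \<ge> max N N'" for i
  proof -
    have "v (fps_nth (g + h) i) * r ^ i \<le> max (v (fps_nth g i)) (v (fps_nth h i)) * r ^ i"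
      using assms(1) v_add_le by (intro mult_right_mono) auto
    then show ?thesis using N(1)[of i] N(2)[of i] that by (auto simp: max_def split: if_splits)
  qed
  then show "\<exists>N. \<forall>i\<ge>N. v (fps_nth (g + h) i) * r ^ i < e" by blast
qed

lemma coeff_mult_le:
  assumes "r \<ge> 0" "0 \<le> B"
    and "\<And>i. i \<le> n \<Longrightarrow> (v (fps_nth g i) * r ^ i) * (v (fps_nth h (n - i)) * r ^ (n - i)) \<le> B"
  shows "v (fps_nth (g * h) n) * r ^ n \<le> B"
proof -
  have v_scale: "v (fps_nth g i * fps_nth h (n - i)) * r ^ n =
      (v (fps_nth g i) * r ^ i) * (v (fps_nth h (n - i)) * r ^ (n - i))" if "i \<le> n" for i
  proof -
    have "r ^ n = r ^ i * r ^ (n - i)" using that by (simp flip: power_add)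
    then show ?thesis by (simp add: v_mult mult_ac)
  qed
  show ?thesis
  proof (cases "r = 0")
    case True
    then show ?thesis using assms(2) assms(3)[of 0] by (cases n) (auto simp: v_mult)
  next
    case False
    then have "r ^ n > 0" using assms(1) by simp
    then have "v (fps_nth g i * fps_nth h (n - i)) \<le> B / r ^ n" if "i \<le> n" for i
      using assms(3)[OF that] v_scale[OF that] by (simp add: pos_le_divide_eq)
    then have "v (fps_nth (g * h) n) \<le> B / r ^ n"
      unfolding fps_mult_nth using assms \<open>r ^ n > 0\<close> by (intro v_sum_le) auto
    then show ?thesis using \<open>r ^ n > 0\<close> by (simp add: pos_le_divide_eq)
  qed
qed

lemma decays_mult:
  assumes r: "r \<ge> 0" and g: "decays r g" and h: "decays r h"
  shows "decays r (g * h)"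
  unfolding decays_def
proof (intro allI impI)
  fix e :: real assume "e > 0"
  obtain B where B: "B > 0" "\<And>i. v (fps_nth g i) * r ^ i \<le> B" using decays_bounded[OF g] by blast
  obtain C where C: "C > 0" "\<And>i. v (fps_nth h i) * r ^ i \<le> C" using decays_bounded[OF h] by blast
  obtain N where N: "\<And>i. i \<ge> N \<Longrightarrow> v (fps_nth g i) * r ^ i < e / 2 / C"
    using decaysD[OF g, of "e / 2 / C"] \<open>e > 0\<close> C(1) by auto
  obtain N' where N': "\<And>i. i \<ge> N' \<Longrightarrow> v (fps_nth h i) * r ^ i < e / 2 / B"
    using decaysD[OF h, of "e / 2 / B"] \<open>e > 0\<close> B(1) by auto
  have "v (fps_nth (g * h) n) * r ^ n \<le> e / 2" if n: "n \<ge> N + N'" for n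
  proof (rule coeff_mult_le[OF r])
    fix i assume "i \<le> n"
    let ?a = "v (fps_nth g i) * r ^ i" and ?b = "v (fps_nth h (n - i)) * r ^ (n - i)"
    have nn: "0 \<le> ?a" "0 \<le> ?b" using r by auto
    show "?a * ?b \<le> e / 2"
    proof (cases "i \<ge> N")
      case True
      then have "?a * ?b \<le> e / 2 / C * C"
        using N[OF True] C nn by (intro mult_mono) auto
      then show ?thesis using C(1) by simp
    next
      case False
      then have "n - i \<ge> N'" using n by simp
      then have "?a * ?b \<le> B * (e / 2 / B)"
        using N'[of "n - i"] B nn by (intro mult_mono) auto
      then show ?thesis using B(1) by simp
    qed
  qed (use \<open>e > 0\<close> in auto)
  then show "\<exists>N. \<forall>i\<ge>N. v (fps_nth (g * h) i) * r ^ i < e"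
    using \<open>e > 0\<close> by (intro exI[of _ "N + N'"]) fastforce
qed

lemma gauss_norm_add_le:
  assumes "r \<ge> 0" "decays r g" "decays r h"
  shows "gauss_norm v r (g + h) \<le> max (gauss_norm v r g) (gauss_norm v r h)"
proof (rule gauss_norm_le)
  fix i
  have "v (fps_nth (g + h) i) * r ^ i \<le> max (v (fps_nth g i)) (v (fps_nth h i)) * r ^ i"
    using assms(1) v_add_le by (intro mult_right_mono) auto
  also have "\<dots> \<le> max (gauss_norm v r g) (gauss_norm v r h)"
    using gauss_norm_ge[OF assms(2), of i] gauss_norm_ge[OF assms(3), of i]
    by (auto simp: max_def)
  finally show "v (fps_nth (g + h) i) * r ^ i \<le> max (gauss_norm v r g) (gauss_norm v r h)" .
qed

text \<open>Gauss's lemma: at the sum of the smallest indices at which the two norms are attained, one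
  term of the Cauchy product strictly dominates all the others.\<close>

lemma gauss_norm_mult:
  assumes r: "r > 0" and g: "decays r g" and h: "decays r h"
  shows "gauss_norm v r (g * h) = gauss_norm v r g * gauss_norm v r h"
proof (cases "g = 0 \<or> h = 0")
  case True
  then show ?thesis by auto
next
  case False
  let ?G = "gauss_norm v r g" and ?H = "gauss_norm v r h"
  have G: "0 < ?G" and H: "0 < ?H" using gauss_norm_pos g h r False by auto
  show ?thesis
  proof (rule antisym)
    show "gauss_norm v r (g * h) \<le> ?G * ?H"
    proof (rule gauss_norm_le)
      fix n show "v (fps_nth (g * h) n) * r ^ n \<le> ?G * ?H"
        using r G H gauss_norm_ge[OF g] gauss_norm_ge[OF h]
        by (intro coeff_mult_le) (auto intro!: mult_mono)
    qed
    obtain i0 where i0: "v (fps_nth g i0) * r ^ i0 = ?G" "\<And>j. j < i0 \<Longrightarrow> v (fps_nth g j) * r ^ j < ?G"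
      using gauss_norm_attained[OF g _ r] False by blast
    obtain j0 where j0: "v (fps_nth h j0) * r ^ j0 = ?H" "\<And>j. j < j0 \<Longrightarrow> v (fps_nth h j) * r ^ j < ?H"
      using gauss_norm_attained[OF h _ r] False by blast
    define n where "n = i0 + j0"
    define t where "t i = fps_nth g i * fps_nth h (n - i)" for i
    have rn: "0 < r ^ n" using r by simp
    have vt: "v (t i) * r ^ n = (v (fps_nth g i) * r ^ i) * (v (fps_nth h (n - i)) * r ^ (n - i))" if "i \<le> n" for i
    proof -
      have "r ^ n = r ^ i * r ^ (n - i)" using that by (simp flip: power_add)
      then show ?thesis by (simp add: t_def v_mult mult_ac)
    qed
    have main: "v (t i0) * r ^ n = ?G * ?H" using vt[of i0] i0 j0 by (simp add: n_def)
    have "v (t i) < ?G * ?H / r ^ n" if i: "i \<in> {..n} - {i0}" for i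
    proof -
      have "v (t i) * r ^ n < ?G * ?H"
      proof (cases "i < i0")
        case True
        have "(v (fps_nth g i) * r ^ i) * (v (fps_nth h (n - i)) * r ^ (n - i)) \<le> (v (fps_nth g i) * r ^ i) * ?H"
          using gauss_norm_ge[OF h] r by (intro mult_left_mono) auto
        also have "\<dots> < ?G * ?H" using i0(2)[OF True] H by (rule mult_strict_right_mono)
        finally show ?thesis using vt i by simp
      next
        case False
        have "n - i < j0" using i False by (auto simp: n_def)
        have "(v (fps_nth g i) * r ^ i) * (v (fps_nth h (n - i)) * r ^ (n - i)) \<le> ?G * (v (fps_nth h (n - i)) * r ^ (n - i))"
          using gauss_norm_ge[OF g] r by (intro mult_right_mono) auto
        also have "\<dots> < ?G * ?H" using j0(2)[OF \<open>n - i < j0\<close>] G by (rule mult_strict_left_mono)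
        finally show ?thesis using vt i by simp
      qed
      then show ?thesis using rn by (simp add: pos_less_divide_eq)
    qed
    then have "v (\<Sum>i\<in>{..n} - {i0}. t i) < ?G * ?H / r ^ n" using G H rn by (intro v_sum_less) auto
    moreover have "v (t i0) = ?G * ?H / r ^ n" unfolding main[symmetric] using r by simp
    ultimately have "v (t i0 + (\<Sum>i\<in>{..n} - {i0}. t i)) = ?G * ?H / r ^ n"
      using v_add_eq by metis
    moreover have "fps_nth (g * h) n = t i0 + (\<Sum>i\<in>{..n} - {i0}. t i)"
      unfolding fps_mult_nth t_def atLeast0AtMost by (rule sum.remove) (auto simp: n_def)
    ultimately have "v (fps_nth (g * h) n) * r ^ n = ?G * ?H" using r by simp
    then show "?G * ?H \<le> gauss_norm v r (g * h)"
      using gauss_norm_ge[OF decays_mult[OF _ g h], of n] r by simp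
  qed
qed

lemma decays_power: "r \<ge> 0 \<Longrightarrow> decays r g \<Longrightarrow> decays r (g ^ k)"
  by (induction k) (use decays_const[of r 1] in \<open>auto intro: decays_mult\<close>)

lemma gauss_norm_one [simp]: "gauss_norm v r 1 = 1"
  using gauss_norm_const[of r 1] by simp

lemma gauss_norm_power: "r > 0 \<Longrightarrow> decays r g \<Longrightarrow> gauss_norm v r (g ^ k) = gauss_norm v r g ^ k"
  by (induction k) (auto simp: gauss_norm_mult decays_power)

lemma decays_sum: "r \<ge> 0 \<Longrightarrow> (\<And>i. i \<in> I \<Longrightarrow> decays r (g i)) \<Longrightarrow> decays r (\<Sum>i\<in>I. g i)"
  by (induction I rule: infinite_finite_induct)
     (use decays_const[of r 0] in \<open>auto intro: decays_add\<close>)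

lemma decays_prod: "r \<ge> 0 \<Longrightarrow> (\<And>i. i \<in> I \<Longrightarrow> decays r (g i)) \<Longrightarrow> decays r (\<Prod>i\<in>I. g i)"
  by (induction I rule: infinite_finite_induct)
     (use decays_const[of r 1] in \<open>auto intro: decays_mult\<close>)

lemma gauss_norm_prod:
  "r > 0 \<Longrightarrow> (\<And>i. i \<in> I \<Longrightarrow> decays r (g i)) \<Longrightarrow>
    gauss_norm v r (\<Prod>i\<in>I. g i) = (\<Prod>i\<in>I. gauss_norm v r (g i))"
  by (induction I rule: infinite_finite_induct) (auto simp: gauss_norm_mult decays_prod)

lemma gauss_norm_sum_le:
  assumes "r \<ge> 0" "finite I" "I \<noteq> {}" "\<And>i. i \<in> I \<Longrightarrow> decays r (g i)"
  shows "\<exists>i\<in>I. gauss_norm v r (\<Sum>i\<in>I. g i) \<le> gauss_norm v r (g i)"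
  using assms(2-4)
proof (induction I rule: finite_ne_induct)
  case (insert i I)
  then obtain j where j: "j \<in> I" "gauss_norm v r (\<Sum>i\<in>I. g i) \<le> gauss_norm v r (g j)" by auto
  have "gauss_norm v r (\<Sum>i\<in>insert i I. g i) \<le> max (gauss_norm v r (g i)) (gauss_norm v r (\<Sum>i\<in>I. g i))"
    using insert assms(1) by (simp add: gauss_norm_add_le decays_sum)
  then show ?case using j by (fastforce simp: max_def split: if_splits)
qed simp

lemma gauss_norm_mono:
  assumes "0 \<le> r" "r \<le> s" "decays s g"
  shows "gauss_norm v r g \<le> gauss_norm v s g"
proof (rule gauss_norm_le)
  fix i
  have "v (fps_nth g i) * r ^ i \<le> v (fps_nth g i) * s ^ i"
    using assms by (intro mult_left_mono power_mono) auto
  then show "v (fps_nth g i) * r ^ i \<le> gauss_norm v s g" using gauss_norm_ge[OF assms(3), of i] by linarith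
qed

end

section \<open>Values of entire functions\<close>

context nonarch
begin

lemma fps_converges_to_iff:
  "fps_converges_to v g z l \<longleftrightarrow>
    (\<forall>e>0. \<exists>N. \<forall>m\<ge>N. v ((\<Sum>i<m. fps_nth g i * z ^ i) - l) < e)"
  unfolding fps_converges_to_def LIMSEQ_iff by simp

lemma fps_converges_toD:
  "fps_converges_to v g z l \<Longrightarrow> e > 0 \<Longrightarrow> \<exists>N. \<forall>m\<ge>N. v ((\<Sum>i<m. fps_nth g i * z ^ i) - l) < e"
  by (simp add: fps_converges_to_iff)

lemma converges_imp_decays:
  assumes "fps_converges_to v g z l"
  shows "decays (v z) g"
  unfolding decays_def
proof (intro allI impI)
  fix e :: real assume "e > 0"
  then obtain N where N: "\<And>m. m \<ge> N \<Longrightarrow> v ((\<Sum>i<m. fps_nth g i * z ^ i) - l) < e"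
    using fps_converges_toD[OF assms] by blast
  have "v (fps_nth g m) * v z ^ m < e" if "m \<ge> N" for m
  proof -
    let ?S = "\<lambda>m. \<Sum>i<m. fps_nth g i * z ^ i"
    have "fps_nth g m * z ^ m = (?S (Suc m) - l) - (?S m - l)" by simp
    then have "v (fps_nth g m * z ^ m) \<le> max (v (?S (Suc m) - l)) (v (?S m - l))"
      using v_diff_le by metis
    also have "\<dots> < e" using N[of m] N[of "Suc m"] that by simp
    finally show ?thesis by (simp add: v_mult v_power)
  qed
  then show "\<exists>N. \<forall>i\<ge>N. v (fps_nth g i) * v z ^ i < e" by blast
qed

lemma decays_mono:
  assumes "0 \<le> r" "r \<le> s" "decays s g"
  shows "decays r g"
  unfolding decays_def
proof (intro allI impI)
  fix e :: real assume "e > 0"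
  then obtain N where N: "\<And>i. i \<ge> N \<Longrightarrow> v (fps_nth g i) * s ^ i < e" using decaysD[OF assms(3)] by blast
  have "v (fps_nth g i) * r ^ i < e" if "i \<ge> N" for i
    using N[OF that] mult_left_mono[OF power_mono[OF assms(2,1)], of "v (fps_nth g i)" i] by simp
  then show "\<exists>N. \<forall>i\<ge>N. v (fps_nth g i) * r ^ i < e" by blast
qed

text \<open>An absolute value bounded by \<open>1\<close> is trivial, so terms that tend to zero are eventually zero.\<close>

lemma trivial_decays_imp_polynomial:
  assumes "\<And>x. v x \<le> 1" "decays 1 g"
  shows "\<exists>N. \<forall>i\<ge>N. fps_nth g i = 0"
proof -
  have v01: "v x = 1" if "x \<noteq> 0" for x
  proof -
    have "v x * v (inverse x) = 1" using that by (simp flip: v_mult)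
    moreover have "v x * v (inverse x) \<le> v x * 1" using assms(1)[of "inverse x"] by (intro mult_left_mono) auto
    ultimately show ?thesis using assms(1)[of x] by linarith
  qed
  obtain N where "\<And>i. i \<ge> N \<Longrightarrow> v (fps_nth g i) * 1 ^ i < 1" using decaysD[OF assms(2), of 1] by auto
  then show ?thesis using v01 by (metis less_irrefl mult.right_neutral power_one)
qed

text \<open>A nontrivial absolute value takes arbitrarily large values, and convergence at a large element
  implies decay at all smaller radii.\<close>

lemma entire_imp_decays:
  assumes g: "entire v g" and r: "0 \<le> r"
  shows "decays r g"
proof (cases "\<exists>x. v x > 1")
  case True
  then obtain x where x: "v x > 1" by blast
  then obtain k where "r < v x ^ k" using real_arch_pow by blast
  then have "r \<le> v (x ^ k)" by (simp add: v_power)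
  moreover have "decays (v (x ^ k)) g" using g converges_imp_decays unfolding entire_def by blast
  ultimately show ?thesis using decays_mono r by blast
next
  case False
  have "decays (v 1) g" using g converges_imp_decays unfolding entire_def by blast
  then obtain N where N: "\<And>i. i \<ge> N \<Longrightarrow> fps_nth g i = 0"
    using trivial_decays_imp_polynomial[of g] False by (auto simp: not_less)
  then show ?thesis unfolding decays_def by (intro allI impI exI[of _ N]) simp
qed

lemma fps_value_eq:
  assumes "fps_converges_to v g z l"
  shows "fps_value v g z = l"
  unfolding fps_value_def
proof (rule the_equality)
  show "fps_converges_to v g z l" by (rule assms)
  fix l' assume l': "fps_converges_to v g z l'"
  show "l' = l"
  proof (rule ccontr)
    assume "l' \<noteq> l"
    then have "v (l' - l) > 0" by (intro v_pos) simp
    then obtain N N' where N: "\<And>m. m \<ge> N \<Longrightarrow> v ((\<Sum>i<m. fps_nth g i * z ^ i) - l) < v (l' - l)"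
      "\<And>m. m \<ge> N' \<Longrightarrow> v ((\<Sum>i<m. fps_nth g i * z ^ i) - l') < v (l' - l)"
      using fps_converges_toD[OF assms] fps_converges_toD[OF l'] by meson
    let ?S = "\<Sum>i<max N N'. fps_nth g i * z ^ i"
    have "v ((?S - l) - (?S - l')) \<le> max (v (?S - l)) (v (?S - l'))" by (rule v_diff_le)
    also have "\<dots> < v (l' - l)" using N(1)[of "max N N'"] N(2)[of "max N N'"] by simp
    finally show False by simp
  qed
qed

lemma converges_const: "fps_converges_to v (fps_const c) z c"
  unfolding fps_converges_to_iff
proof (intro allI impI exI[of _ 1])
  fix e :: real and m :: nat assume "e > 0" "m \<ge> 1"
  have "(\<Sum>i<m. fps_nth (fps_const c) i * z ^ i) = (\<Sum>i<m. if i = 0 then c else 0)"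
    by (intro sum.cong) auto
  also have "\<dots> = c" using \<open>m \<ge> 1\<close> by simp
  finally show "v ((\<Sum>i<m. fps_nth (fps_const c) i * z ^ i) - c) < e" using \<open>e > 0\<close> by simp
qed

lemma converges_add:
  assumes "fps_converges_to v g z a" "fps_converges_to v h z b"
  shows "fps_converges_to v (g + h) z (a + b)"
  unfolding fps_converges_to_iff
proof (intro allI impI)
  fix e :: real assume "e > 0"
  then obtain N N' where N: "\<And>m. m \<ge> N \<Longrightarrow> v ((\<Sum>i<m. fps_nth g i * z ^ i) - a) < e"
    "\<And>m. m \<ge> N' \<Longrightarrow> v ((\<Sum>i<m. fps_nth h i * z ^ i) - b) < e"
    using fps_converges_toD[OF assms(1)] fps_converges_toD[OF assms(2)] by meson
  have "v ((\<Sum>i<m. fps_nth (g + h) i * z ^ i) - (a + b)) < e" if "m \<ge> max N N'" for m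
  proof -
    let ?S = "\<Sum>i<m. fps_nth g i * z ^ i" and ?T = "\<Sum>i<m. fps_nth h i * z ^ i"
    have "(\<Sum>i<m. fps_nth (g + h) i * z ^ i) - (a + b) = (?S - a) + (?T - b)"
      by (simp add: distrib_right sum.distrib)
    also have "v \<dots> \<le> max (v (?S - a)) (v (?T - b))" by (rule v_add_le)
    also have "\<dots> < e" using N that by simp
    finally show ?thesis .
  qed
  then show "\<exists>N. \<forall>m\<ge>N. v ((\<Sum>i<m. fps_nth (g + h) i * z ^ i) - (a + b)) < e" by blast
qed

text \<open>The product of the \<open>m\<close>-th partial sums and the \<open>m\<close>-th partial sum of the Cauchy product differ by
  the terms with \<open>i + j \<ge> m\<close>.  In each of them one of the two factors is small and the other bounded.\<close>

lemma converges_mult: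
  assumes g: "fps_converges_to v g z a" and h: "fps_converges_to v h z b"
  shows "fps_converges_to v (g * h) z (a * b)"
  unfolding fps_converges_to_iff
proof (intro allI impI)
  fix e :: real assume e: "e > 0"
  let ?S = "\<lambda>m. \<Sum>i<m. fps_nth g i * z ^ i" and ?T = "\<lambda>m. \<Sum>i<m. fps_nth h i * z ^ i"
  let ?g = "\<lambda>i. fps_nth g i * z ^ i" and ?h = "\<lambda>i. fps_nth h i * z ^ i"
  have dg: "decays (v z) g" and dh: "decays (v z) h" using g h converges_imp_decays by blast+
  obtain B where B: "B > 0" "\<And>i. v (?g i) \<le> B"
    using decays_bounded[OF dg] by (auto simp: v_mult v_power)
  obtain C where C: "C > 0" "\<And>i. v (?h i) \<le> C"
    using decays_bounded[OF dh] by (auto simp: v_mult v_power)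
  define M where "M = max 1 (max C (v a))"
  have M: "M > 0" "C \<le> M" "v a \<le> M" by (auto simp: M_def)
  define \<epsilon> where "\<epsilon> = e / 2 / max M B"
  have \<epsilon>: "\<epsilon> > 0" "\<epsilon> * M < e" "\<epsilon> * B < e"
  proof -
    have mx: "max M B > 0" using M by simp
    then show "\<epsilon> > 0" using e by (simp add: \<epsilon>_def)
    then have "\<epsilon> * M \<le> \<epsilon> * max M B" "\<epsilon> * B \<le> \<epsilon> * max M B" by (auto intro!: mult_left_mono)
    moreover have "\<epsilon> * max M B < e" using mx e by (simp add: \<epsilon>_def)
    ultimately show "\<epsilon> * M < e" "\<epsilon> * B < e" by linarith+
  qed
  obtain N1 where N1: "\<And>i. i \<ge> N1 \<Longrightarrow> v (?g i) < \<epsilon>"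
    using decaysD[OF dg \<epsilon>(1)] by (auto simp: v_mult v_power)
  obtain N2 where N2: "\<And>i. i \<ge> N2 \<Longrightarrow> v (?h i) < \<epsilon>"
    using decaysD[OF dh \<epsilon>(1)] by (auto simp: v_mult v_power)
  obtain N3 where N3: "\<And>m. m \<ge> N3 \<Longrightarrow> v (?S m - a) < \<epsilon>" using fps_converges_toD[OF g \<epsilon>(1)] by blast
  obtain N4 where N4: "\<And>m. m \<ge> N4 \<Longrightarrow> v (?T m - b) < \<epsilon>" using fps_converges_toD[OF h \<epsilon>(1)] by blast
  have "v ((\<Sum>i<m. fps_nth (g * h) i * z ^ i) - a * b) < e" if m: "m \<ge> N1 + N2 + N3 + N4" for m
  proof -
    define P where "P = {..<m} \<times> {..<m}"
    define P0 where "P0 = {(i, j). i + j < m}"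
    have sub: "P0 \<subseteq> P" "finite P" by (auto simp: P_def P0_def)
    have "(\<Sum>k<m. fps_nth (g * h) k * z ^ k) = (\<Sum>k<m. \<Sum>i\<le>k. ?g i * ?h (k - i))"
    proof (rule sum.cong[OF refl])
      fix k
      have eq: "?g i * ?h (k - i) = fps_nth g i * fps_nth h (k - i) * z ^ k" if "i \<le> k" for i
      proof -
        have "z ^ k = z ^ i * z ^ (k - i)" using that by (simp flip: power_add)
        then show ?thesis by (simp add: mult_ac)
      qed
      show "fps_nth (g * h) k * z ^ k = (\<Sum>i\<le>k. ?g i * ?h (k - i))"
        unfolding fps_mult_nth atLeast0AtMost sum_distrib_right by (rule sum.cong[OF refl]) (simp only: atMost_iff eq)
    qed
    also have "\<dots> = (\<Sum>(i, j)\<in>P0. ?g i * ?h j)"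
      unfolding P0_def by (rule sum.triangle_reindex[symmetric])
    finally have low: "(\<Sum>k<m. fps_nth (g * h) k * z ^ k) = (\<Sum>(i, j)\<in>P0. ?g i * ?h j)" .
    have "?S m * ?T m = (\<Sum>(i, j)\<in>P. ?g i * ?h j)"
      by (simp add: P_def sum_product sum.cartesian_product)
    also have "\<dots> = (\<Sum>(i, j)\<in>P0. ?g i * ?h j) + (\<Sum>(i, j)\<in>P - P0. ?g i * ?h j)"
      using sum.subset_diff[OF sub, of "\<lambda>(i, j). ?g i * ?h j"] by (simp add: add.commute)
    finally have split: "(\<Sum>k<m. fps_nth (g * h) k * z ^ k) = ?S m * ?T m - (\<Sum>(i, j)\<in>P - P0. ?g i * ?h j)"
      using low by simp
    have rest: "v (\<Sum>(i, j)\<in>P - P0. ?g i * ?h j) < e"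
    proof (rule v_sum_less[OF e])
      fix ij assume "ij \<in> P - P0"
      moreover obtain i j where ij: "ij = (i, j)" by (cases ij)
      ultimately have "\<not> i + j < m" by (simp add: P0_def)
      then consider "i \<ge> N1" | "j \<ge> N2" using m by linarith
      then have "v (?g i * ?h j) < e"
      proof cases
        case 1
        have "v (?g i) * v (?h j) \<le> \<epsilon> * M"
          using N1[OF 1] C(2)[of j] M \<epsilon>(1) by (intro mult_mono) auto
        then show ?thesis using \<epsilon>(2) by (subst v_mult) linarith
      next
        case 2
        have "v (?g i) * v (?h j) \<le> B * \<epsilon>"
          using N2[OF 2] B(1) B(2)[of i] by (intro mult_mono) auto
        then show ?thesis using \<epsilon>(3) by (subst v_mult) (simp add: mult.commute)
      qed
      then show "v (case ij of (i, j) \<Rightarrow> ?g i * ?h j) < e" by (simp add: ij)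
    qed
    have vT: "v (?T m) \<le> M" using M C(2) by (intro v_sum_le) (auto intro: order_trans)
    have t1: "v ((?S m - a) * ?T m) < e"
    proof -
      have "v (?S m - a) * v (?T m) \<le> \<epsilon> * M" using N3[of m] m vT \<epsilon>(1) by (intro mult_mono) auto
      then show ?thesis using \<epsilon>(2) by (subst v_mult) linarith
    qed
    have t2: "v (a * (?T m - b)) < e"
    proof -
      have "v a * v (?T m - b) \<le> M * \<epsilon>" using N4[of m] m M by (intro mult_mono) auto
      then show ?thesis using \<epsilon>(2) by (subst v_mult) (simp add: mult.commute)
    qed
    have "(\<Sum>i<m. fps_nth (g * h) i * z ^ i) - a * b =
        ((?S m - a) * ?T m + a * (?T m - b)) - (\<Sum>(i, j)\<in>P - P0. ?g i * ?h j)"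
      unfolding split by (simp add: left_diff_distrib right_diff_distrib)
    then show ?thesis
      using v_diff_le[of "(?S m - a) * ?T m + a * (?T m - b)" "\<Sum>(i, j)\<in>P - P0. ?g i * ?h j"]
        v_add_le[of "(?S m - a) * ?T m" "a * (?T m - b)"] t1 t2 rest by simp
  qed
  then show "\<exists>N. \<forall>m\<ge>N. v ((\<Sum>i<m. fps_nth (g * h) i * z ^ i) - a * b) < e" by blast
qed

end

locale nonarch_closed = nonarch v for v :: "'k::alg_closed_field \<Rightarrow> real"
begin

lemma ex_nonzero_value_polynomial:
  assumes "p \<noteq> (0 :: 'k poly)"
  shows "\<exists>z. poly p z \<noteq> 0"
proof (cases "degree p = 0")
  case True
  then obtain c where "p = [:c:]" by (rule degree_eq_zeroE)
  then show ?thesis using assms by auto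
next
  case False
  then have "degree (p + (- 1)) = degree p" by (intro degree_add_eq_left) simp
  then have "degree (p - 1) > 0" using False by simp
  then obtain z where "poly (p - 1) z = 0" using alg_closed_imp_poly_has_root by blast
  then show ?thesis by (intro exI[of _ z]) auto
qed

text \<open>For a trivial absolute value \<open>g\<close> is a polynomial.  Otherwise, at a point \<open>z\<close> close to \<open>0\<close> the
  lowest nonzero term of \<open>g\<close> strictly dominates all others.\<close>

lemma zero_values_imp_zero:
  assumes conv: "\<And>z. fps_converges_to v g z 0"
  shows "g = 0"
proof (rule ccontr)
  assume "g \<noteq> 0"
  show False
  proof (cases "\<forall>x. v x \<le> 1")
    case True
    have "decays (v 1) g" using converges_imp_decays[OF conv[of 1]] .
    then obtain N where N: "\<And>i. i \<ge> N \<Longrightarrow> fps_nth g i = 0"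
      using trivial_decays_imp_polynomial[of g] True by auto
    define p where "p = (\<Sum>i<N. monom (fps_nth g i) i)"
    have "coeff p i = fps_nth g i" for i using N[of i] by (auto simp: p_def coeff_sum)
    then have "p \<noteq> 0" using \<open>g \<noteq> 0\<close> by (auto simp: fps_eq_iff poly_eq_iff)
    then obtain z where z: "poly p z \<noteq> 0" using ex_nonzero_value_polynomial by blast
    have S: "(\<Sum>i<m. fps_nth g i * z ^ i) = poly p z" if "m \<ge> N" for m
    proof -
      have "(\<Sum>i<m. fps_nth g i * z ^ i) = (\<Sum>i<N. fps_nth g i * z ^ i)"
        using that N by (intro sum.mono_neutral_right) auto
      then show ?thesis by (simp add: p_def poly_sum poly_monom)
    qed
    obtain N' where "\<And>m. m \<ge> N' \<Longrightarrow> v ((\<Sum>i<m. fps_nth g i * z ^ i) - 0) < v (poly p z)"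
      using fps_converges_toD[OF conv v_pos[OF z]] by blast
    then show False using S[of "max N N'"] by (metis diff_zero less_irrefl max.cobounded1 max.cobounded2)
  next
    case False
    then obtain x where x: "v x > 1" by (auto simp: not_le)
    define y where "y = inverse x"
    have "x \<noteq> 0" using x by auto
    then have "v y * v x = 1" using v_mult[of y x] by (simp add: y_def)
    then have "v y = 1 / v x" using \<open>x \<noteq> 0\<close> by (simp add: eq_divide_eq)
    then have y: "0 < v y" "v y < 1" using x by auto
    have dec: "decays 1 g" using converges_imp_decays[OF conv[of 1]] by simp
    obtain k where k: "fps_nth g k \<noteq> 0" "\<And>i. i < k \<Longrightarrow> fps_nth g i = 0"
      using \<open>g \<noteq> 0\<close> exists_least_iff[of "\<lambda>i. fps_nth g i \<noteq> 0"] by (auto simp: fps_eq_iff)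
    define G where "G = gauss_norm v 1 g"
    have G: "v (fps_nth g i) \<le> G" for i using gauss_norm_ge[OF dec, of i] by (simp add: G_def)
    have Gpos: "G > 0" using G[of k] v_pos[OF k(1)] by linarith
    obtain n where n: "v y ^ n < v (fps_nth g k) / G"
      using real_arch_pow_inv[of "v (fps_nth g k) / G" "v y"] y Gpos v_pos[OF k(1)] by auto
    define z where "z = y ^ n"
    define \<rho> where "\<rho> = v z"
    have \<rho>: "0 < \<rho>" "\<rho> \<le> 1" "\<rho> * G < v (fps_nth g k)"
      using y n Gpos by (auto simp: \<rho>_def z_def v_power power_le_one pos_less_divide_eq)
    have tail: "v (\<Sum>i\<in>{..<m} - {k}. fps_nth g i * z ^ i) < v (fps_nth g k * z ^ k)" for m
    proof (rule v_sum_less)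
      show "0 < v (fps_nth g k * z ^ k)" using \<rho>(1) v_pos[OF k(1)] by (simp add: v_mult v_power \<rho>_def)
      fix i assume i: "i \<in> {..<m} - {k}"
      show "v (fps_nth g i * z ^ i) < v (fps_nth g k * z ^ k)"
      proof (cases "i < k")
        case True
        then show ?thesis using k(2) \<open>0 < v (fps_nth g k * z ^ k)\<close> by simp
      next
        case False
        then have "Suc k \<le> i" using i by auto
        then have "\<rho> ^ i \<le> \<rho> ^ Suc k" using \<rho> by (intro power_decreasing) auto
        then have "v (fps_nth g i) * \<rho> ^ i \<le> G * \<rho> ^ Suc k"
          using G[of i] Gpos \<rho>(1) by (intro mult_mono) auto
        also have "\<dots> = (\<rho> * G) * \<rho> ^ k" by simp
        also have "\<dots> < v (fps_nth g k) * \<rho> ^ k" using \<rho> by (intro mult_strict_right_mono) auto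
        finally show ?thesis by (simp add: v_mult v_power \<rho>_def)
      qed
    qed
    have main: "v (\<Sum>i<m. fps_nth g i * z ^ i) = v (fps_nth g k * z ^ k)" if "k < m" for m
    proof -
      have "(\<Sum>i<m. fps_nth g i * z ^ i) = fps_nth g k * z ^ k + (\<Sum>i\<in>{..<m} - {k}. fps_nth g i * z ^ i)"
        using that by (intro sum.remove) auto
      then show ?thesis using v_add_eq[OF tail[of m]] by simp
    qed
    have "0 < v (fps_nth g k * z ^ k)" using \<rho>(1) v_pos[OF k(1)] by (simp add: v_mult v_power \<rho>_def)
    then obtain N where "\<And>m. m \<ge> N \<Longrightarrow> v ((\<Sum>i<m. fps_nth g i * z ^ i) - 0) < v (fps_nth g k * z ^ k)"
      using fps_converges_toD[OF conv] by blast
    from this[of "max N (Suc k)"] show False using main[of "max N (Suc k)"] by simp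
  qed
qed

end

section \<open>Estimates along an analytic map\<close>

locale analytic = nonarch_closed v for v :: "'k::alg_closed_field \<Rightarrow> real" +
  fixes f :: "'n::finite \<Rightarrow> 'k fps"
  assumes rep: "analytic_rep v f"
begin

abbreviation pullback :: "('n, 'k) mpoly \<Rightarrow> 'k fps" where
  "pullback H \<equiv> subst_poly fps_const f H"

abbreviation norm_f :: "real \<Rightarrow> real" where
  "norm_f r \<equiv> map_norm v f r"

abbreviation norm_along :: "real \<Rightarrow> ('n, 'k) mpoly \<Rightarrow> real" where
  "norm_along r H \<equiv> gauss_norm v r (pullback H)"

definition val :: "'k \<Rightarrow> 'n \<Rightarrow> 'k" where
  "val z j = fps_value v (f j) z"

lemma f_converges: "fps_converges_to v (f j) z (val z j)"
proof -
  obtain l where "fps_converges_to v (f j) z l"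
    using rep unfolding analytic_rep_def entire_def by blast
  then show ?thesis using fps_value_eq unfolding val_def by blast
qed

lemma f_decays: "0 \<le> r \<Longrightarrow> decays r (f j)"
  using rep entire_imp_decays unfolding analytic_rep_def by blast

lemma val_nonzero: "\<exists>j. val z j \<noteq> 0"
  using rep unfolding analytic_rep_def val_def by blast

lemma analytic_map_val: "analytic_map v f z = proj_point (val z)"
  unfolding analytic_map_def val_def ..

lemma pullback_decays: "homogeneous d H \<Longrightarrow> 0 \<le> r \<Longrightarrow> decays r (pullback H)"
proof (induction rule: homogeneous_induct)
  case (zero d)
  then show ?case using decays_const[of r 0] by simp
next
  case (add d G H)
  then show ?case by (simp add: fs.subst_poly_add decays_add)
next
  case (Const c)
  then show ?case by (simp add: decays_const)
next
  case (Var d k H)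
  then show ?case by (simp add: fs.subst_poly_mult decays_mult f_decays)
qed

lemma pullback_converges: "homogeneous d H \<Longrightarrow> fps_converges_to v (pullback H) z (eval_poly (val z) H)"
proof (induction rule: homogeneous_induct)
  case (zero d)
  then show ?case using converges_const[of 0 z] by simp
next
  case (add d G H)
  then show ?case by (simp add: fs.subst_poly_add ev.subst_poly_add converges_add)
next
  case (Const c)
  then show ?case by (simp add: converges_const)
next
  case (Var d k H)
  then show ?case by (simp add: fs.subst_poly_mult ev.subst_poly_mult converges_mult f_converges)
qed

lemma pullback_eq_zero:
  assumes "homogeneous d H" "\<And>z. eval_poly (val z) H = 0"
  shows "pullback H = 0"
  using zero_values_imp_zero pullback_converges[OF assms(1)] assms(2) by metis

lemma eval_val_zero:
  assumes "homogeneous d H" "pullback H = 0"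
  shows "eval_poly (val z) H = 0"
proof -
  have "fps_converges_to v 0 z (eval_poly (val z) H)" using pullback_converges[OF assms(1), of z] assms(2) by simp
  moreover have "fps_converges_to v 0 z 0" using converges_const[of 0 z] by simp
  ultimately show ?thesis using fps_value_eq by metis
qed

lemma norm_f_ge: "gauss_norm v r (f j) \<le> norm_f r"
  unfolding map_norm_def by (intro Max_ge) auto

lemma norm_f_attained: "\<exists>j. norm_f r = gauss_norm v r (f j)"
proof -
  have "norm_f r \<in> range (\<lambda>j. gauss_norm v r (f j))" unfolding map_norm_def by (intro Max_in) auto
  then show ?thesis by blast
qed

lemma norm_f_pos:
  assumes "0 < r"
  shows "0 < norm_f r"
proof -
  obtain j where "val 0 j \<noteq> 0" using val_nonzero by blast
  then have "pullback (Var j) \<noteq> 0" using eval_val_zero[OF homogeneous_Var, of j 0] by auto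
  then have "0 < gauss_norm v r (f j)" using gauss_norm_pos[OF f_decays[of r j]] assms by simp
  then show ?thesis using norm_f_ge[of r j] by linarith
qed

lemma norm_f_mono:
  assumes "1 \<le> r"
  shows "norm_f 1 \<le> norm_f r"
proof -
  obtain j where "norm_f 1 = gauss_norm v 1 (f j)" using norm_f_attained by blast
  also have "\<dots> \<le> gauss_norm v r (f j)" using assms f_decays by (intro gauss_norm_mono) auto
  also have "\<dots> \<le> norm_f r" by (rule norm_f_ge)
  finally show ?thesis .
qed

lemma pullback_bound:
  "homogeneous d H \<Longrightarrow> \<exists>C>0. \<forall>r>0. norm_along r H \<le> C * norm_f r ^ d"
proof (induction rule: homogeneous_induct)
  case (zero d)
  show ?case using norm_f_pos by (intro exI[of _ 1]) (auto simp: less_imp_le)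
next
  case (add d G H)
  then obtain B C where B: "B > 0" "\<And>r. r > 0 \<Longrightarrow> norm_along r G \<le> B * norm_f r ^ d"
    and C: "C > 0" "\<And>r. r > 0 \<Longrightarrow> norm_along r H \<le> C * norm_f r ^ d" by blast
  have "norm_along r (G + H) \<le> max B C * norm_f r ^ d" if r: "r > 0" for r
  proof -
    have "norm_along r (G + H) \<le> max (norm_along r G) (norm_along r H)"
      using add r by (simp add: fs.subst_poly_add gauss_norm_add_le pullback_decays)
    moreover have "B * norm_f r ^ d \<le> max B C * norm_f r ^ d" "C * norm_f r ^ d \<le> max B C * norm_f r ^ d"
      using norm_f_pos[OF r] by (auto intro!: mult_right_mono)
    ultimately show ?thesis using B(2)[OF r] C(2)[OF r] by linarith
  qed
  then show ?case using B(1) by (intro exI[of _ "max B C"]) auto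
next
  case (Const c)
  show ?case
    by (intro exI[of _ "v c + 1"]) (auto intro: add_nonneg_pos)
next
  case (Var d k H)
  then obtain C where C: "C > 0" "\<And>r. r > 0 \<Longrightarrow> norm_along r H \<le> C * norm_f r ^ d" by blast
  have "norm_along r (Var k * H) \<le> C * norm_f r ^ Suc d" if r: "r > 0" for r
  proof -
    have "norm_along r (Var k * H) = gauss_norm v r (f k) * norm_along r H"
      using Var r by (simp add: fs.subst_poly_mult gauss_norm_mult f_decays pullback_decays)
    also have "\<dots> \<le> norm_f r * (C * norm_f r ^ d)"
      using r Var norm_f_ge C(2)[OF r] norm_f_pos[OF r] by (intro mult_mono gauss_norm_nonneg pullback_decays) auto
    finally show ?thesis by (simp add: mult_ac)
  qed
  then show ?case using C(1) by blast
qed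

lemma pullback_nonneg: "homogeneous d H \<Longrightarrow> 0 < r \<Longrightarrow> 0 \<le> norm_along r H"
  by (intro gauss_norm_nonneg pullback_decays) auto

lemma pullback_lower_bound:
  assumes "homogeneous d H" "pullback H \<noteq> 0"
  shows "\<exists>c>0. \<forall>r\<ge>1. c \<le> norm_along r H"
proof (intro exI[of _ "norm_along 1 H"] conjI allI impI)
  show "0 < norm_along 1 H" using assms by (intro gauss_norm_pos pullback_decays) auto
  fix r :: real assume "1 \<le> r"
  then show "norm_along 1 H \<le> norm_along r H"
    using assms by (intro gauss_norm_mono pullback_decays) auto
qed

text \<open>A relation in the homogeneous coordinate ring of \<open>X\<close> becomes, by composition with \<open>f\<close>, an
  identity of entire functions, and the non-archimedean triangle inequality singles out one term.\<close>

lemma combination_estimate: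
  fixes Q :: "nat \<Rightarrow> ('n, 'k) mpoly"
  assumes X: "range (analytic_map v f) \<subseteq> X"
    and I: "finite I" "I \<noteq> {}" and Q: "\<And>i. i \<in> I \<Longrightarrow> homogeneous (d i) (Q i)"
    and F: "homogeneous k F"
    and relation: "\<And>j. combination X Q d I (e + M * k) (Var j ^ e * F ^ M)"
  shows "\<exists>C>0. \<forall>r\<ge>1. \<exists>i\<in>I.
    norm_along r F ^ M * norm_f r ^ d i \<le> C * norm_along r (Q i) * norm_f r ^ (M * k)"
proof -
  define D where "D = e + M * k"
  have "\<forall>j. combination X Q d I D (Var j ^ e * F ^ M)"
    using relation unfolding D_def by (rule allI)
  from choice[OF this] obtain A where A: "\<forall>j. cofactors I d D (A j) \<and>
      (\<forall>q\<in>X. \<forall>x\<in>q. eval_poly x (Var j ^ e * F ^ M) = (\<Sum>i\<in>I. eval_poly x (Q i * A j i)))" ..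
  have cof: "cofactors I d D (A j)" for j using spec[OF A, of j] by (rule conjunct1)
  have eq: "eval_poly x (Var j ^ e * F ^ M) = (\<Sum>i\<in>I. eval_poly x (Q i * A j i))"
    if "q \<in> X" "x \<in> q" for j q x
    using conjunct2[OF spec[OF A, of j]] that by blast
  have cofD: "A j i = 0 \<or> (\<exists>a. a + d i = D \<and> homogeneous a (A j i))" if "i \<in> I" for i j
    using cof[of j] that by (simp add: cofactors_def)
  have hom_A: "\<exists>a. homogeneous a (A j i)" if "i \<in> I" for i j
    using cofD[OF that] homogeneous_0 by metis
  have QA: "homogeneous D (Q i * A j i)" if "i \<in> I" for i j
    using cofD[OF that, of j] homogeneous_mult[OF Q[OF that]] by (metis add.commute homogeneous_0 mult_zero_right)
  have VF: "homogeneous D (Var j ^ e * F ^ M)" for j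
    unfolding D_def by (intro homogeneous_mult homogeneous_Var_power homogeneous_power F)
  have in_X: "proj_point (val z) \<in> X" for z using X analytic_map_val by blast
  have series: "f j ^ e * pullback F ^ M = (\<Sum>i\<in>I. pullback (Q i) * pullback (A j i))" for j
  proof -
    have "pullback (Var j ^ e * F ^ M - (\<Sum>i\<in>I. Q i * A j i)) = 0"
    proof (rule pullback_eq_zero)
      show "homogeneous D (Var j ^ e * F ^ M - (\<Sum>i\<in>I. Q i * A j i))"
        using QA by (intro homogeneous_diff VF homogeneous_sum)
      fix z show "eval_poly (val z) (Var j ^ e * F ^ M - (\<Sum>i\<in>I. Q i * A j i)) = 0"
        using eq[OF in_X self_in_proj_point] by (simp add: ev.subst_poly_diff ev.subst_poly_sum)
    qed
    then show ?thesis
      by (simp add: fs.subst_poly_diff fs.subst_poly_sum fs.subst_poly_mult fs.subst_poly_power)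
  qed
  have "\<exists>C>0. \<forall>r>0. norm_along r (A j i) * norm_f r ^ d i \<le> C * norm_f r ^ D" if "i \<in> I" for i j
    using cofD[OF that, of j]
  proof
    assume "A j i = 0"
    then show ?thesis using norm_f_pos by (intro exI[of _ 1]) (auto simp: less_imp_le)
  next
    assume "\<exists>a. a + d i = D \<and> homogeneous a (A j i)"
    then obtain a where a: "a + d i = D" "homogeneous a (A j i)" by blast
    obtain C where C: "C > 0" "\<And>r. r > 0 \<Longrightarrow> norm_along r (A j i) \<le> C * norm_f r ^ a"
      using pullback_bound[OF a(2)] by blast
    have "norm_along r (A j i) * norm_f r ^ d i \<le> C * norm_f r ^ D" if r: "r > 0" for r
    proof -
      have "norm_along r (A j i) * norm_f r ^ d i \<le> C * norm_f r ^ a * norm_f r ^ d i"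
        using C(2)[OF r] norm_f_pos[OF r] by (intro mult_right_mono) auto
      then show ?thesis using a(1) by (simp add: mult.assoc flip: power_add)
    qed
    then show ?thesis using C(1) by blast
  qed
  then obtain C where C: "\<And>i j. i \<in> I \<Longrightarrow> C i j > 0"
    "\<And>i j r. i \<in> I \<Longrightarrow> r > 0 \<Longrightarrow> norm_along r (A j i) * norm_f r ^ d i \<le> C i j * norm_f r ^ D"
    by metis
  define C0 where "C0 = Max ((\<lambda>(i, j). C i j) ` (I \<times> UNIV))"
  have C0: "C i j \<le> C0" if "i \<in> I" for i j
    unfolding C0_def using that I(1) by (intro Max_ge) auto
  obtain i1 where "i1 \<in> I" using I(2) by blast
  then have "C0 > 0" using C(1)[of i1 undefined] C0[of i1 undefined] by simp
  moreover have "\<exists>i\<in>I. norm_along r F ^ M * norm_f r ^ d i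
      \<le> C0 * norm_along r (Q i) * norm_f r ^ (M * k)" if r1: "r \<ge> 1" for r
  proof -
    have r: "r > 0" using r1 by simp
    let ?n = "gauss_norm v r" and ?N = "norm_f r"
    have N: "?N > 0" using norm_f_pos[OF r] .
    obtain j where j: "?N = ?n (f j)" using norm_f_attained by blast
    have dA: "decays r (pullback (A j i))" if "i \<in> I" for i
      using hom_A[OF that, of j] pullback_decays r by (metis less_imp_le)
    have dQ: "decays r (pullback (Q i))" if "i \<in> I" for i using pullback_decays[OF Q[OF that]] r by simp
    have dF: "decays r (pullback F)" using pullback_decays[OF F] r by simp
    have "decays r (pullback (Q i) * pullback (A j i))" if "i \<in> I" for i
      using dQ[OF that] dA[OF that] r by (intro decays_mult) auto
    then have "\<exists>i\<in>I. ?n (\<Sum>i\<in>I. pullback (Q i) * pullback (A j i)) \<le> ?n (pullback (Q i) * pullback (A j i))"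
      using I r by (intro gauss_norm_sum_le) auto
    then obtain i where i: "i \<in> I"
      "?n (\<Sum>i\<in>I. pullback (Q i) * pullback (A j i)) \<le> ?n (pullback (Q i) * pullback (A j i))" by blast
    have "?N ^ e * ?n (pullback F) ^ M = ?n (f j ^ e * pullback F ^ M)"
      using r dF f_decays[of r j]
      by (simp add: gauss_norm_mult gauss_norm_power decays_power j)
    also have "\<dots> \<le> ?n (pullback (Q i)) * ?n (pullback (A j i))"
      using i r dA dQ by (simp add: series gauss_norm_mult)
    finally have "?N ^ e * ?n (pullback F) ^ M * ?N ^ d i \<le> ?n (pullback (Q i)) * ?n (pullback (A j i)) * ?N ^ d i"
      using N by (intro mult_right_mono) auto
    also have "\<dots> = ?n (pullback (Q i)) * (?n (pullback (A j i)) * ?N ^ d i)" by (simp add: mult.assoc)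
    also have "\<dots> \<le> ?n (pullback (Q i)) * (C0 * ?N ^ D)"
    proof (rule mult_left_mono)
      have "?n (pullback (A j i)) * ?N ^ d i \<le> C i j * ?N ^ D" using C(2)[OF i(1) r] .
      also have "\<dots> \<le> C0 * ?N ^ D" using C0[OF i(1), of j] N by (intro mult_right_mono) auto
      finally show "?n (pullback (A j i)) * ?N ^ d i \<le> C0 * ?N ^ D" .
      show "0 \<le> ?n (pullback (Q i))" using dQ[OF i(1)] by (rule gauss_norm_nonneg)
    qed
    finally have "?N ^ e * (?n (pullback F) ^ M * ?N ^ d i) \<le> ?N ^ e * (C0 * ?n (pullback (Q i)) * ?N ^ (M * k))"
      by (simp add: D_def power_add mult_ac)
    then have "?n (pullback F) ^ M * ?N ^ d i \<le> C0 * ?n (pullback (Q i)) * ?N ^ (M * k)"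
      using N by (simp only: mult_le_cancel_left_pos zero_less_power)
    then show ?thesis using i(1) by blast
  qed
  ultimately show ?thesis by blast
qed

lemma gauss_norm_const_mult: "r > 0 \<Longrightarrow> decays r g \<Longrightarrow> gauss_norm v r (fps_const c * g) = v c * gauss_norm v r g"
  by (simp add: gauss_norm_mult decays_const)

text \<open>The distance from \<open>f\<close> to the point with coordinates \<open>x\<close>, up to the factor \<open>norm_f r\<close>.\<close>

definition point_dist :: "('n \<Rightarrow> 'k) \<Rightarrow> real \<Rightarrow> real" where
  "point_dist x r = (MAX ij. norm_along r (minor x ij))"

lemma point_dist_ge: "norm_along r (minor x ij) \<le> point_dist x r"
  unfolding point_dist_def by (intro Max_ge) auto

lemma point_dist_attained: "\<exists>ij. norm_along r (minor x ij) = point_dist x r"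
proof -
  have "point_dist x r \<in> range (\<lambda>ij. norm_along r (minor x ij))"
    unfolding point_dist_def by (intro Max_in) auto
  then show ?thesis by force
qed

lemma pullback_minor: "pullback (minor x (i, j)) = fps_const (x i) * f j - fps_const (x j) * f i"
  by (simp add: minor_def fs.subst_poly_diff fs.subst_poly_mult)

text \<open>The map cannot be close to two different points at the same radius: the linear forms through
  the two points span all linear forms.  The constants come from writing this out.  Cramer's rule
  with the determinant \<open>\<Delta>\<close> expresses \<open>f a\<close> and \<open>f b\<close> by one minor for each point, and a minor with a
  column \<open>c\<close> for which \<open>x c \<noteq> 0\<close> then gives every other \<open>f l\<close>.\<close>

lemma point_dist_separation:
  assumes ab: "x a * y b \<noteq> x b * y a"
  shows "\<exists>c>0. \<forall>r>0. c * norm_f r \<le> max (point_dist x r) (point_dist y r)"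
proof -
  define \<Delta> where "\<Delta> = x a * y b - x b * y a"
  have \<Delta>: "\<Delta> \<noteq> 0" using ab by (simp add: \<Delta>_def)
  obtain c where c: "c = a \<or> c = b" "x c \<noteq> 0" using ab by (metis mult_zero_left)
  define K where "K = Max (insert (v \<Delta>) (range (\<lambda>l. v (x l * y c)) \<union> range (\<lambda>l. v (x l * x c))))"
  have K: "v \<Delta> \<le> K" "\<And>l. v (x l * y c) \<le> K" "\<And>l. v (x l * x c) \<le> K"
    unfolding K_def by (intro Max_ge; auto)+
  have Kpos: "0 < K" using K(1) v_pos[OF \<Delta>] by linarith
  have key: "v (\<Delta> * x c) * norm_f r \<le> K * max (point_dist x r) (point_dist y r)" if r: "r > 0" for r
  proof -
    define \<mu> where "\<mu> = max (point_dist x r) (point_dist y r)"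
    obtain l where l: "norm_f r = gauss_norm v r (f l)" using norm_f_attained by blast
    define m1 m2 m3 where "m1 = pullback (minor x (c, l))" and "m2 = pullback (minor x (a, b))"
      and "m3 = pullback (minor y (a, b))"
    have dec: "decays r m1" "decays r m2" "decays r m3"
      using r pullback_decays[OF homogeneous_minor] by (auto simp: m1_def m2_def m3_def)
    have le: "gauss_norm v r m1 \<le> \<mu>" "gauss_norm v r m2 \<le> \<mu>" "gauss_norm v r m3 \<le> \<mu>"
      using point_dist_ge[of r x "(c, l)"] point_dist_ge[of r x "(a, b)"] point_dist_ge[of r y "(a, b)"]
      by (auto simp: \<mu>_def m1_def m2_def m3_def)
    have \<mu>: "0 \<le> \<mu>" using le(1) gauss_norm_nonneg[OF dec(1)] by linarith
    have summand: "gauss_norm v r (fps_const t * m) \<le> K * \<mu>"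
      if "v t \<le> K" "gauss_norm v r m \<le> \<mu>" "decays r m" for t m
      using that r gauss_norm_nonneg[OF that(3)] Kpos
      by (simp add: gauss_norm_const_mult) (intro mult_mono; simp)
    have split: "fps_const (\<Delta> * x c) * f l =
        fps_const \<Delta> * m1 + (fps_const (x l * y c) * m2 + fps_const (- (x l * x c)) * m3)"
      using c(1)
      by (auto simp: \<Delta>_def m1_def m2_def m3_def pullback_minor algebra_simps
          simp flip: fps_const_mult fps_const_sub fps_const_neg simp del: fps_const_mult fps_const_sub fps_const_neg)
    have "v (\<Delta> * x c) * norm_f r = gauss_norm v r (fps_const (\<Delta> * x c) * f l)"
      using r f_decays[of r l] by (simp add: gauss_norm_const_mult l)
    also have "\<dots> \<le> max (gauss_norm v r (fps_const \<Delta> * m1))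
        (gauss_norm v r (fps_const (x l * y c) * m2 + fps_const (- (x l * x c)) * m3))"
      unfolding split using r dec
      by (intro gauss_norm_add_le decays_add decays_mult decays_const) auto
    also have "\<dots> \<le> max (gauss_norm v r (fps_const \<Delta> * m1))
        (max (gauss_norm v r (fps_const (x l * y c) * m2)) (gauss_norm v r (fps_const (- (x l * x c)) * m3)))"
      using r dec by (intro max.mono gauss_norm_add_le decays_mult decays_const order_refl) auto
    also have "\<dots> \<le> K * \<mu>"
      using summand[OF K(1) le(1) dec(1)] summand[OF K(2) le(2) dec(2)] summand[of "- (x l * x c)", OF _ le(3) dec(3)] K(3)
      by simp
    finally show ?thesis by (simp add: \<mu>_def)
  qed
  define c0 where "c0 = v (\<Delta> * x c) / K"
  have "c0 > 0" using \<Delta> c(2) Kpos v_pos[of "\<Delta> * x c"] by (simp add: c0_def)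
  moreover have "c0 * norm_f r \<le> max (point_dist x r) (point_dist y r)" if "r > 0" for r
    using key[OF that] Kpos by (simp add: c0_def pos_divide_le_eq mult.commute)
  ultimately show ?thesis by blast
qed

text \<open>If all minors vanished along \<open>f\<close>, then \<open>f\<close> would be the constant map to this point.\<close>

lemma point_dist_lower_bound:
  assumes nonconst: "\<not> analytic_map v f constant_on UNIV" and x: "\<exists>j. x j \<noteq> 0"
  shows "\<exists>c>0. \<forall>r\<ge>1. c \<le> point_dist x r"
proof -
  have "\<exists>ij. pullback (minor x ij) \<noteq> 0"
  proof (rule ccontr)
    assume "\<nexists>ij. pullback (minor x ij) \<noteq> 0"
    then have "eval_poly (val z) (minor x (i, j)) = 0" for z i j
      using eval_val_zero[OF homogeneous_minor] by blast
    then have "x i * val z j = x j * val z i" for z i j using eval_minor[of "val z" x i j] by simp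
    then have "proj_point (val z) = proj_point x" for z
      using minors_zero_imp_proportional[of x "val z"] x val_nonzero by blast
    then show False using nonconst unfolding constant_on_def analytic_map_val by blast
  qed
  then obtain ij where "pullback (minor x ij) \<noteq> 0" by blast
  then obtain c where c: "c > 0" "\<And>r. r \<ge> 1 \<Longrightarrow> c \<le> norm_along r (minor x ij)"
    using pullback_lower_bound[OF homogeneous_minor] by blast
  have "c \<le> point_dist x r" if "r \<ge> 1" for r using c(2)[OF that] point_dist_ge[of r x ij] by linarith
  then show ?thesis using c(1) by blast
qed

end

context analytic
begin

text \<open>Take through each point the linear form that is largest along \<open>f\<close> at the given radius.  All
  points but one, \<open>p0\<close>, are at distance at least \<open>c\<close> times \<open>norm_f r\<close>, and \<open>p0\<close> is at distance at least \<open>c\<close>.\<close>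

lemma product_of_minors_lower_bound:
  assumes nonconst: "\<not> analytic_map v f constant_on UNIV"
    and A: "finite A" "A \<subseteq> proj_space" and R: "\<And>p. p \<in> A \<Longrightarrow> R p \<in> p"
  shows "\<exists>c>0. \<forall>r\<ge>1. \<exists>\<phi>\<in>A \<rightarrow>\<^sub>E UNIV.
    c * norm_f r ^ card A \<le> norm_f r * norm_along r (\<Prod>p\<in>A. minor (R p) (\<phi> p))"
proof (cases "A = {}")
  case True
  have le: "norm_f 1 * norm_f r ^ card A \<le>
      norm_f r * norm_along r (\<Prod>p\<in>A. minor (R p) ((\<lambda>_. undefined) p))" if "r \<ge> 1" for r
    using True norm_f_mono[OF that] by simp
  have empty: "(\<lambda>_. undefined) \<in> A \<rightarrow>\<^sub>E UNIV" using True by simp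
  show ?thesis
  proof (intro exI[of _ "norm_f 1"] conjI allI impI)
    show "0 < norm_f 1" by (rule norm_f_pos) simp
    fix r :: real assume "r \<ge> 1"
    then show "\<exists>\<phi>\<in>A \<rightarrow>\<^sub>E UNIV. norm_f 1 * norm_f r ^ card A \<le>
        norm_f r * norm_along r (\<Prod>p\<in>A. minor (R p) (\<phi> p))"
      using le empty by (intro bexI[where x = "\<lambda>_. undefined"])
  qed
next
  case False
  have proj_R: "proj_point (R p) = p" "\<exists>j. R p j \<noteq> 0" if "p \<in> A" for p
  proof -
    have p: "p \<in> proj_space" "R p \<in> p" using that A(2) R by auto
    show "proj_point (R p) = p" using proj_point_eq[OF p] by simp
    show "\<exists>j. R p j \<noteq> 0" using p by (rule proj_space_nonzero)
  qed
  have "\<exists>c>0. \<forall>r\<ge>1. c \<le> point_dist (R p) r" if "p \<in> A" for p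
    by (rule point_dist_lower_bound[OF nonconst proj_R(2)[OF that]])
  then obtain c1 where c1: "\<And>p. p \<in> A \<Longrightarrow> c1 p > 0"
    "\<And>p r. p \<in> A \<Longrightarrow> r \<ge> 1 \<Longrightarrow> c1 p \<le> point_dist (R p) r" by metis
  have separated: "\<exists>c>0. \<forall>r>0. c * norm_f r \<le> max (point_dist (R p) r) (point_dist (R p') r)"
    if p: "p \<in> A" "p' \<in> A" "p \<noteq> p'" for p p'
  proof -
    obtain k where k: "R p k \<noteq> 0" using proj_R(2)[OF p(1)] by blast
    have "\<exists>a b. R p a * R p' b \<noteq> R p b * R p' a"
    proof (rule ccontr)
      assume "\<nexists>a b. R p a * R p' b \<noteq> R p b * R p' a"
      then have "proj_point (R p') = proj_point (R p)"
        by (intro minors_zero_imp_proportional[of "R p" "R p'" k] k proj_R(2)[OF p(2)]) simp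
      then show False using proj_R(1)[OF p(1)] proj_R(1)[OF p(2)] p(3) by simp
    qed
    then obtain a b where "R p a * R p' b \<noteq> R p b * R p' a" by blast
    then show ?thesis by (rule point_dist_separation)
  qed
  define c2 where "c2 p p' = (SOME c. 0 < c \<and>
      (\<forall>r>0. c * norm_f r \<le> max (point_dist (R p) r) (point_dist (R p') r)))" for p p'
  have c2: "0 < c2 p p' \<and> (\<forall>r>0. c2 p p' * norm_f r \<le> max (point_dist (R p) r) (point_dist (R p') r))"
    if "p \<in> A" "p' \<in> A" "p \<noteq> p'" for p p'
    using someI_ex[OF separated[OF that]] unfolding c2_def .
  define S where "S = c1 ` A \<union> (\<lambda>(p, p'). c2 p p') ` {(p, p'). p \<in> A \<and> p' \<in> A \<and> p \<noteq> p'}"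
  have "finite {(p, p'). p \<in> A \<and> p' \<in> A \<and> p \<noteq> p'}"
    by (rule finite_subset[of _ "A \<times> A"]) (use A(1) in auto)
  then have S: "finite S" "S \<noteq> {}" using A(1) False by (auto simp: S_def)
  define c where "c = Min S"
  have cpos: "c > 0" unfolding c_def using S c1(1) c2 by (subst Min_gr_iff) (auto simp: S_def)
  have cle1: "c \<le> c1 p" if "p \<in> A" for p
    unfolding c_def using S(1) that by (intro Min_le) (auto simp: S_def)
  have cle2: "c \<le> c2 p p'" if "p \<in> A" "p' \<in> A" "p \<noteq> p'" for p p'
    unfolding c_def using S(1) that by (intro Min_le) (auto simp: S_def)
  have "\<exists>\<phi>\<in>A \<rightarrow>\<^sub>E UNIV. c ^ card A * norm_f r ^ card A \<le>
      norm_f r * norm_along r (\<Prod>p\<in>A. minor (R p) (\<phi> p))" if r1: "r \<ge> 1" for r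
  proof -
    have r: "r > 0" using r1 by simp
    have N: "norm_f r > 0" using norm_f_pos[OF r] .
    define \<delta> where "\<delta> p = point_dist (R p) r" for p
    have "\<exists>\<psi>. \<forall>p. norm_along r (minor (R p) (\<psi> p)) = \<delta> p"
      unfolding \<delta>_def by (intro choice allI point_dist_attained)
    then obtain \<psi> where \<psi>: "\<And>p. norm_along r (minor (R p) (\<psi> p)) = \<delta> p" by blast
    have "\<exists>p0\<in>A. \<forall>p\<in>A - {p0}. c * norm_f r \<le> \<delta> p"
    proof (cases "\<exists>p\<in>A. \<delta> p < c * norm_f r")
      case True
      then obtain p0 where p0: "p0 \<in> A" "\<delta> p0 < c * norm_f r" by blast
      have "c * norm_f r \<le> \<delta> p" if p: "p \<in> A - {p0}" for p
      proof -
        have "c * norm_f r \<le> c2 p0 p * norm_f r" using cle2 p p0 N by (intro mult_right_mono) auto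
        also have "\<dots> \<le> max (\<delta> p0) (\<delta> p)" using c2[of p0 p] p p0(1) r by (auto simp: \<delta>_def)
        finally show ?thesis using p0(2) by linarith
      qed
      then show ?thesis using p0(1) by blast
    next
      case False
      then have "c * norm_f r \<le> \<delta> p" if "p \<in> A" for p using that by (simp add: not_less)
      then show ?thesis using \<open>A \<noteq> {}\<close> by blast
    qed
    then obtain p0 where p0: "p0 \<in> A" "\<And>p. p \<in> A - {p0} \<Longrightarrow> c * norm_f r \<le> \<delta> p" by blast
    have d0: "c \<le> \<delta> p0" using cle1[OF p0(1)] c1(2)[OF p0(1) r1] by (simp add: \<delta>_def)
    have "card A = Suc (card (A - {p0}))" using A(1) p0(1) by (rule card.remove)
    then have "c ^ card A * norm_f r ^ card A = norm_f r * (c * (c * norm_f r) ^ card (A - {p0}))"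
      by (simp add: power_mult_distrib mult_ac)
    also have "(c * norm_f r) ^ card (A - {p0}) = (\<Prod>p\<in>A - {p0}. c * norm_f r)" by simp
    also have "norm_f r * (c * \<dots>) \<le> norm_f r * (\<delta> p0 * (\<Prod>p\<in>A - {p0}. \<delta> p))"
      using N d0 cpos p0(2) by (intro mult_left_mono mult_mono prod_mono prod_nonneg) auto
    also have "\<delta> p0 * (\<Prod>p\<in>A - {p0}. \<delta> p) = (\<Prod>p\<in>A. \<delta> p)"
      by (rule prod.remove[OF A(1) p0(1), symmetric])
    also have "\<dots> = norm_along r (\<Prod>p\<in>A. minor (R p) (\<psi> p))"
      unfolding fs.subst_poly_prod
      using r pullback_decays[OF homogeneous_minor] \<psi> by (subst gauss_norm_prod) auto
    also have "(\<Prod>p\<in>A. minor (R p) (\<psi> p)) = (\<Prod>p\<in>A. minor (R p) (restrict \<psi> A p))"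
      by (intro prod.cong) auto
    finally show ?thesis by (intro bexI[of _ "restrict \<psi> A"]) auto
  qed
  then show ?thesis using cpos by (intro exI[of _ "c ^ card A"]) auto
qed

text \<open>Each product of linear forms through the points vanishes on the support, so its \<open>M\<close>-th power is
  a combination of the \<open>Q i\<close> up to a power of a variable.  There are finitely many such products,
  and at each radius one of them is large.\<close>

lemma zero_dimensional_intersection_estimate:
  fixes Q :: "nat \<Rightarrow> ('n, 'k) mpoly"
  assumes nonconst: "\<not> analytic_map v f constant_on UNIV"
    and X: "closedin zariski X" "range (analytic_map v f) \<subseteq> X"
    and I: "finite I" "I \<noteq> {}" and Q: "\<And>i. i \<in> I \<Longrightarrow> homogeneous (d i) (Q i)"
    and le: "subscheme_le (inter_with X Q I) (subscheme_mult M (Supp (inter_with X Q I)))"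
    and fin: "finite (points (inter_with X Q I))"
  shows "\<exists>C>0. \<forall>r\<ge>1. \<exists>i\<in>I. norm_f r ^ d i \<le> C * norm_along r (Q i) * norm_f r ^ M"
proof -
  define A where "A = points (inter_with X Q I)"
  have A: "finite A" "A \<subseteq> proj_space" using fin by (auto simp: A_def points_def)
  define R where "R p = (SOME x. x \<in> p)" for p :: "('n, 'k) ppoint"
  have R: "R p \<in> p" if "p \<in> A" for p
    using proj_space_nonempty[of p] that A(2) by (auto simp: R_def some_in_eq)
  define k where "k = card A"
  define F where "F \<phi> = (\<Prod>p\<in>A. minor (R p) (\<phi> p))" for \<phi>
  have F: "homogeneous k (F \<phi>)" for \<phi>
  proof -
    have "homogeneous (\<Sum>p\<in>A. 1) (F \<phi>)" unfolding F_def by (intro homogeneous_prod homogeneous_minor)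
    then show ?thesis by (simp add: k_def)
  qed
  have F0: "eval_poly x (F \<phi>) = 0" if "p \<in> A" "x \<in> p" for p x \<phi>
  proof -
    have "eval_poly x (minor (R p) (\<phi> p)) = 0" using eval_minor_zero R that A(2) by blast
    then show ?thesis unfolding F_def ev.subst_poly_prod using that(1) A(1) by (intro prod_zero) auto
  qed
  have "\<exists>C>0. \<forall>r\<ge>1. \<exists>i\<in>I. norm_along r (F \<phi>) ^ M * norm_f r ^ d i
      \<le> C * norm_along r (Q i) * norm_f r ^ (M * k)" for \<phi>
  proof -
    have "\<exists>e. \<forall>j. combination X Q d I (e + M * k) (Var j ^ e * F \<phi> ^ M)"
    proof (rule combination_local_to_global)
      fix p :: "('n, 'k) ppoint" assume p: "p \<in> proj_space"
      show "locally_combination X Q d I p (M * k) (F \<phi> ^ M)"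
        by (rule power_locally_combination[OF X(1) I(1) Q le F F0 p]) (auto simp: A_def)
    qed
    then obtain e where rel: "\<And>j. combination X Q d I (e + M * k) (Var j ^ e * F \<phi> ^ M)"
      by blast
    show ?thesis by (rule combination_estimate[OF X(2) I _ F rel]) (rule Q)
  qed
  then obtain C where C: "\<And>\<phi>. C \<phi> > 0" "\<And>\<phi> r. r \<ge> 1 \<Longrightarrow> \<exists>i\<in>I.
      norm_along r (F \<phi>) ^ M * norm_f r ^ d i
      \<le> C \<phi> * norm_along r (Q i) * norm_f r ^ (M * k)" by metis
  obtain c where c: "c > 0" "\<And>r. r \<ge> 1 \<Longrightarrow> \<exists>\<phi>\<in>A \<rightarrow>\<^sub>E UNIV.
      c * norm_f r ^ k \<le> norm_f r * norm_along r (F \<phi>)"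
    using product_of_minors_lower_bound[OF nonconst A R] unfolding k_def F_def by blast
  define C0 where "C0 = Max (C ` (A \<rightarrow>\<^sub>E UNIV))"
  have C0: "C \<phi> \<le> C0" if "\<phi> \<in> A \<rightarrow>\<^sub>E UNIV" for \<phi>
    unfolding C0_def using that A(1) by (intro Max_ge finite_imageI finite_PiE imageI finite)
  have "C0 > 0" using C(1)[of "restrict undefined A"] C0[of "restrict undefined A"] by simp
  moreover have "\<exists>i\<in>I. norm_f r ^ d i \<le> C0 / c ^ M * norm_along r (Q i) * norm_f r ^ M"
    if r1: "r \<ge> 1" for r
  proof -
    let ?N = "norm_f r" and ?n = "\<lambda>H. norm_along r H"
    have r: "r > 0" using r1 by simp
    have N: "?N > 0" using norm_f_pos[OF r] .
    obtain \<phi> where \<phi>: "\<phi> \<in> A \<rightarrow>\<^sub>E UNIV" "c * ?N ^ k \<le> ?N * ?n (F \<phi>)" using c(2)[OF r1] by blast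
    obtain i where i: "i \<in> I" "?n (F \<phi>) ^ M * ?N ^ d i \<le> C \<phi> * ?n (Q i) * ?N ^ (M * k)"
      using C(2)[OF r1] by blast
    have nQ: "0 \<le> ?n (Q i)" using pullback_nonneg[OF Q[OF i(1)] r] .
    have "?N ^ (M * k) * (c ^ M * ?N ^ d i) = (c * ?N ^ k) ^ M * ?N ^ d i"
      by (simp add: power_mult_distrib power_mult[symmetric] mult_ac)
    also have "\<dots> \<le> (?N * ?n (F \<phi>)) ^ M * ?N ^ d i"
      using \<phi>(2) c(1) N by (intro mult_right_mono power_mono) auto
    also have "\<dots> = ?N ^ M * (?n (F \<phi>) ^ M * ?N ^ d i)" by (simp add: power_mult_distrib)
    also have "\<dots> \<le> ?N ^ M * (C \<phi> * ?n (Q i) * ?N ^ (M * k))"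
      using i(2) N by (intro mult_left_mono) auto
    also have "\<dots> \<le> ?N ^ M * (C0 * ?n (Q i) * ?N ^ (M * k))"
      using C0[OF \<phi>(1)] nQ N by (intro mult_left_mono mult_right_mono) auto
    also have "\<dots> = ?N ^ (M * k) * (C0 * ?n (Q i) * ?N ^ M)" by (simp add: mult_ac)
    finally have "c ^ M * ?N ^ d i \<le> C0 * ?n (Q i) * ?N ^ M"
      using N by (simp only: mult_le_cancel_left_pos zero_less_power)
    then have "?N ^ d i \<le> C0 / c ^ M * ?n (Q i) * ?N ^ M"
      using c(1) by (simp add: pos_le_divide_eq mult.commute)
    then show ?thesis using i(1) by blast
  qed
  ultimately show ?thesis using c(1) by (intro exI[of _ "C0 / c ^ M"]) auto
qed

text \<open>The estimate for combinations with the form \<open>1\<close> in place of a power of \<open>F\<close>.\<close>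

lemma empty_intersection_estimate:
  fixes Q :: "nat \<Rightarrow> ('n, 'k) mpoly"
  assumes X: "closedin zariski X" "range (analytic_map v f) \<subseteq> X"
    and I: "finite I" "I \<noteq> {}" and Q: "\<And>i. i \<in> I \<Longrightarrow> homogeneous (d i) (Q i)"
    and empty: "points (inter_with X Q I) = {}"
  shows "\<exists>C>0. \<forall>r\<ge>1. \<exists>i\<in>I. norm_f r ^ d i \<le> C * norm_along r (Q i)"
proof -
  have "\<exists>e. \<forall>j. combination X Q d I (e + 0) (Var j ^ e * 1)"
    by (rule combination_local_to_global, rule empty_intersection_locally_combination[OF X(1) I(1) Q empty])
  then obtain e where "\<And>j. combination X Q d I (e + 0 * 0) (Var j ^ e * 1 ^ 0)"
    by (simp only: mult_0 power_0) blast
  from combination_estimate[OF X(2) I _ homogeneous_one this] Q show ?thesis by simp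
qed

lemma pullback_nonzero:
  assumes Q: "homogeneous d Q" and "\<not> range (analytic_map v f) \<subseteq> points (hypersurface Q)"
  shows "pullback Q \<noteq> 0"
proof
  assume "pullback Q = 0"
  then have zero: "eval_poly (val z) Q = 0" for z using eval_val_zero[OF Q] by blast
  have "proj_point (val z) \<in> points (hypersurface Q)" for z
  proof (rule zero_in_points_hypersurface)
    show pz: "proj_point (val z) \<in> proj_space" using val_nonzero[of z] by (auto intro: proj_point_in_space)
    fix x assume "x \<in> proj_point (val z)"
    then show "eval_poly x Q = 0"
      using homogeneous_eval_zero_iff[OF Q pz _ self_in_proj_point] zero by blast
  qed
  then show False using assms(2) by (auto simp: analytic_map_val)
qed

end

section \<open>Summing over the hypersurfaces\<close>

text \<open>Makes one constant serve all hypersurfaces, or all sets of hypersurfaces of a given size.\<close>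

lemma uniform_constant:
  fixes P :: "'s \<Rightarrow> real \<Rightarrow> bool"
  assumes "finite S" "\<And>s. s \<in> S \<Longrightarrow> \<exists>C. P s C" "\<And>s C C'. P s C \<Longrightarrow> C \<le> C' \<Longrightarrow> P s C'"
  shows "\<exists>C. \<forall>s\<in>S. P s C"
  using assms(1,2)
proof (induction S)
  case (insert s S)
  obtain C where "P s C" using insert.prems by blast
  moreover obtain C' where "\<forall>s\<in>S. P s C'" using insert by auto
  ultimately have "\<forall>s\<in>insert s S. P s (max C C')" using assms(3) by (metis insert_iff max.cobounded1 max.cobounded2)
  then show ?case by blast
qed simp

text \<open>By \<open>few\<close>, at most \<open>n\<close> terms exceed \<open>C\<close>.  If fewer than \<open>n\<close> do, the bound \<open>each\<close> suffices for them; if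
  exactly \<open>n\<close> do, one of them satisfies the bound of \<open>small\<close> and \<open>each\<close> is used for the other \<open>n - 1\<close>.\<close>

lemma sum_le_of_few_large_terms:
  fixes a :: "'i \<Rightarrow> real"
  assumes S: "finite S" and n: "n \<ge> 1" and nonneg: "0 \<le> C" "0 \<le> \<mu>" "0 \<le> T + C"
    and each: "\<And>i. i \<in> S \<Longrightarrow> a i \<le> T + C"
    and few: "\<And>J. J \<subseteq> S \<Longrightarrow> card J = n + 1 \<Longrightarrow> \<exists>i\<in>J. a i \<le> C"
    and small: "\<And>J. J \<subseteq> S \<Longrightarrow> card J = n \<Longrightarrow> \<exists>i\<in>J. a i \<le> \<mu> * T + C"
  shows "(\<Sum>i\<in>S. a i) \<le> (real n - 1 + \<mu>) * T + (real (card S) + real n + \<mu>) * C"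
proof -
  define B where "B = {i \<in> S. a i > C}"
  have B: "B \<subseteq> S" "finite B" using S by (auto simp: B_def)
  have cardB: "card B \<le> n"
  proof (rule ccontr)
    assume "\<not> card B \<le> n"
    then obtain J where "J \<subseteq> B" "card J = n + 1" using obtain_subset_with_card_n[of "n + 1" B] by auto
    then show False using few[of J] B(1) by (force simp: B_def)
  qed
  have "(\<Sum>i\<in>S - B. a i) \<le> real (card (S - B)) * C"
    by (rule sum_bounded_above) (auto simp: B_def)
  also have "\<dots> \<le> real (card S) * C"
    using S nonneg(1) by (intro mult_right_mono) (auto intro: card_mono)
  finally have rest: "(\<Sum>i\<in>S - B. a i) \<le> real (card S) * C" .
  have large: "(\<Sum>i\<in>B. a i) \<le> (real n - 1 + \<mu>) * T + (real n + \<mu>) * C"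
  proof (cases "card B = n")
    case True
    then obtain i0 where i0: "i0 \<in> B" "a i0 \<le> \<mu> * T + C" using small[OF B(1)] by blast
    have "(\<Sum>i\<in>B - {i0}. a i) \<le> real (card (B - {i0})) * (T + C)"
      using each B(1) by (intro sum_bounded_above) auto
    moreover have "real (card (B - {i0})) = real n - 1" using True i0(1) B(2) n by (simp add: of_nat_diff)
    moreover have "(\<Sum>i\<in>B. a i) = a i0 + (\<Sum>i\<in>B - {i0}. a i)" using B(2) i0(1) by (rule sum.remove)
    ultimately have "(\<Sum>i\<in>B. a i) \<le> (\<mu> * T + C) + (real n - 1) * (T + C)" using i0(2) by simp
    also have "\<dots> \<le> (\<mu> * T + C) + (real n - 1) * (T + C) + \<mu> * C" using nonneg by simp
    finally show ?thesis by (simp add: algebra_simps)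
  next
    case False
    then have "real (card B) \<le> real n - 1" using cardB n by linarith
    have "(\<Sum>i\<in>B. a i) \<le> real (card B) * (T + C)"
      using each B(1) by (intro sum_bounded_above) auto
    also have "\<dots> \<le> (real n - 1) * (T + C)"
      using \<open>real (card B) \<le> real n - 1\<close> nonneg(3) by (rule mult_right_mono)
    also have "\<dots> \<le> (real n - 1) * (T + C) + \<mu> * (T + C) + C" using nonneg by simp
    finally show ?thesis by (simp add: algebra_simps)
  qed
  have "(\<Sum>i\<in>S. a i) = (\<Sum>i\<in>S - B. a i) + (\<Sum>i\<in>B. a i)"
    using S B(1) by (rule sum.subset_diff[rotated])
  then show ?thesis using rest large by (simp add: algebra_simps)
qed

theorem theorem10:
  fixes v :: "'k::alg_closed_field \<Rightarrow> real"
    and X :: "('n::finite, 'k) ppoint set"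
    and Q :: "nat \<Rightarrow> ('n, 'k) mpoly"
    and d :: "nat \<Rightarrow> nat"
    and f :: "'n \<Rightarrow> 'k fps"
    and n q M :: nat
  assumes "nonarch_absval v" and "complete_absval v"
    and "irreducible_closed X" and "zariski_dim X = ereal (real n)" and "n \<ge> 1"
    and "q \<ge> 1"
    and "\<And>i. i \<in> {1..q} \<Longrightarrow> d i \<ge> 1 \<and> homogeneous (d i) (Q i) \<and> Q i \<noteq> 0"
    and "general_position X n Q q"
    and "M \<ge> 1"
    and "\<And>I. I \<subseteq> {1..q} \<Longrightarrow> card I = n \<Longrightarrow>
           subscheme_le (inter_with X Q I) (subscheme_mult M (Supp (inter_with X Q I)))"
    and "analytic_rep v f"
    and "range (analytic_map v f) \<subseteq> X"
    and "\<not> analytic_map v f constant_on UNIV"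
    and "\<And>i. i \<in> {1..q} \<Longrightarrow> \<not> range (analytic_map v f) \<subseteq> points (hypersurface (Q i))"
  shows "\<exists>C. \<forall>r\<ge>1.
           (\<Sum>i=1..q. proximity_fun v f (d i) (Q i) r / real (d i))
             \<le> (real n - 1 + (MAX i\<in>{1..q}. real M / real (d i))) * characteristic_fun v f r + C"
proof -
  interpret analytic v f by unfold_locales (rule assms)+
  let ?S = "{1..q}"
  have X: "closedin zariski X" using assms(3) by (simp add: irreducible_closed_def)
  have Q: "homogeneous (d i) (Q i)" and d: "d i \<ge> 1" if "i \<in> ?S" for i using assms(7)[OF that] by auto
  have gp: "zariski_dim (points (inter_with X Q J)) \<le> ereal (real n - real (card J))"
    if "J \<subseteq> ?S" "card J \<le> n + 1" for J
    using assms(8) that unfolding general_position_def by blast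
  define T where "T r = ln (norm_f r)" for r
  define w where "w i r = norm_along r (Q i)" for i r
  define a where "a i r = proximity_fun v f (d i) (Q i) r / real (d i)" for i r
  define \<mu> where "\<mu> = (MAX i\<in>?S. real M / real (d i))"
  have \<mu>: "real M / real (d i) \<le> \<mu>" if "i \<in> ?S" for i
    unfolding \<mu>_def using that by (intro Max_ge) auto
  have \<mu>0: "0 \<le> \<mu>" using \<mu>[of 1] assms(6) by (auto intro: order_trans[rotated])
  have N: "norm_f r > 0" if "r \<ge> 1" for r using norm_f_pos that by simp
  have lower: "\<exists>c>0. \<forall>r\<ge>1. c \<le> w i r" if "i \<in> ?S" for i
    unfolding w_def using pullback_lower_bound[OF Q[OF that]] pullback_nonzero[OF Q[OF that]] assms(14)[OF that] by blast
  have wpos: "w i r > 0" if "i \<in> ?S" "r \<ge> 1" for i r using lower[OF that(1)] that(2) by (metis less_le_trans)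
  have a_eq: "a i r = (real (d i) * T r - ln (w i r)) / real (d i)" if "i \<in> ?S" "r \<ge> 1" for i r
    unfolding a_def proximity_fun_def T_def w_def[symmetric]
    using N[OF that(2)] wpos[OF that] by (simp add: ln_div ln_realpow)
  \<comment> \<open>Logarithm of the norm estimates; used with \<open>m = d i\<close>, \<open>m = 0\<close> and \<open>m = M\<close>.\<close>
  have a_le: "a i r \<le> real m / real (d i) * T r + \<bar>ln C\<bar>"
    if i: "i \<in> ?S" and r: "r \<ge> 1" and C: "C > 0" "norm_f r ^ d i \<le> C * w i r * norm_f r ^ m" for i r C m
  proof -
    have "ln (norm_f r ^ d i) \<le> ln (C * w i r * norm_f r ^ m)"
      using C N[OF r] by (intro ln_mono) (auto simp: wpos[OF i r])
    then have "real (d i) * T r \<le> ln C + ln (w i r) + real m * T r"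
      using C(1) N[OF r] wpos[OF i r] by (simp add: ln_mult ln_realpow T_def)
    then have "a i r \<le> (real m * T r + ln C) / real (d i)"
      unfolding a_eq[OF i r] by (intro divide_right_mono) auto
    also have "\<dots> = real m / real (d i) * T r + ln C / real (d i)" by (simp add: add_divide_distrib)
    also have "ln C / real (d i) \<le> \<bar>ln C\<bar> / 1" using d[OF i] by (intro frac_le) auto
    finally show ?thesis by simp
  qed
  define C0 where "C0 = \<bar>T 1\<bar>"
  have T0: "0 \<le> T r + C0" if "r \<ge> 1" for r
  proof -
    have "T 1 \<le> T r" unfolding T_def using norm_f_mono[OF that] N[of 1] N[OF that] by simp
    then show ?thesis by (simp add: C0_def)
  qed
  have "\<exists>C. \<forall>i\<in>?S. \<forall>r\<ge>1. a i r \<le> T r + C"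
  proof (rule uniform_constant)
    fix i assume i: "i \<in> ?S"
    obtain c where c: "c > 0" "\<And>r. r \<ge> 1 \<Longrightarrow> c \<le> w i r" using lower[OF i] by blast
    have "a i r \<le> T r + \<bar>ln (1 / c)\<bar>" if r: "r \<ge> 1" for r
    proof -
      have "norm_f r ^ d i * 1 \<le> norm_f r ^ d i * (w i r / c)"
        using c N[OF r] r by (intro mult_left_mono) auto
      then have "norm_f r ^ d i \<le> 1 / c * w i r * norm_f r ^ d i" by (simp add: mult_ac)
      then have "a i r \<le> real (d i) / real (d i) * T r + \<bar>ln (1 / c)\<bar>"
        using c(1) by (intro a_le i r) auto
      then show ?thesis using d[OF i] by simp
    qed
    then show "\<exists>C. \<forall>r\<ge>1. a i r \<le> T r + C" by blast
  qed (auto intro: order_trans)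
  then obtain C1 where C1: "\<And>i r. i \<in> ?S \<Longrightarrow> r \<ge> 1 \<Longrightarrow> a i r \<le> T r + C1" by blast
  have "\<exists>C. \<forall>J\<in>{J. J \<subseteq> ?S \<and> card J = n + 1}. \<forall>r\<ge>1. \<exists>i\<in>J. a i r \<le> C"
  proof (rule uniform_constant)
    fix J assume "J \<in> {J. J \<subseteq> ?S \<and> card J = n + 1}"
    then have J: "J \<subseteq> ?S" "card J = n + 1" by auto
    then have J': "finite J" "J \<noteq> {}" by (auto intro: finite_subset)
    have "zariski_dim (points (inter_with X Q J)) \<le> ereal (real n - real (card J))"
      using gp[OF J(1)] J(2) by simp
    also have "\<dots> < 0" using J(2) by (simp add: zero_ereal_def)
    finally have "points (inter_with X Q J) = {}"
      by (intro zariski_dim_negative_imp_empty) (auto simp: points_def)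
    then have "\<exists>C>0. \<forall>r\<ge>1. \<exists>i\<in>J. norm_f r ^ d i \<le> C * w i r"
      unfolding w_def using Q J(1) by (intro empty_intersection_estimate[OF X assms(12) J']) auto
    then obtain C where C: "C > 0" "\<And>r. r \<ge> 1 \<Longrightarrow> \<exists>i\<in>J. norm_f r ^ d i \<le> C * w i r" by blast
    have "\<exists>i\<in>J. a i r \<le> \<bar>ln C\<bar>" if r: "r \<ge> 1" for r
    proof -
      obtain i where "i \<in> J" "norm_f r ^ d i \<le> C * w i r" using C(2)[OF r] by blast
      then show ?thesis using a_le[of i r C 0] J(1) r C(1) by (intro bexI[of _ i]) auto
    qed
    then show "\<exists>C. \<forall>r\<ge>1. \<exists>i\<in>J. a i r \<le> C" by blast
  next
    show "finite {J. J \<subseteq> ?S \<and> card J = n + 1}" by (rule finite_subset[of _ "Pow ?S"]) auto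
  qed (meson order_trans)
  then obtain C2 where C2: "\<And>J r. J \<subseteq> ?S \<Longrightarrow> card J = n + 1 \<Longrightarrow> r \<ge> 1 \<Longrightarrow> \<exists>i\<in>J. a i r \<le> C2" by blast
  have "\<exists>C. \<forall>J\<in>{J. J \<subseteq> ?S \<and> card J = n}. \<forall>r\<ge>1. \<exists>i\<in>J. a i r \<le> \<mu> * T r + C"
  proof (rule uniform_constant)
    fix J assume "J \<in> {J. J \<subseteq> ?S \<and> card J = n}"
    then have J: "J \<subseteq> ?S" "card J = n" by auto
    then have J': "finite J" "J \<noteq> {}" using assms(5) by (auto intro: finite_subset)
    have "zariski_dim (points (inter_with X Q J)) \<le> ereal (real n - real (card J))"
      using gp[OF J(1)] J(2) by simp
    then have "zariski_dim (points (inter_with X Q J)) \<le> 0" using J(2) by (simp add: zero_ereal_def)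
    moreover have "closedin zariski (points (inter_with X Q J))"
      using closedin_points_inter_with[OF X J'(1), of d Q] Q J(1) by blast
    ultimately have "finite (points (inter_with X Q J))" by (intro zero_dimensional_imp_finite)
    then have "\<exists>C>0. \<forall>r\<ge>1. \<exists>i\<in>J. norm_f r ^ d i \<le> C * w i r * norm_f r ^ M"
      unfolding w_def using Q J(1) assms(10)[OF J]
      by (intro zero_dimensional_intersection_estimate[OF assms(13) X assms(12) J']) auto
    then obtain C where C: "C > 0" "\<And>r. r \<ge> 1 \<Longrightarrow> \<exists>i\<in>J. norm_f r ^ d i \<le> C * w i r * norm_f r ^ M" by blast
    have "\<exists>i\<in>J. a i r \<le> \<mu> * T r + (\<bar>ln C\<bar> + \<mu> * C0)" if r: "r \<ge> 1" for r
    proof -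
      obtain i where i: "i \<in> J" "norm_f r ^ d i \<le> C * w i r * norm_f r ^ M" using C(2)[OF r] by blast
      then have iS: "i \<in> ?S" using J(1) by blast
      have "a i r \<le> real M / real (d i) * T r + \<bar>ln C\<bar>" using a_le[OF iS r C(1) i(2)] .
      also have "real M / real (d i) * T r \<le> real M / real (d i) * (T r + C0)"
        by (intro mult_left_mono) (auto simp: C0_def)
      also have "\<dots> \<le> \<mu> * (T r + C0)" using \<mu>[OF iS] T0[OF r] by (rule mult_right_mono)
      finally show ?thesis using i(1) by (intro bexI[of _ i]) (auto simp: algebra_simps)
    qed
    then show "\<exists>C. \<forall>r\<ge>1. \<exists>i\<in>J. a i r \<le> \<mu> * T r + C" by blast
  next
    show "finite {J. J \<subseteq> ?S \<and> card J = n}" by (rule finite_subset[of _ "Pow ?S"]) auto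
  qed (meson add_left_mono order_trans)
  then obtain C3 where C3: "\<And>J r. J \<subseteq> ?S \<Longrightarrow> card J = n \<Longrightarrow> r \<ge> 1 \<Longrightarrow> \<exists>i\<in>J. a i r \<le> \<mu> * T r + C3" by blast
  define C where "C = max (max C0 C1) (max C2 C3)"
  have CC: "C0 \<le> C" "C1 \<le> C" "C2 \<le> C" "C3 \<le> C" by (auto simp: C_def)
  have "(\<Sum>i\<in>?S. a i r) \<le> (real n - 1 + \<mu>) * T r + (real (card ?S) + real n + \<mu>) * C" if r: "r \<ge> 1" for r
  proof (rule sum_le_of_few_large_terms)
    show "0 \<le> C" using CC(1) by (simp add: C0_def)
    show "0 \<le> T r + C" using T0[OF r] CC(1) by linarith
    show "a i r \<le> T r + C" if "i \<in> ?S" for i using C1[OF that r] CC(2) by linarith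
    show "\<exists>i\<in>J. a i r \<le> C" if "J \<subseteq> ?S" "card J = n + 1" for J using C2[OF that r] CC(3) by (meson order_trans)
    show "\<exists>i\<in>J. a i r \<le> \<mu> * T r + C" if "J \<subseteq> ?S" "card J = n" for J
      using C3[OF that r] CC(4) by (meson add_left_mono order_trans)
  qed (use assms(5) \<mu>0 in auto)
  then show ?thesis unfolding a_def \<mu>_def T_def characteristic_fun_def by blast
qed

end
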